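(* Let a hyperelliptic curve of genus $g$ (in the canonical form described in the context) have all branch points real. For a subset $I'\subseteq\{1,2,\dots,g\}$ put $\Omega'(I')=\sum_{k\in I'}\tfrac12\omega'_k$ and $\mathfrak{U}_{\Re}(I')=\Omega'(I')+\mathbb{R}^g\subset\mathbb{C}^g$. Then among the $2^g$ affine subspaces $\mathfrak{U}_{\Re}(I')$, where $I'$ runs over all subsets of $\{1,2,\dots,g\}$, there exists only one which contains no zeros of the sigma function. With the choice of cycles described in the context, this subspace corresponds to $\hat I'=\{1,2,\dots,g\}$, that is $$\Omega'(\hat I')=\sum_{k=1}^{g}\tfrac12\omega'_k,$$ and so $u\in\mathfrak{U}_{\Re}(\hat I')$ has the form $u=s+\Omega'(\hat I')$, $s\in\mathbb{R}^g$.
   Context: The curve is non-degenerate, $y^2=\Lambda(x)=x^{2g+1}+\sum_{i=0}^{2g}\lambda_{2i+2}x^{2g-i}$, with real branch points (roots of $\Lambda$) $e_1<e_2<\dots<e_{2g+1}$. Cuts are made between $e_{2k-1}$ and $e_{2k}$, $k=1,\dots,g$, and from $e_{2g+1}$ to $\infty$; $\mathfrak{a}_k$ encircles the cut $(e_{2k-1},e_{2k})$, and $\mathfrak{b}_k$ emerges from the cut $(e_{2k-1},e_{2k})$ and enters the cut $(e_{2g+1},\infty)$. Differentials (with $\lambda_0=1$): $$\mathrm{d}u_{2n-1}=\frac{x^{g-n}\mathrm{d}x}{-2y},\qquad \mathrm{d}r_{2n-1}=\frac{\mathrm{d}x}{-2y}\sum_{j=0}^{2n-2}(2n-1-j)\lambda_{2j}x^{g+n-1-j},\qquad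 n=1,\dots,g,$$ $\mathrm{d}u=(\mathrm{d}u_1,\mathrm{d}u_3,\dots,\mathrm{d}u_{2g-1})^t$, $\mathrm{d}r=(\mathrm{d}r_1,\mathrm{d}r_3,\dots,\mathrm{d}r_{2g-1})^t$. The matrices $\omega,\omega',\eta$ have columns $$\omega_k=\oint_{\mathfrak{a}_k}\mathrm{d}u=2\int_{e_{2k-1}}^{e_{2k}}\mathrm{d}u,\quad \omega'_k=\oint_{\mathfrak{b}_k}\mathrm{d}u=2\sum_{i=k}^{g}\int_{e_{2i}}^{e_{2i+1}}\mathrm{d}u,\quad \eta_k=\oint_{\mathfrak{a}_k}\mathrm{d}r=2\int_{e_{2k-1}}^{e_{2k}}\mathrm{d}r,$$ the integrals being along the real axis (regularized in the usual sense), with $y$ the boundary values from the upper half-plane of one fixed analytic branch of $\sqrt{\Lambda}$. Here $\omega$ is real and $\omega'$ purely imaginary; $\tau=\omega^{-1}\omega'$ is symmetric with $\operatorname{Im}\tau>0$; $\varkappa=\eta\omega^{-1}$ is symmetric. Theta function: $\theta(v;\tau)=\sum_{n\in\mathbb{Z}^g}\exp(\imath\pi n^t\tau n+2\imath\pi n^tv)$; with characteristic $[\varepsilon]=(\varepsilon',\varepsilon)^t$: $$\theta[\varepsilon](v;\tau)=\exp\big(\imath\pi(\varepsilon'^t/2)\tau(\varepsilon'/2)+2\imath\pi(v+\varepsilon/2)^t\varepsilon'/2\big)\,\theta(v+\varepsilon/2+\tau\varepsilon'/2;\tau).$$ The characteristic $[K]$ of the vector of Riemann constants is the sum modulo 2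 of the characteristics of the branch points $e_{2k}$, $k=1,\dots,g$, where $e_{2k}$ corresponds to the half-period $\tfrac12\omega'_k+\sum_{i=1}^k\tfrac12\omega_i$, a half-period $\tfrac12\omega\varepsilon+\tfrac12\omega'\varepsilon'$ having characteristic $(\varepsilon',\varepsilon)^t$; thus $[K]$ has $\varepsilon'_k=1$ and $\varepsilon_k\equiv g-k+1\pmod 2$. The sigma function is the entire function $$\sigma(u)=C\exp\big(-\tfrac12u^t\varkappa u\big)\,\theta[K](\omega^{-1}u;\omega^{-1}\omega'),\qquad u\in\mathbb{C}^g,$$ with a nonzero constant $C$. *)

theory Defs
  imports "HOL-Analysis.Analysis"
begin

text \<open>
  The genus is \<^term>\<open>CARD('g)\<close>, where the index type \<^typ>\<open>'g\<close> is finite and linearly ordered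
  (for instance a numeral type); \<^term>\<open>ix k\<close> below is the position of \<^term>\<open>k\<close>, running through
  1, ..., g in increasing order. A subset of {1, ..., g} is a set over \<^typ>\<open>'g\<close>, the full set
  being \<^term>\<open>UNIV\<close>. The entry \<^term>\<open>A $ n $ k\<close> of a matrix has row n and column k.
\<close>

type_synonym 'g cvec = "(complex, 'g) vec"
type_synonym 'g cmat = "((complex, 'g) vec, 'g) vec"
type_synonym 'g characteristic = "(int, 'g) vec \<times> (int, 'g) vec" \<comment> \<open>(eps', eps)\<close>

definition ix :: "'g::{finite,linorder} \<Rightarrow> nat" where
  "ix k = card {..k}"

lemma bij_betw_ix: "bij_betw (ix :: 'g::{finite,linorder} \<Rightarrow> nat) UNIV {1..CARD('g)}"
proof -
  have mono: "ix j < ix k" if "j < k" for j k :: 'g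
    unfolding ix_def by (rule psubset_card_mono) (use that in auto)
  have inj: "inj (ix :: 'g \<Rightarrow> nat)"
    by (rule injI) (metis mono less_irrefl not_less_iff_gr_or_eq)
  have "ix k \<in> {1..CARD('g)}" for k :: 'g
    unfolding ix_def by (auto simp: card_mono Suc_le_eq card_gt_0_iff)
  then have sub: "range (ix :: 'g \<Rightarrow> nat) \<subseteq> {1..CARD('g)}" by auto
  have "range (ix :: 'g \<Rightarrow> nat) = {1..CARD('g)}"
    by (rule card_subset_eq) (use sub inj in \<open>auto simp: card_image\<close>)
  with inj show ?thesis by (simp add: bij_betw_def)
qed

subsection \<open>The curve and its differentials\<close>

definition Lambda :: "nat \<Rightarrow> (nat \<Rightarrow> complex) \<Rightarrow> complex \<Rightarrow> complex" where
  "Lambda g lam x = x ^ (2*g + 1) + (\<Sum>i=0..2*g. lam (2*i + 2) * x ^ (2*g - i))"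

definition sqrt_branch :: "(complex \<Rightarrow> complex) \<Rightarrow> (complex \<Rightarrow> complex) \<Rightarrow> bool" where
  "sqrt_branch L Y \<longleftrightarrow>
     Y holomorphic_on {z. Im z > 0} \<and> (\<forall>z. Im z > 0 \<longrightarrow> Y z ^ 2 = L z)"

definition boundary_value :: "(complex \<Rightarrow> complex) \<Rightarrow> real \<Rightarrow> complex" where
  "boundary_value Y x = Lim (at (complex_of_real x) within {z. Im z > 0}) Y"

text \<open>Coefficients of dx in the differentials with subscript 2n - 1, as functions of (x, y).\<close>

definition du :: "nat \<Rightarrow> nat \<Rightarrow> complex \<Rightarrow> complex \<Rightarrow> complex" where
  "du g n x y = x ^ (g - n) / (- 2 * y)"

definition dr :: "nat \<Rightarrow> (nat \<Rightarrow> complex) \<Rightarrow> nat \<Rightarrow> complex \<Rightarrow> complex \<Rightarrow> complex" where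
  "dr g lam n x y =
     (\<Sum>j=0..2*n - 2. of_nat (2*n - 1 - j) * lam (2*j) * x ^ (g + n - 1 - j)) / (- 2 * y)"

text \<open>
  Integrals along the real axis from above. Between neighbouring branch points the integrands have
  at worst inverse square root singularities at the end points, so the gauge integral is the
  (convergent) improper integral.
\<close>

definition real_axis_integral ::
    "(complex \<Rightarrow> complex) \<Rightarrow> (complex \<Rightarrow> complex \<Rightarrow> complex) \<Rightarrow> real \<Rightarrow> real \<Rightarrow> complex" where
  "real_axis_integral Y f a b =
     integral {a..b} (\<lambda>x. f (complex_of_real x) (boundary_value Y x))"

subsection \<open>Period matrices\<close>

definition omega :: "(nat \<Rightarrow> real) \<Rightarrow> (complex \<Rightarrow> complex) \<Rightarrow> 'g::{finite,linorder} cmat" where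
  "omega e Y = (\<chi> n k. 2 * real_axis_integral Y (du CARD('g) (ix n))
                             (e (2 * ix k - 1)) (e (2 * ix k)))"

definition omega' :: "(nat \<Rightarrow> real) \<Rightarrow> (complex \<Rightarrow> complex) \<Rightarrow> 'g::{finite,linorder} cmat" where
  "omega' e Y = (\<chi> n k. 2 * (\<Sum>i=ix k..CARD('g).
                    real_axis_integral Y (du CARD('g) (ix n)) (e (2 * i)) (e (2 * i + 1))))"

definition eta ::
    "(nat \<Rightarrow> complex) \<Rightarrow> (nat \<Rightarrow> real) \<Rightarrow> (complex \<Rightarrow> complex) \<Rightarrow> 'g::{finite,linorder} cmat" where
  "eta lam e Y = (\<chi> n k. 2 * real_axis_integral Y (dr CARD('g) lam (ix n))
                              (e (2 * ix k - 1)) (e (2 * ix k)))"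

definition tau :: "(nat \<Rightarrow> real) \<Rightarrow> (complex \<Rightarrow> complex) \<Rightarrow> 'g::{finite,linorder} cmat" where
  "tau e Y = matrix_inv (omega e Y) ** omega' e Y"

definition kappa ::
    "(nat \<Rightarrow> complex) \<Rightarrow> (nat \<Rightarrow> real) \<Rightarrow> (complex \<Rightarrow> complex) \<Rightarrow> 'g::{finite,linorder} cmat" where
  "kappa lam e Y = eta lam e Y ** matrix_inv (omega e Y)"

subsection \<open>Theta functions with characteristics\<close>

text \<open>The bilinear product, without complex conjugation (unlike the library's inner product).\<close>

definition bdot :: "'n::finite cvec \<Rightarrow> 'n::finite cvec \<Rightarrow> complex" where
  "bdot u v = (\<Sum>i\<in>UNIV. u $ i * v $ i)"

definition cvec_of_int :: "int^'n \<Rightarrow> 'n::finite cvec" where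
  "cvec_of_int n = (\<chi> i. of_int (n $ i))"

definition cvec_of_real :: "real^'n \<Rightarrow> 'n::finite cvec" where
  "cvec_of_real s = (\<chi> i. complex_of_real (s $ i))"

definition theta :: "'n::finite cvec \<Rightarrow> 'n::finite cmat \<Rightarrow> complex" where
  "theta v T = (\<Sum>\<^sub>\<infinity>n\<in>(UNIV :: (int^'n) set).
     exp (\<i> * of_real pi * bdot (cvec_of_int n) (T *v cvec_of_int n)
          + 2 * \<i> * of_real pi * bdot (cvec_of_int n) v))"

definition theta_char ::
    "'n::finite characteristic \<Rightarrow> 'n::finite cvec \<Rightarrow> 'n::finite cmat \<Rightarrow> complex" where
  "theta_char c v T =
     (let a = (1/2) *s cvec_of_int (fst c); b = (1/2) *s cvec_of_int (snd c)
      in exp (\<i> * of_real pi * bdot a (T *v a) + 2 * \<i> * of_real pi * bdot (v + b) a)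
         * theta (v + b + T *v a) T)"

definition half_period ::
    "(nat \<Rightarrow> real) \<Rightarrow> (complex \<Rightarrow> complex) \<Rightarrow> 'g characteristic
      \<Rightarrow> 'g::{finite,linorder} cvec" where
  "half_period e Y c = (1/2) *s (omega e Y *v cvec_of_int (snd c))
                     + (1/2) *s (omega' e Y *v cvec_of_int (fst c))"

text \<open>The characteristic of the branch point with number 2k; see \<open>half_period_even_branch_char\<close>.\<close>

definition even_branch_char :: "'g::{finite,linorder} \<Rightarrow> 'g characteristic" where
  "even_branch_char k = ((\<chi> j. if j = k then 1 else 0), (\<chi> j. if j \<le> k then 1 else 0))"

lemma half_period_even_branch_char:
  "half_period e Y (even_branch_char k) =
     (1/2) *s column k (omega' e Y) + (\<Sum>i | i \<le> k. (1/2) *s column i (omega e Y))"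
  by (simp add: half_period_def even_branch_char_def vec_eq_iff matrix_vector_mult_def
      cvec_of_int_def column_def sum_distrib_left if_distrib sum.If_cases cong: if_cong)

definition K_char :: "'g::{finite,linorder} characteristic" where
  "K_char = ((\<chi> j. (\<Sum>k\<in>UNIV. fst (even_branch_char k) $ j) mod 2),
             (\<chi> j. (\<Sum>k\<in>UNIV. snd (even_branch_char k) $ j) mod 2))"

lemma K_char_eq:
  "(K_char :: 'g::{finite,linorder} characteristic) = ((\<chi> j. 1), (\<chi> j. int (CARD('g) - ix j + 1) mod 2))"
proof -
  have "int (card {k. j \<le> k}) = int (CARD('g) - ix j + 1)" for j :: 'g
  proof -
    have "card {..j} + card {j<..} = CARD('g)"
      by (subst card_Un_disjoint [symmetric]) (auto intro: arg_cong [where f = card])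
    moreover have "card {k. j \<le> k} = Suc (card {j<..})"
      by (subst card_insert_disjoint [symmetric]) (auto intro: arg_cong [where f = card])
    ultimately show ?thesis unfolding ix_def by simp
  qed
  then show ?thesis
    by (simp add: K_char_def even_branch_char_def vec_eq_iff sum.If_cases)
qed

subsection \<open>The sigma function and the affine subspaces\<close>

definition sigma_fun ::
    "(nat \<Rightarrow> complex) \<Rightarrow> (nat \<Rightarrow> real) \<Rightarrow> (complex \<Rightarrow> complex) \<Rightarrow> complex
      \<Rightarrow> 'g::{finite,linorder} cvec \<Rightarrow> complex" where
  "sigma_fun lam e Y C u =
     C * exp (- (1/2) * bdot u (kappa lam e Y *v u))
       * theta_char K_char (matrix_inv (omega e Y) *v u) (tau e Y)"

definition Omega' ::
    "(nat \<Rightarrow> real) \<Rightarrow> (complex \<Rightarrow> complex) \<Rightarrow> 'g set \<Rightarrow> 'g::{finite,linorder} cvec" where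
  "Omega' e Y I = (\<Sum>k\<in>I. (1/2) *s column k (omega' e Y))"

definition U_Re ::
    "(nat \<Rightarrow> real) \<Rightarrow> (complex \<Rightarrow> complex) \<Rightarrow> 'g set \<Rightarrow> ('g::{finite,linorder} cvec) set" where
  "U_Re e Y I = range (\<lambda>s :: (real, 'g) vec. Omega' e Y I + cvec_of_real s)"

end

theory Submission
  imports Defs "HOL-Probability.Characteristic_Functions" "HOL-Complex_Analysis.Cauchy_Integral_Formula"
    "HOL-Real_Asymp.Real_Asymp"
begin

text \<open>
  After multiplication by \<open>\<omega>\<^sup>-\<^sup>1\<close> the subspace of \<open>I'\<close> becomes the set of all
  \<open>x + \<i> T h\<close> with \<open>x\<close> real, where \<open>\<tau> = \<i> T\<close> and \<open>h\<close> is \<open>1/2\<close> on \<open>I'\<close> and \<open>0\<close> elsewhere.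
  Together with the characteristic of the Riemann constants, \<open>\<sigma>\<close> vanishes there iff
  \<open>\<Sum>n. exp (- \<pi> (n + a)\<^sup>t T (n + a)) exp (2 \<pi> \<i> (n + a)\<^sup>t x)\<close> does (at a shifted \<open>x\<close>), where
  \<open>a\<close> is \<open>1\<close> on \<open>I'\<close> and \<open>1/2\<close> elsewhere. If some \<open>a\<^sub>k = 1/2\<close>, this series is
  real and changes sign under \<open>x\<^sub>k \<mapsto> x\<^sub>k + 1\<close>, so it has a zero. If \<open>a\<close> is integral, the series
  is positive: a product of Fejer kernels is nonnegative, and multiplying Fourier coefficients
  by a Gaussian is an average over translates.

  That \<open>T\<close> is symmetric and positive definite (Riemann's bilinear relations) is seen on the upper
  half-plane. The boundary values of \<open>p dx / y\<close>, for a real polynomial \<open>p\<close> of degree less than \<open>g\<close>,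
  are real on the cuts and imaginary on the gaps between them. If \<open>F\<^sub>p\<close> is the primitive vanishing at
  infinity, then \<open>\<integral> F\<^sub>p dF\<^sub>q = 0\<close> over the real line by Cauchy's theorem,
  \<open>\<integral> cnj F\<^sub>p dF\<^sub>q\<close> is anti-Hermitian, and for \<open>p = q\<close> its imaginary part is twice the area covered by
  \<open>F\<^sub>p\<close>. Combining these expresses the symmetric positive form through the a- and b-periods.
\<close>

text \<open>Nonnegativity of Fejer kernels survives the passage to the limit only as
  \<open>0 \<le>\<close>, while \<open>\<sigma>\<close> must not vanish at all. Strictness comes
  from splitting the form into \<open>\<epsilon> * (v \<bullet> v)\<close> plus squares of linear
  forms. The first part factors over the coordinates, and in each of them the Gaussian average of a
  Fejer kernel is at least some \<open>m > 0\<close> that does not depend on the truncation. The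
  squares are then added one at a time by averaging over a single direction, which keeps the bound
  \<open>m ^ CARD('n)\<close>. All averages act on finite sums; the infinite series enters only in
  the last limit.

  For the periods the obstacle is the branch points: the differentials are unbounded there, and
  nothing may be integrated through them along closed contours. Cauchy's theorem is therefore used
  on horizontal lines at positive height, and only dominated convergence leads down to the real
  line. The form to be evaluated is the integral of \<open>Re f * Im G\<close>, with
  \<open>G\<close> a primitive: of the two factors one vanishes or the other is constant on every
  interval between branch points, so only finitely many products of periods remain.\<close>

text \<open>The majorant makes the finite partial sums converge uniformly in the parameter
  (Weierstrass), which permits the exchange of the two limits.\<close>

lemma tendsto_infsum_dominated:
  fixes f :: "'b \<Rightarrow> 'a \<Rightarrow> 'c::banach"
  assumes lim: "\<And>n. n \<in> A \<Longrightarrow> ((\<lambda>y. f y n) \<longlongrightarrow> g n) F"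
    and bound: "\<And>y n. n \<in> A \<Longrightarrow> norm (f y n) \<le> M n"
    and M: "M summable_on A" and F: "F \<noteq> bot"
  shows "((\<lambda>y. infsum (f y) A) \<longlongrightarrow> infsum g A) F"
proof -
  have gM: "norm (g n) \<le> M n" if "n \<in> A" for n
    by (rule tendsto_upperbound[OF tendsto_norm[OF lim[OF that]] _ F]) (use bound that in auto)
  have "(\<lambda>n. norm (g n)) summable_on A"
    using M by (rule Infinite_Sum.abs_summable_on_comparison_test') (rule gM)
  then have g: "(g has_sum infsum g A) A"
    using abs_summable_summable has_sum_infsum by blast
  have u: "uniform_limit UNIV (\<lambda>X y. \<Sum>n\<in>X. f y n) (\<lambda>y. infsum (f y) A) (finite_subsets_at_top A)"
    by (rule Weierstrass_m_test_general) (use bound M in auto)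
  show ?thesis
  proof (rule swap_uniform_limit'[OF _ _ u])
    show "\<forall>\<^sub>F X in finite_subsets_at_top A. ((\<lambda>y. \<Sum>n\<in>X. f y n) \<longlongrightarrow> sum g X) F"
      by (rule eventually_finite_subsets_at_top_weakI) (auto intro!: tendsto_sum lim)
    show "(sum g \<longlongrightarrow> infsum g A) (finite_subsets_at_top A)"
      using g by (simp add: has_sum_def)
  qed auto
qed

subsection \<open>Sums of squares\<close>

lemma inner_matrix_commute:
  fixes B :: "real^'n^'n"
  assumes "transpose B = B"
  shows "v \<bullet> (B *v w) = w \<bullet> (B *v v)"
  by (metis assms dot_lmul_matrix inner_commute transpose_matrix_vector)

text \<open>Along the direction \<open>axis k 1\<close> the form is affine when the diagonal entry
  is zero, and an affine function with nonzero slope takes negative values.\<close>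

lemma psd_zero_diagonal:
  fixes B :: "real^'n^'n"
  assumes sym: "transpose B = B" and psd: "\<And>v. 0 \<le> v \<bullet> (B *v v)" and k: "B $ k $ k = 0"
  shows "B $ k = 0"
proof (rule ccontr)
  assume "B $ k \<noteq> 0"
  then obtain j where j: "B $ k $ j \<noteq> 0" by (auto simp: vec_eq_iff)
  define c where "c = axis j 1 \<bullet> (B *v axis j (1::real))"
  have kj: "axis k 1 \<bullet> (B *v axis j 1) = B $ k $ j" 
    by (simp add: inner_axis' matrix_vector_mult_basis column_def)
  have kk: "axis k 1 \<bullet> (B *v axis k 1) = 0" 
    using k by (simp add: inner_axis' matrix_vector_mult_basis column_def)
  \<comment> \<open>Chosen to make the value -1: the quadratic term is absent and
    \<open>2 * s * B $ k $ j = - (c + 1)\<close>.\<close>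
  define s where "s = - (c + 1) / (2 * B $ k $ j)"
  have "(s *\<^sub>R axis k 1 + axis j 1) \<bullet> (B *v (s *\<^sub>R axis k 1 + axis j 1))
     = s * s * (axis k 1 \<bullet> (B *v axis k 1)) + 2 * s * (axis k 1 \<bullet> (B *v axis j 1)) + c"
    using inner_matrix_commute[OF sym, of "axis j 1" "axis k 1"]
    by (simp add: c_def matrix_vector_right_distrib inner_add_left inner_add_right
        matrix_vector_mult_scaleR algebra_simps)
  also have "\<dots> = -1" using j unfolding kk kj s_def by (simp add: field_simps)
  finally show False using psd[of "s *\<^sub>R axis k 1 + axis j 1"] by simp
qed

text \<open>Lagrange reduction: each step completes one square and passes to a Schur complement.
  \<open>K\<close> holds the rows that may still be nonzero and at the same time indexes the
  squares, so the induction runs over it.\<close>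

lemma psd_sum_of_squares_aux:
  fixes B :: "real^'n^'n"
  assumes "finite K" and "transpose B = B" and "\<And>v. 0 \<le> v \<bullet> (B *v v)"
    and "\<And>i. i \<notin> K \<Longrightarrow> B $ i = 0"
  shows "\<exists>L :: 'n \<Rightarrow> real^'n. \<forall>v. v \<bullet> (B *v v) = (\<Sum>k\<in>K. (L k \<bullet> v)\<^sup>2)"
  using assms
proof (induction K arbitrary: B rule: finite_induct)
  case empty
  then have "B = 0" by (auto simp: vec_eq_iff)
  then show ?case by simp
next
  case (insert k K B)
  note sym = insert.prems(1) and psd = insert.prems(2) and rows = insert.prems(3)
  show ?case
  proof (cases "B $ k $ k = 0")
    case True
    then have "B $ k = 0" using psd_zero_diagonal[OF sym psd] by blast
    then have "B $ i = 0" if "i \<notin> K" for i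
      using rows that by (cases "i = k") auto
    then obtain L :: "'n \<Rightarrow> real^'n" where L: "\<And>v. v \<bullet> (B *v v) = (\<Sum>k\<in>K. (L k \<bullet> v)\<^sup>2)"
      using insert.IH[OF sym psd] by blast
    show ?thesis
    proof (intro exI[of _ "L(k := 0)"] allI)
      fix v
      have "(\<Sum>i\<in>K. ((L(k := 0)) i \<bullet> v)\<^sup>2) = (\<Sum>i\<in>K. (L i \<bullet> v)\<^sup>2)"
        using insert.hyps by (intro sum.cong) auto
      then show "v \<bullet> (B *v v) = (\<Sum>i\<in>insert k K. ((L(k := 0)) i \<bullet> v)\<^sup>2)"
        using insert.hyps by (simp add: L)
    qed
  next
    case False
    define b where "b = B $ k $ k"
    have bk: "axis k 1 \<bullet> (B *v axis k 1) = b"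
      by (simp add: inner_axis' matrix_vector_mult_basis column_def b_def)
    with psd[of "axis k 1"] False have b: "b > 0" by (simp add: b_def)
    have Bsym: "B $ i $ j = B $ j $ i" for i j
      using arg_cong[OF sym, of "\<lambda>M. M $ i $ j"] by (simp add: transpose_def)
    have row: "axis k 1 \<bullet> (B *v v) = B $ k \<bullet> v" for v
      by (simp add: inner_axis' matrix_vector_mul_component)
    \<comment> \<open>The Schur complement of \<open>b\<close>: removing the matrix of the square
      \<open>(B $ k \<bullet> v)^2 / b\<close> clears row \<open>k\<close> and leaves zero rows
      zero.\<close>
    define B' where "B' = (\<chi> i j. B $ i $ j - B $ k $ i * B $ k $ j / b)"
    have B'v: "B' *v v = B *v v - ((B $ k \<bullet> v) / b) *\<^sub>R (B $ k)" for v
    proof -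
      have "(B' *v v) $ i = (B *v v) $ i - (B $ k \<bullet> v) / b * B $ k $ i" for i
      proof -
        have "(B' *v v) $ i = (\<Sum>j\<in>UNIV. B $ i $ j * v $ j - B $ k $ i / b * (B $ k $ j * v $ j))"
          unfolding matrix_vector_mult_def B'_def
          by (simp only: vec_lambda_beta) (intro sum.cong refl, simp add: algebra_simps)
        also have "\<dots> = (B *v v) $ i - B $ k $ i / b * (B $ k \<bullet> v)"
          by (simp add: sum_subtractf sum_distrib_left matrix_vector_mult_def inner_vec_def)
        finally show ?thesis by simp
      qed
      then show ?thesis by (simp add: vec_eq_iff)
    qed
    have q: "v \<bullet> (B *v v) = v \<bullet> (B' *v v) + (B $ k \<bullet> v)\<^sup>2 / b" for v
      by (simp add: B'v inner_diff_right power2_eq_square inner_commute)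
    have sym': "transpose B' = B'"
      by (simp add: B'_def transpose_def vec_eq_iff Bsym mult.commute)
    have psd': "0 \<le> v \<bullet> (B' *v v)" for v
    proof -
      \<comment> \<open>\<open>v - c *\<^sub>R axis k 1\<close> minimizes the form of
        \<open>B\<close> on the line through \<open>v\<close> in direction \<open>k\<close>; the
        minimum is the form of \<open>B'\<close> at \<open>v\<close>.\<close>
      define c where "c = (B $ k \<bullet> v) / b"
      have "(v - c *\<^sub>R axis k 1) \<bullet> (B *v (v - c *\<^sub>R axis k 1))
         = v \<bullet> (B *v v) - 2 * c * (axis k 1 \<bullet> (B *v v)) + c * c * b"
        using inner_matrix_commute[OF sym, of v "axis k 1"] bk
        by (simp add: matrix_vector_mult_diff_distrib inner_diff_left inner_diff_right
            matrix_vector_mult_scaleR algebra_simps)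
      also have "\<dots> = v \<bullet> (B' *v v)"
        using b by (simp add: row q c_def power2_eq_square field_simps)
      finally show ?thesis using psd by metis
    qed
    have rows': "B' $ i = 0" if "i \<notin> K" for i
    proof (cases "i = k")
      case True
      then show ?thesis using b by (simp add: B'_def vec_eq_iff b_def[symmetric] Bsym)
    next
      case False
      then have "B $ i = 0" using rows that by auto
      moreover have "B $ k $ i = 0" using Bsym[of k i] \<open>B $ i = 0\<close> by simp
      ultimately show ?thesis by (simp add: B'_def vec_eq_iff)
    qed
    obtain L :: "'n \<Rightarrow> real^'n" where L: "\<And>v. v \<bullet> (B' *v v) = (\<Sum>k\<in>K. (L k \<bullet> v)\<^sup>2)"
      using insert.IH[OF sym' psd' rows'] by blast
    show ?thesis
    proof (intro exI[of _ "L(k := (1 / sqrt b) *\<^sub>R (B $ k))"] allI)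
      fix v
      have "(\<Sum>i\<in>K. ((L(k := (1 / sqrt b) *\<^sub>R (B $ k))) i \<bullet> v)\<^sup>2) = (\<Sum>i\<in>K. (L i \<bullet> v)\<^sup>2)"
        using insert.hyps by (intro sum.cong) auto
      then show "v \<bullet> (B *v v) = (\<Sum>i\<in>insert k K. ((L(k := (1 / sqrt b) *\<^sub>R (B $ k))) i \<bullet> v)\<^sup>2)"
        using insert.hyps b by (simp add: q L power_divide)
    qed
  qed
qed

lemma psd_sum_of_squares:
  fixes B :: "real^'n^'n"
  assumes "transpose B = B" and "\<And>v. 0 \<le> v \<bullet> (B *v v)"
  obtains L :: "'n \<Rightarrow> real^'n" where "\<And>v. v \<bullet> (B *v v) = (\<Sum>k\<in>UNIV. (L k \<bullet> v)\<^sup>2)"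
  using psd_sum_of_squares_aux[of UNIV B] assms by auto

lemma posdef_lower_bound:
  fixes T :: "real^'n^'n"
  assumes "\<And>v. v \<noteq> 0 \<Longrightarrow> 0 < v \<bullet> (T *v v)"
  obtains \<epsilon> where "\<epsilon> > 0" "\<And>v. \<epsilon> * (v \<bullet> v) \<le> v \<bullet> (T *v v)"
proof -
  have "continuous_on (sphere 0 1) (\<lambda>v. v \<bullet> (T *v v))"
    by (intro continuous_intros matrix_vector_mult_linear_continuous_on)
  moreover have "sphere (0::real^'n) 1 \<noteq> {}"
    by (metis norm_axis_1 mem_sphere_0 empty_iff)
  ultimately obtain u where u: "u \<in> sphere 0 1" "\<And>v. v \<in> sphere 0 1 \<Longrightarrow> u \<bullet> (T *v u) \<le> v \<bullet> (T *v v)"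
    using continuous_attains_inf[OF compact_sphere] by blast
  show thesis
  proof
    show "u \<bullet> (T *v u) > 0" using u(1) by (intro assms) auto
    fix v :: "real^'n"
    show "(u \<bullet> (T *v u)) * (v \<bullet> v) \<le> v \<bullet> (T *v v)"
    proof (cases "v = 0")
      case False
      define w where "w = (1 / norm v) *\<^sub>R v"
      have "u \<bullet> (T *v u) \<le> w \<bullet> (T *v w)" using False by (intro u(2)) (simp add: w_def)
      also have "\<dots> = (v \<bullet> (T *v v)) / (v \<bullet> v)"
        by (simp add: w_def matrix_vector_mult_scaleR dot_square_norm power2_eq_square)
      finally show ?thesis using False by (simp add: field_simps)
    qed auto
  qed
qed

subsection \<open>Trigonometric polynomials averaged against Gaussians\<close>

lemma gaussian_average_cos:
  "integral\<^sup>L std_normal_distribution (\<lambda>z. cos (a + t * z)) = exp (- t\<^sup>2 / 2) * cos a"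
proof -
  interpret real_distribution std_normal_distribution by (rule real_dist_normal_dist)
  have 1: "integral\<^sup>L std_normal_distribution (\<lambda>z. iexp (t * z)) = complex_of_real (exp (- t\<^sup>2 / 2))"
    using fun_cong[OF char_std_normal_distribution, of t] by (simp add: char_def)
  have i: "integrable std_normal_distribution (\<lambda>z. iexp (t * z))"
    by (rule integrable_const_bound[where B = 1]) auto
  have "integral\<^sup>L std_normal_distribution (\<lambda>z. Re (iexp a * iexp (t * z)))
     = Re (integral\<^sup>L std_normal_distribution (\<lambda>z. iexp a * iexp (t * z)))"
    by (rule integral_Re) (use i in auto)
  also have "\<dots> = Re (iexp a * complex_of_real (exp (- t\<^sup>2 / 2)))"
    by (subst integral_mult_right_zero) (simp only: 1)
  also have "(\<lambda>z. Re (iexp a * iexp (t * z))) = (\<lambda>z. cos (a + t * z))"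
    by (auto simp: fun_eq_iff cis_conv_exp[symmetric] cis_mult simp flip: of_real_mult)
  finally show ?thesis by (simp add: cis_conv_exp[symmetric] mult.commute)
qed

lemma integrable_std_normal_cos: "integrable std_normal_distribution (\<lambda>z. cos (a + t * z))"
proof -
  interpret real_distribution std_normal_distribution by (rule real_dist_normal_dist)
  show ?thesis by (rule integrable_const_bound[where B = 1]) auto
qed

definition real_vec :: "int^'n \<Rightarrow> real^'n" where
  "real_vec n = (\<chi> i. of_int (n $ i))"

text \<open>The bound is averaged over the translates \<open>x + r z l\<close> with \<open>z\<close> normally distributed.\<close>

lemma gaussian_multiplier_preserves_bound:
  fixes l :: "real^'n"
  assumes m: "\<And>x. m \<le> (\<Sum>n\<in>S. c n * cos (2 * pi * (real_vec n \<bullet> x)))"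
  shows "m \<le> (\<Sum>n\<in>S. c n * exp (- pi * (l \<bullet> real_vec n)\<^sup>2) * cos (2 * pi * (real_vec n \<bullet> x)))"
proof -
  interpret real_distribution std_normal_distribution by (rule real_dist_normal_dist)
  \<comment> \<open>The average of \<open>cos (a + t * z)\<close> carries the factor
    \<open>exp (- t^2 / 2)\<close>; this \<open>r\<close> turns \<open>t = 2 * pi * r * y\<close>
    into \<open>exp (- pi * y^2)\<close>.\<close>
  define r where "r = 1 / sqrt (2 * pi)"
  have r2: "(2 * pi * r * y)\<^sup>2 / 2 = pi * y\<^sup>2" for y
    by (simp add: r_def power_mult_distrib power_divide field_simps power2_eq_square)
  define h where "h n z = c n * cos (2 * pi * (real_vec n \<bullet> x) + (2 * pi * r * (l \<bullet> real_vec n)) * z)" for n z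
  have h: "h n z = c n * cos (2 * pi * (real_vec n \<bullet> (x + (r * z) *\<^sub>R l)))" for n z
    by (simp add: h_def inner_add_right algebra_simps inner_commute)
  have int: "integrable std_normal_distribution (h n)" for n
    unfolding h_def by (intro integrable_mult_right integrable_std_normal_cos)
  have "m = integral\<^sup>L std_normal_distribution (\<lambda>z. m)" using prob_space by simp
  also have "\<dots> \<le> integral\<^sup>L std_normal_distribution (\<lambda>z. \<Sum>n\<in>S. h n z)"
    by (intro integral_mono Bochner_Integration.integrable_sum int) (use m in \<open>simp_all add: h\<close>)
  also have "\<dots> = (\<Sum>n\<in>S. integral\<^sup>L std_normal_distribution (h n))"
    by (intro Bochner_Integration.integral_sum int)
  also have "\<dots> = (\<Sum>n\<in>S. c n * exp (- pi * (l \<bullet> real_vec n)\<^sup>2) * cos (2 * pi * (real_vec n \<bullet> x)))"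
    unfolding h_def
    by (intro sum.cong refl, subst integral_mult_right_zero, subst gaussian_average_cos)
       (simp add: r2)
  finally show ?thesis .
qed

text \<open>Every factor is an average against a probability measure, so the constant
  \<open>m\<close> passes through unchanged however many squares are added.\<close>

lemma gaussian_multipliers_preserve_bound:
  fixes L :: "'k \<Rightarrow> real^'n"
  assumes "finite K" and m: "\<And>x. m \<le> (\<Sum>n\<in>S. c n * cos (2 * pi * (real_vec n \<bullet> x)))"
  shows "m \<le> (\<Sum>n\<in>S. c n * exp (- pi * (\<Sum>k\<in>K. (L k \<bullet> real_vec n)\<^sup>2)) * cos (2 * pi * (real_vec n \<bullet> x)))"
  using assms(1)
proof (induction K arbitrary: x rule: finite_induct)
  case (insert k K x)
  have "m \<le> (\<Sum>n\<in>S. (c n * exp (- pi * (\<Sum>k\<in>K. (L k \<bullet> real_vec n)\<^sup>2)))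
        * exp (- pi * (L k \<bullet> real_vec n)\<^sup>2) * cos (2 * pi * (real_vec n \<bullet> x)))"
    by (rule gaussian_multiplier_preserves_bound) (rule insert.IH)
  also have "\<dots> = (\<Sum>n\<in>S. c n * exp (- pi * (\<Sum>k\<in>insert k K. (L k \<bullet> real_vec n)\<^sup>2)) * cos (2 * pi * (real_vec n \<bullet> x)))"
    using insert.hyps
    by (intro sum.cong refl) (simp add: mult.assoc algebra_simps flip: exp_add)
  finally show ?case .
qed (use m in simp)

lemma sum_differences:
  fixes g :: "int \<Rightarrow> real"
  shows "(\<Sum>j<N. \<Sum>k<N. g (int j - int k)) = (\<Sum>n=-int N..int N. (real N - \<bar>real_of_int n\<bar>) * g n)"
proof (induction N)
  case (Suc N)
  have row: "(\<Sum>k<Suc N. g (int N - int k)) = (\<Sum>n=0..int N. g n)"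
    by (rule sum.reindex_bij_witness[where i = "\<lambda>n. nat (int N - n)" and j = "\<lambda>k. int N - int k"]) auto
  have col: "(\<Sum>j<N. g (int j - int N)) = (\<Sum>n=-int N..-1. g n)"
    by (rule sum.reindex_bij_witness[where i = "\<lambda>n. nat (n + int N)" and j = "\<lambda>j. int j - int N"]) auto
  have split: "{-int N..int N} = {-int N..-1} \<union> {0..int N}" by auto
  have "(\<Sum>j<Suc N. \<Sum>k<Suc N. g (int j - int k))
     = (\<Sum>j<N. \<Sum>k<N. g (int j - int k)) + (\<Sum>j<N. g (int j - int N)) + (\<Sum>k<Suc N. g (int N - int k))"
    by (simp add: sum.distrib)
  also have "\<dots> = (\<Sum>n=-int N..int N. (real N - \<bar>real_of_int n\<bar>) * g n) + (\<Sum>n=-int N..int N. g n)"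
    unfolding row col Suc.IH split by (subst (2) sum.union_disjoint) auto
  also have "\<dots> = (\<Sum>n=-int N..int N. (real (Suc N) - \<bar>real_of_int n\<bar>) * g n)"
    by (simp add: sum.distrib[symmetric] algebra_simps)
  also have "\<dots> = (\<Sum>n=-int (Suc N)..int (Suc N). (real (Suc N) - \<bar>real_of_int n\<bar>) * g n)"
  \<comment> \<open>The two end terms that are new in the larger range have weight zero.\<close>
  proof (rule sum.mono_neutral_left)
    show "\<forall>i\<in>{- int (Suc N)..int (Suc N)} - {- int N..int N}. (real (Suc N) - \<bar>real_of_int i\<bar>) * g i = 0"
    proof
      fix i assume "i \<in> {- int (Suc N)..int (Suc N)} - {- int N..int N}"
      then have "i = int (Suc N) \<or> i = - int (Suc N)" by auto
      then show "(real (Suc N) - \<bar>real_of_int i\<bar>) * g i = 0" by auto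
    qed
  qed auto
  finally show ?case .
qed simp

text \<open>The weight of \<open>n\<close> counts the pairs \<open>j, k < N\<close> with difference
  \<open>n\<close>, so the sum is the squared modulus of
  \<open>\<Sum>j<N. cis (j * y)\<close>.\<close>

lemma fejer_nonneg: "0 \<le> (\<Sum>n=-int N..int N. (real N - \<bar>real_of_int n\<bar>) * cos (real_of_int n * y))"
proof -
  have "(\<Sum>n=-int N..int N. (real N - \<bar>real_of_int n\<bar>) * cos (real_of_int n * y))
     = (\<Sum>j<N. \<Sum>k<N. cos (real_of_int (int j - int k) * y))"
    by (rule sum_differences[symmetric])
  also have "\<dots> = (\<Sum>j<N. cos (j * y))\<^sup>2 + (\<Sum>j<N. sin (j * y))\<^sup>2"
    by (simp add: power2_eq_square sum_product sum.distrib left_diff_distrib cos_diff)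
  also have "\<dots> \<ge> 0" by simp
  finally show ?thesis .
qed

definition fejer_weight :: "nat \<Rightarrow> int \<Rightarrow> real" where
  "fejer_weight N n = (real N - \<bar>real_of_int n\<bar>) / real N"

text \<open>The kernel is nonnegative, so its Gaussian average is at least the contribution of one
  period. There the kernel has mean 1 and the density is bounded below, whatever \<open>N\<close>
  and \<open>x\<close> are.\<close>

lemma fejer_gaussian_lower_bound:
  assumes eps: "\<epsilon> > 0"
  obtains m where "m > 0" "\<And>N x. N > 0 \<Longrightarrow>
    m \<le> (\<Sum>n=-int N..int N. fejer_weight N n * exp (- pi * \<epsilon> * (real_of_int n)\<^sup>2) * cos (2 * pi * real_of_int n * x))"
proof
  \<comment> \<open>With this scale the translates \<open>x + b * z\<close> produce exactly the
    factor \<open>exp (- pi * \<epsilon> * n^2)\<close>, and \<open>z\<close> in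
    \<open>{0..1/b}\<close> sweeps one period.\<close>
  define b where "b = sqrt (\<epsilon> / (2 * pi))"
  have b: "b > 0" using eps by (simp add: b_def)
  \<comment> \<open>The normal density is decreasing on \<open>{0..1/b}\<close>, hence smallest at
    the right end; \<open>1 / b\<close> is the integral of the kernel over that interval.\<close>
  define m where "m = std_normal_density (1 / b) / b"
  show "m > 0" using b by (simp add: m_def normal_density_pos)
  fix N :: nat and x :: real
  assume N: "N > 0"
  interpret real_distribution std_normal_distribution by (rule real_dist_normal_dist)
  define h where "h n z = fejer_weight N n * cos (2 * pi * real_of_int n * x + (2 * pi * real_of_int n * b) * z)" for n z
  define K where "K z = (\<Sum>n=-int N..int N. h n z)" for z
  have K_nonneg: "K z \<ge> 0" for z
  proof -
    have "K z = (\<Sum>n=-int N..int N. (real N - \<bar>real_of_int n\<bar>) * cos (real_of_int n * (2 * pi * (x + b * z)))) / real N"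
      by (simp add: K_def h_def fejer_weight_def sum_divide_distrib algebra_simps)
    then show ?thesis using fejer_nonneg[of N] by simp
  qed
  have int: "integrable std_normal_distribution (h n)" for n
    unfolding h_def by (intro integrable_mult_right integrable_std_normal_cos)
  have b2: "(2 * pi * real_of_int n * b)\<^sup>2 / 2 = pi * \<epsilon> * (real_of_int n)\<^sup>2" for n
    using eps by (simp add: b_def power_mult_distrib power2_eq_square field_simps)
  have Eh: "integral\<^sup>L std_normal_distribution (h n)
     = fejer_weight N n * exp (- pi * \<epsilon> * (real_of_int n)\<^sup>2) * cos (2 * pi * real_of_int n * x)" for n
  proof -
    have "- (2 * pi * real_of_int n * b)\<^sup>2 / 2 = - pi * \<epsilon> * (real_of_int n)\<^sup>2"
      using b2[of n] by simp
    then show ?thesis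
      unfolding h_def by (subst integral_mult_right_zero, subst gaussian_average_cos) (simp only: mult.assoc)
  qed
  have E: "integral\<^sup>L std_normal_distribution K
     = (\<Sum>n=-int N..int N. fejer_weight N n * exp (- pi * \<epsilon> * (real_of_int n)\<^sup>2) * cos (2 * pi * real_of_int n * x))"
    unfolding K_def by (subst Bochner_Integration.integral_sum, rule int, simp only: Eh)
  \<comment> \<open>Over a full period all frequencies except \<open>n = 0\<close> integrate to
    zero.\<close>
  have hint: "(h n has_integral (if n = 0 then 1 / b else 0)) {0..1/b}" for n
  proof (cases "n = 0")
    case True
    then have "h n = (\<lambda>z. 1)" using N by (auto simp: h_def fejer_weight_def)
    then show ?thesis using True b has_integral_const_real[of "1::real" 0 "1/b"] by simp
  next
    case False
    define c where "c = 2 * pi * real_of_int n * b"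
    define a where "a = 2 * pi * real_of_int n * x"
    have c: "c \<noteq> 0" using False b by (simp add: c_def)
    have "((\<lambda>z. fejer_weight N n * cos (a + c * z)) has_integral
        (fejer_weight N n * sin (a + c * (1/b)) / c - fejer_weight N n * sin (a + c * 0) / c)) {0..1/b}"
      using b c by (intro fundamental_theorem_of_calculus)
        (auto intro!: derivative_eq_intros simp flip: has_real_derivative_iff_has_vector_derivative)
    moreover have "sin (a + c * (1/b)) = sin a"
    proof -
      have "c * (1/b) = 2 * pi * real_of_int n" using b by (simp add: c_def)
      then show ?thesis using sin.plus_of_int[of a n] by (simp add: algebra_simps)
    qed
    ultimately show ?thesis using False by (simp add: h_def[abs_def] a_def c_def)
  qed
  have K_int: "(K has_integral 1 / b) {0..1/b}"
  proof -
    have "((\<lambda>z. \<Sum>n=-int N..int N. h n z) has_integral (\<Sum>n=-int N..int N. if n = 0 then 1 / b else 0)) {0..1/b}"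
      by (intro has_integral_sum hint) auto
    then show ?thesis by (simp add: K_def[abs_def])
  qed
  have K_cont: "continuous_on A K" for A
    unfolding K_def h_def by (intro continuous_intros)
  have K_meas: "K \<in> borel_measurable borel"
    by (rule borel_measurable_continuous_onI[OF K_cont])
  have Kset: "set_integrable lborel {0..1/b} K"
    by (rule borel_integrable_atLeastAtMost'[OF K_cont])
  have "m = std_normal_density (1/b) * set_lebesgue_integral lborel {0..1/b} K"
    using set_borel_integral_eq_integral(2)[OF Kset] integral_unique[OF K_int] by (simp add: m_def)
  also have "\<dots> = integral\<^sup>L lborel (\<lambda>z. std_normal_density (1/b) * (indicator {0..1/b} z *\<^sub>R K z))"
    by (simp add: set_lebesgue_integral_def)
  also have "\<dots> \<le> integral\<^sup>L lborel (\<lambda>z. std_normal_density z * K z)"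
  proof (rule integral_mono)
    show "integrable lborel (\<lambda>z. std_normal_density (1/b) * (indicator {0..1/b} z *\<^sub>R K z))"
      using Kset by (auto simp: set_integrable_def)
    have "integrable std_normal_distribution K" unfolding K_def by (intro Bochner_Integration.integrable_sum int)
    then show "integrable lborel (\<lambda>z. std_normal_density z * K z)"
      using K_meas by (subst (asm) integrable_density) (auto simp: normal_density_nonneg)
    fix z :: real
    show "std_normal_density (1/b) * (indicator {0..1/b} z *\<^sub>R K z) \<le> std_normal_density z * K z"
    proof (cases "z \<in> {0..1/b}")
      case True
      then have "z\<^sup>2 \<le> (1/b)\<^sup>2" by (intro power_mono) auto
      then have "std_normal_density (1/b) \<le> std_normal_density z"
        by (auto simp: std_normal_density_def intro!: divide_right_mono)
      then show ?thesis using True K_nonneg by (simp add: mult_right_mono)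
    qed (simp add: K_nonneg normal_density_nonneg)
  qed
  also have "\<dots> = integral\<^sup>L std_normal_distribution K"
    using K_meas by (subst integral_density) (auto simp: normal_density_nonneg)
  finally show "m \<le> (\<Sum>n=-int N..int N. fejer_weight N n * exp (- pi * \<epsilon> * (real_of_int n)\<^sup>2) * cos (2 * pi * real_of_int n * x))"
    using E by simp
qed

subsection \<open>Positivity of the theta function at real arguments\<close>

lemma summable_on_geometric_int:
  fixes r :: real
  assumes "0 \<le> r" "r < 1"
  shows "(\<lambda>k::int. r ^ nat \<bar>k\<bar>) summable_on UNIV"
proof -
  have s: "(\<lambda>n. r ^ n) summable_on UNIV"
    using summable_geometric[of r] assms by (subst summable_on_UNIV_nonneg_real_iff) auto
  have 1: "(\<lambda>k. r ^ nat \<bar>k\<bar>) summable_on (int ` UNIV)"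
    using s by (subst summable_on_reindex) (auto simp: o_def)
  have 2: "(\<lambda>k. r ^ nat \<bar>k\<bar>) summable_on ((\<lambda>n. - int n) ` UNIV)"
    using s by (subst summable_on_reindex) (auto simp: o_def inj_on_def)
  have "(\<lambda>k. r ^ nat \<bar>k\<bar>) summable_on (int ` UNIV \<union> (\<lambda>n. - int n) ` UNIV)"
    by (rule summable_on_union[OF 1 2])
  also have "int ` UNIV \<union> (\<lambda>n. - int n) ` UNIV = UNIV"
    by (auto simp: image_iff) (metis int_cases2)
  finally show ?thesis .
qed

text \<open>The inequality \<open>y^2 \<ge> \<bar>y\<bar> - 1/4\<close> reduces the Gaussian to a
  two-sided geometric series.\<close>

lemma summable_gaussian_int:
  assumes c: "c > 0"
  shows "(\<lambda>k::int. exp (- c * (real_of_int k + a)\<^sup>2)) summable_on UNIV"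
proof (rule summable_on_comparison_test)
  show "(\<lambda>k::int. exp (c / 4 + c * \<bar>a\<bar>) * exp (- c) ^ nat \<bar>k\<bar>) summable_on UNIV"
    using c by (intro summable_on_cmult_right summable_on_geometric_int) auto
  fix k :: int
  define y where "y = real_of_int k + a"
  have "0 \<le> (\<bar>y\<bar> - 1/2)\<^sup>2" by simp
  then have "\<bar>y\<bar> - 1/4 \<le> y\<^sup>2" by (simp add: power2_eq_square algebra_simps)
  moreover have "\<bar>real_of_int k\<bar> - \<bar>a\<bar> \<le> \<bar>y\<bar>" unfolding y_def by linarith
  ultimately have "\<bar>real_of_int k\<bar> - \<bar>a\<bar> - 1/4 \<le> y\<^sup>2" by linarith
  then have "c * (\<bar>real_of_int k\<bar> - \<bar>a\<bar> - 1/4) \<le> c * y\<^sup>2"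
    using c by (intro mult_left_mono) auto
  then have "exp (- c * y\<^sup>2) \<le> exp (c / 4 + c * \<bar>a\<bar> + \<bar>real_of_int k\<bar> * (- c))"
    by (simp add: algebra_simps)
  also have "\<dots> = exp (c / 4 + c * \<bar>a\<bar>) * exp (- c) ^ nat \<bar>k\<bar>"
    by (simp only: exp_add) (simp flip: exp_of_nat_mult)
  finally show "exp (- c * (real_of_int k + a)\<^sup>2) \<le> exp (c / 4 + c * \<bar>a\<bar>) * exp (- c) ^ nat \<bar>k\<bar>"
    by (simp add: y_def)
qed auto

lemma bij_vec_lambda: "bij (vec_lambda :: ('n::finite \<Rightarrow> 'a) \<Rightarrow> 'a^'n)"
  by (rule bij_betwI[of _ _ _ vec_nth]) auto

lemma summable_on_prod_vec:
  fixes f :: "'n::finite \<Rightarrow> int \<Rightarrow> real"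
  assumes "\<And>i k. f i k \<ge> 0" and "\<And>i. f i summable_on UNIV"
  shows "(\<lambda>n::int^'n. \<Prod>i\<in>UNIV. f i (n $ i)) summable_on UNIV"
proof -
  have "Infinite_Set_Sum.abs_summable_on (\<lambda>g. \<Prod>i\<in>UNIV. f i (g i)) (PiE UNIV (\<lambda>_. UNIV))"
    by (intro abs_summable_on_prod_PiE)
       (use assms in \<open>auto simp: abs_summable_equivalent[symmetric]\<close>)
  then have "(\<lambda>g. \<Prod>i\<in>UNIV. f i (g i)) summable_on UNIV"
    using assms(1) by (simp add: abs_summable_equivalent[symmetric] prod_nonneg PiE_UNIV_domain)
  then have "((\<lambda>n::int^'n. \<Prod>i\<in>UNIV. f i (n $ i)) \<circ> vec_lambda) summable_on UNIV"
    by (simp add: o_def)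
  then show ?thesis
    using bij_vec_lambda[where 'n = 'n and 'a = int]
    by (subst (asm) summable_on_reindex[symmetric]) (auto simp: bij_def)
qed

locale posdef_form =
  fixes T :: "real^'n::finite^'n"
  assumes sym: "transpose T = T" and posdef: "\<And>v. v \<noteq> 0 \<Longrightarrow> 0 < v \<bullet> (T *v v)"
begin

definition Q :: "real^'n \<Rightarrow> real" where "Q v = v \<bullet> (T *v v)"

lemma Q_lower_bound: obtains \<epsilon> where "\<epsilon> > 0" "\<And>v. \<epsilon> * (v \<bullet> v) \<le> Q v"
  using posdef_lower_bound[OF posdef] that unfolding Q_def by blast

lemma summable_gaussian: "(\<lambda>n. exp (- pi * Q (real_vec n + a))) summable_on UNIV"
proof -
  obtain \<epsilon> where eps: "\<epsilon> > 0" "\<And>v. \<epsilon> * (v \<bullet> v) \<le> Q v" using Q_lower_bound by blast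
  show ?thesis
  proof (rule summable_on_comparison_test)
    show "(\<lambda>n::int^'n. \<Prod>i\<in>UNIV. exp (- (pi * \<epsilon>) * (real_of_int (n $ i) + a $ i)\<^sup>2)) summable_on UNIV"
      by (rule summable_on_prod_vec, simp, rule summable_gaussian_int) (use eps in simp)
    fix n :: "int^'n"
    have "(\<Sum>i\<in>UNIV. (real_of_int (n $ i) + a $ i)\<^sup>2) = (real_vec n + a) \<bullet> (real_vec n + a)"
      by (simp add: inner_vec_def real_vec_def power2_eq_square)
    then have "(\<Prod>i\<in>UNIV. exp (- (pi * \<epsilon>) * (real_of_int (n $ i) + a $ i)\<^sup>2))
       = exp (- pi * (\<epsilon> * ((real_vec n + a) \<bullet> (real_vec n + a))))"
      by (simp add: exp_sum[symmetric] sum_distrib_left[symmetric] sum_negf mult.assoc)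
    then show "exp (- pi * Q (real_vec n + a)) \<le> (\<Prod>i\<in>UNIV. exp (- (pi * \<epsilon>) * (real_of_int (n $ i) + a $ i)\<^sup>2))"
      using eps(2)[of "real_vec n + a"] by simp
  qed auto
qed

lemma theta_real_pos: "0 < (\<Sum>\<^sub>\<infinity>n\<in>UNIV. exp (- pi * Q (real_vec n)) * cos (2 * pi * (real_vec n \<bullet> x)))"
proof -
  obtain \<epsilon> where eps: "\<epsilon> > 0" "\<And>v. \<epsilon> * (v \<bullet> v) \<le> Q v" using Q_lower_bound by blast
  \<comment> \<open>What is left of \<open>T\<close> after the part that factors over the
    coordinates; it is semidefinite, and its squares supply the remaining Gaussian factors.\<close>
  define B where "B = T - \<epsilon> *\<^sub>R mat 1"
  have B: "v \<bullet> (B *v v) = Q v - \<epsilon> * (v \<bullet> v)" for v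
    by (simp add: B_def Q_def matrix_vector_mult_diff_rdistrib inner_diff_right scaleR_matrix_vector_assoc[symmetric])
  have "transpose B = B"
    using sym by (auto simp: B_def transpose_def vec_eq_iff mat_def)
  moreover have "0 \<le> v \<bullet> (B *v v)" for v using B eps(2) by simp
  ultimately obtain L :: "'n \<Rightarrow> real^'n" where "\<And>v. v \<bullet> (B *v v) = (\<Sum>k\<in>UNIV. (L k \<bullet> v)\<^sup>2)"
    using psd_sum_of_squares by metis
  then have L: "Q v = \<epsilon> * (v \<bullet> v) + (\<Sum>k\<in>UNIV. (L k \<bullet> v)\<^sup>2)" for v using B[of v] by simp
  obtain m where m: "m > 0" "\<And>N x. N > 0 \<Longrightarrow> m \<le> (\<Sum>n=-int N..int N.
      fejer_weight N n * exp (- pi * \<epsilon> * (real_of_int n)\<^sup>2) * cos (2 * pi * real_of_int n * x))"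
    by (rule fejer_gaussian_lower_bound[OF eps(1)]) blast
  define S where "S N = {n :: int^'n. \<forall>i. n $ i \<in> {-int N..int N}}" for N
  define w where "w N n = (\<Prod>i\<in>UNIV. fejer_weight N (n $ i))" for N and n :: "int^'n"
  define c where "c N n = (\<Prod>i\<in>UNIV. fejer_weight N (n $ i) * exp (- pi * \<epsilon> * (real_of_int (n $ i))\<^sup>2))" for N and n :: "int^'n"
  have S_image: "S N = vec_lambda ` (PiE UNIV (\<lambda>_. {-int N..int N}))" for N
  proof
    show "S N \<subseteq> vec_lambda ` (PiE UNIV (\<lambda>_. {-int N..int N}))"
    proof
      fix n assume "n \<in> S N"
      then have "n = vec_lambda (vec_nth n)" "vec_nth n \<in> PiE UNIV (\<lambda>_. {-int N..int N})"
        by (auto simp: S_def PiE_UNIV_domain)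
      then show "n \<in> vec_lambda ` (PiE UNIV (\<lambda>_. {-int N..int N}))" by blast
    qed
  qed (auto simp: S_def PiE_UNIV_domain Pi_iff)
  have finS: "finite (S N)" for N unfolding S_image by (intro finite_imageI finite_PiE) auto
  have c_eq: "c N n = w N n * exp (- pi * (\<epsilon> * (real_vec n \<bullet> real_vec n)))" for N n
    by (simp add: c_def w_def prod.distrib exp_sum[symmetric] sum_distrib_left[symmetric] sum_negf
        inner_vec_def real_vec_def power2_eq_square mult.assoc)
  have base: "m ^ CARD('n) \<le> (\<Sum>n\<in>S N. c N n * cos (2 * pi * (real_vec n \<bullet> x)))" if N: "N > 0" for N x
  proof -
    define a where "a k = fejer_weight N k * exp (- pi * \<epsilon> * (real_of_int k)\<^sup>2)" for k
    define G where "G t = (\<Sum>k=-int N..int N. a k * cos (2 * pi * real_of_int k * t))" for t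
    have a_even: "a (- k) = a k" for k by (simp add: a_def fejer_weight_def)
    \<comment> \<open>Exponentials replace cosines because a product of sums of \<open>cis\<close>
      expands into the functions \<open>cis (2 * pi * (real_vec n \<bullet> x))\<close>; the sines
      cancel since the coefficients are even.\<close>
    have G: "(\<Sum>k=-int N..int N. complex_of_real (a k) * cis (2 * pi * real_of_int k * t)) = complex_of_real (G t)" for t
    proof -
      have "(\<Sum>k=-int N..int N. a k * sin (2 * pi * real_of_int k * t))
          = (\<Sum>k=-int N..int N. a (- k) * sin (2 * pi * real_of_int (- k) * t))"
        by (rule sum.reindex_bij_witness[where i = uminus and j = uminus]) auto
      also have "\<dots> = - (\<Sum>k=-int N..int N. a k * sin (2 * pi * real_of_int k * t))"
        by (simp add: a_even sum_negf)
      finally have "(\<Sum>k=-int N..int N. a k * sin (2 * pi * real_of_int k * t)) = 0" by simp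
      then show ?thesis by (simp add: complex_eq_iff G_def)
    qed
    have cis_eq: "(\<Prod>i\<in>UNIV. complex_of_real (a (n $ i)) * cis (2 * pi * real_of_int (n $ i) * x $ i))
       = complex_of_real (c N n) * cis (2 * pi * (real_vec n \<bullet> x))" for n
    proof -
      have "(\<Prod>i\<in>UNIV. cis (2 * pi * real_of_int (n $ i) * x $ i)) = cis (2 * pi * (real_vec n \<bullet> x))"
        by (simp add: cis_conv_exp exp_sum[symmetric] sum_distrib_left inner_vec_def real_vec_def mult.assoc)
      then show ?thesis by (simp add: prod.distrib c_def a_def)
    qed
    have "complex_of_real (\<Prod>i\<in>UNIV. G (x $ i))
       = (\<Prod>i\<in>UNIV. \<Sum>k=-int N..int N. complex_of_real (a k) * cis (2 * pi * real_of_int k * x $ i))"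
      by (simp add: G)
    also have "\<dots> = (\<Sum>g\<in>PiE UNIV (\<lambda>_. {-int N..int N}). \<Prod>i\<in>UNIV. complex_of_real (a (g i)) * cis (2 * pi * real_of_int (g i) * x $ i))"
      by (rule prod_sum_PiE) auto
    also have "\<dots> = (\<Sum>n\<in>S N. \<Prod>i\<in>UNIV. complex_of_real (a (n $ i)) * cis (2 * pi * real_of_int (n $ i) * x $ i))"
      unfolding S_image by (subst sum.reindex) (auto intro: inj_on_subset[OF bij_is_inj[OF bij_vec_lambda]])
    also have "\<dots> = (\<Sum>n\<in>S N. complex_of_real (c N n) * cis (2 * pi * (real_vec n \<bullet> x)))"
      by (simp only: cis_eq)
    finally have "(\<Prod>i\<in>UNIV. G (x $ i)) = Re (\<Sum>n\<in>S N. complex_of_real (c N n) * cis (2 * pi * (real_vec n \<bullet> x)))"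
      by (metis Re_complex_of_real)
    then have "(\<Prod>i\<in>UNIV. G (x $ i)) = (\<Sum>n\<in>S N. c N n * cos (2 * pi * (real_vec n \<bullet> x)))"
      by simp
    moreover have "m ^ CARD('n) \<le> (\<Prod>i\<in>(UNIV::'n set). G (x $ i))"
    proof -
      have "(\<Prod>i\<in>(UNIV::'n set). m) \<le> (\<Prod>i\<in>UNIV. G (x $ i))"
        using m N by (intro prod_mono) (auto simp: G_def a_def mult.assoc)
      then show ?thesis by simp
    qed
    ultimately show ?thesis by simp
  qed
  \<comment> \<open>Extension by zero off the box \<open>S N\<close> puts all truncations on one
    index set, as dominated convergence requires.\<close>
  define F where "F N n = (if n \<in> S N then w N n else 0) * (exp (- pi * Q (real_vec n)) * cos (2 * pi * (real_vec n \<bullet> x)))" for N n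
  have F_sum: "m ^ CARD('n) \<le> (\<Sum>\<^sub>\<infinity>n\<in>UNIV. F N n)" if "N > 0" for N
  proof -
    have "m ^ CARD('n) \<le> (\<Sum>n\<in>S N. c N n * exp (- pi * (\<Sum>k\<in>UNIV. (L k \<bullet> real_vec n)\<^sup>2)) * cos (2 * pi * (real_vec n \<bullet> x)))"
      by (rule gaussian_multipliers_preserve_bound) (use base that in auto)
    also have "\<dots> = (\<Sum>n\<in>S N. F N n)"
    proof (intro sum.cong refl)
      fix n assume "n \<in> S N"
      have "exp (- pi * Q (real_vec n)) = exp (- pi * (\<epsilon> * (real_vec n \<bullet> real_vec n)))
          * exp (- pi * (\<Sum>k\<in>UNIV. (L k \<bullet> real_vec n)\<^sup>2))"
        by (simp add: L distrib_left flip: exp_add)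
      then show "c N n * exp (- pi * (\<Sum>k\<in>UNIV. (L k \<bullet> real_vec n)\<^sup>2)) * cos (2 * pi * (real_vec n \<bullet> x)) = F N n"
        using \<open>n \<in> S N\<close> by (simp add: F_def c_eq)
    qed
    also have "\<dots> = (\<Sum>\<^sub>\<infinity>n\<in>S N. F N n)" using finS by (simp add: infsum_finite)
    also have "\<dots> = (\<Sum>\<^sub>\<infinity>n\<in>UNIV. F N n)" by (rule infsum_cong_neutral) (auto simp: F_def)
    finally show ?thesis .
  qed
  have lim: "(\<lambda>N. F N n) \<longlonglongrightarrow> exp (- pi * Q (real_vec n)) * cos (2 * pi * (real_vec n \<bullet> x))" for n
  proof -
    have "(\<lambda>N. fejer_weight N k) \<longlonglongrightarrow> 1" for k
      unfolding fejer_weight_def by real_asymp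
    then have "(\<lambda>N. w N n) \<longlonglongrightarrow> (\<Prod>i\<in>(UNIV::'n set). 1)"
      unfolding w_def by (intro tendsto_prod)
    moreover have "eventually (\<lambda>N. (if n \<in> S N then w N n else 0) = w N n) sequentially"
      using eventually_ge_at_top[of "Max (range (\<lambda>i. nat \<bar>n $ i\<bar>))"]
    proof eventually_elim
      case (elim N)
      have "n $ i \<in> {-int N..int N}" for i
      proof -
        have "nat \<bar>n $ i\<bar> \<le> Max (range (\<lambda>i. nat \<bar>n $ i\<bar>))" by (intro Max_ge) auto
        with elim have "nat \<bar>n $ i\<bar> \<le> N" by linarith
        then show ?thesis by auto
      qed
      then show ?case by (simp add: S_def)
    qed
    ultimately have "(\<lambda>N. if n \<in> S N then w N n else 0) \<longlonglongrightarrow> 1"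
      by (simp add: tendsto_cong)
    then show ?thesis unfolding F_def by (auto intro!: tendsto_eq_intros)
  qed
  have w_bound: "\<bar>if n \<in> S N then w N n else 0\<bar> \<le> 1" for N n
  proof (cases "n \<in> S N")
    case True
    have "0 \<le> fejer_weight N (n $ i) \<and> fejer_weight N (n $ i) \<le> 1" for i
    proof -
      have "n $ i \<in> {-int N..int N}" using True by (simp add: S_def)
      then have "\<bar>n $ i\<bar> \<le> int N" by auto
      then have "\<bar>real_of_int (n $ i)\<bar> \<le> real N" by linarith
      then show ?thesis by (auto simp: fejer_weight_def divide_le_eq)
    qed
    then have "0 \<le> w N n" "w N n \<le> 1" unfolding w_def by (auto intro!: prod_nonneg prod_le_1)
    then show ?thesis by simp
  qed simp
  have "(\<lambda>N. \<Sum>\<^sub>\<infinity>n\<in>UNIV. F N n) \<longlonglongrightarrow> (\<Sum>\<^sub>\<infinity>n\<in>UNIV. exp (- pi * Q (real_vec n)) * cos (2 * pi * (real_vec n \<bullet> x)))"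
  proof (rule tendsto_infsum_dominated[OF lim])
    show "(\<lambda>n. exp (- pi * Q (real_vec n))) summable_on (UNIV :: (int^'n) set)"
      using summable_gaussian[of 0] by simp
    show "norm (F N n) \<le> exp (- pi * Q (real_vec n))" for N n
      using mult_mono[OF w_bound[of n N] abs_cos_le_one[of "2 * pi * (real_vec n \<bullet> x)"]]
      by (simp add: F_def abs_mult mult.left_commute[of _ "exp _"] mult_left_le)
  qed auto
  then have "m ^ CARD('n) \<le> (\<Sum>\<^sub>\<infinity>n\<in>UNIV. exp (- pi * Q (real_vec n)) * cos (2 * pi * (real_vec n \<bullet> x)))"
    by (rule tendsto_lowerbound[OF _ eventually_sequentiallyI[of 1]]) (auto intro: F_sum)
  then show ?thesis using m(1) by (meson less_le_trans zero_less_power)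
qed

end

section \<open>Theta functions with period matrix i T at real shifts of half-integral imaginary
  parts\<close>

lemma real_vec_add: "real_vec (m + n) = real_vec m + real_vec n"
  by (simp add: real_vec_def vec_eq_iff)

lemma real_vec_minus: "real_vec (- n) = - real_vec n"
  by (simp add: real_vec_def vec_eq_iff)

context posdef_form
begin

definition Tc :: "'n cmat" where "Tc = (\<chi> i j. \<i> * complex_of_real (T $ i $ j))"

text \<open>
  Up to a nowhere vanishing factor, \<open>Theta a x\<close> is the theta function at \<open>x + \<i> T a\<close>; in this
  normalisation it depends on \<open>a\<close> modulo the integers only.
\<close>

definition Theta :: "real^'n \<Rightarrow> real^'n \<Rightarrow> complex" where
  "Theta a x = (\<Sum>\<^sub>\<infinity>n\<in>UNIV. complex_of_real (exp (- pi * Q (real_vec n + a))) * cis (2 * pi * ((real_vec n + a) \<bullet> x)))"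

lemma bdot_cvec_of_real: "bdot (cvec_of_real u) (cvec_of_real v) = complex_of_real (u \<bullet> v)"
  by (simp add: bdot_def cvec_of_real_def inner_vec_def)

lemma Tc_cvec_of_real: "Tc *v cvec_of_real u = \<i> *s cvec_of_real (T *v u)"
  by (simp add: vec_eq_iff Tc_def cvec_of_real_def matrix_vector_mult_def sum_distrib_left mult.assoc)

lemma cvec_of_int_eq: "cvec_of_int n = cvec_of_real (real_vec n)"
  by (simp add: cvec_of_int_def cvec_of_real_def real_vec_def)

lemma bdot_add_right: "bdot u (v + w) = bdot u v + bdot u w"
  by (simp add: bdot_def distrib_left sum.distrib)

lemma bdot_scale_right: "bdot u (c *s v) = c * bdot u v"
  by (simp add: bdot_def sum_distrib_left mult.left_commute)

lemma Q_add: "Q (u + v) = Q u + 2 * (u \<bullet> (T *v v)) + Q v"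
  using inner_matrix_commute[OF sym, of u v]
  by (simp add: Q_def matrix_vector_right_distrib inner_add_left inner_add_right)

text \<open>Completing the square by \<open>Q_add\<close>; the factor left over depends on
  \<open>a\<close> and \<open>x\<close> but not on the summation index.\<close>

lemma theta_eq_Theta:
  "theta (cvec_of_real x + Tc *v cvec_of_real a) Tc
     = complex_of_real (exp (pi * Q a)) * cis (- (2 * pi * (a \<bullet> x))) * Theta a x"
proof -
  have "exp (\<i> * of_real pi * bdot (cvec_of_int n) (Tc *v cvec_of_int n)
          + 2 * \<i> * of_real pi * bdot (cvec_of_int n) (cvec_of_real x + Tc *v cvec_of_real a))
     = (complex_of_real (exp (pi * Q a)) * cis (- (2 * pi * (a \<bullet> x)))) *
       (complex_of_real (exp (- pi * Q (real_vec n + a))) * cis (2 * pi * ((real_vec n + a) \<bullet> x)))" for n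
  proof -
    have "\<i> * of_real pi * bdot (cvec_of_int n) (Tc *v cvec_of_int n)
          + 2 * \<i> * of_real pi * bdot (cvec_of_int n) (cvec_of_real x + Tc *v cvec_of_real a)
      = complex_of_real (pi * Q a) + \<i> * complex_of_real (- (2 * pi * (a \<bullet> x)))
        + (complex_of_real (- pi * Q (real_vec n + a)) + \<i> * complex_of_real (2 * pi * ((real_vec n + a) \<bullet> x)))"
      unfolding cvec_of_int_eq Tc_cvec_of_real bdot_add_right bdot_scale_right bdot_cvec_of_real Q_add
      by (simp add: complex_eq_iff Q_def inner_add_left algebra_simps)
    then show ?thesis
      by (simp only: exp_add cis_conv_exp exp_of_real)
  qed
  then show ?thesis
    unfolding theta_def Theta_def by (simp only: infsum_cmult_right')
qed

lemma Theta_add_int: "Theta (a + real_vec m) x = Theta a x"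
proof -
  have "bij_betw (\<lambda>n. n + m) (UNIV :: (int^'n) set) UNIV"
    by (rule bij_betwI[of _ _ _ "\<lambda>n. n - m"]) auto
  from infsum_reindex_bij_betw[OF this, of "\<lambda>n. complex_of_real (exp (- pi * Q (real_vec n + a))) * cis (2 * pi * ((real_vec n + a) \<bullet> x))"]
  show ?thesis unfolding Theta_def by (simp add: real_vec_add add_ac)
qed

lemma Theta_terms_abs_summable:
  "(\<lambda>n. norm (complex_of_real (exp (- pi * Q (real_vec n + a))) * cis (2 * pi * ((real_vec n + a) \<bullet> x)))) summable_on UNIV"
  using summable_gaussian[of a] by (simp add: norm_mult)

lemma Theta_0_nonzero: "Theta 0 x \<noteq> 0"
proof -
  have "Re (Theta 0 x) = (\<Sum>\<^sub>\<infinity>n\<in>UNIV. exp (- pi * Q (real_vec n)) * cos (2 * pi * (real_vec n \<bullet> x)))"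
    unfolding Theta_def
    by (subst infsum_Re[symmetric]) (use abs_summable_summable[OF Theta_terms_abs_summable[of 0 x]] in auto)
  with theta_real_pos[of x] show ?thesis by (metis less_irrefl zero_complex.sel(1))
qed

text \<open>The reflection \<open>n \<mapsto> - n - m\<close> sends \<open>real_vec n + a\<close> to
  its negative, so it conjugates the series term by term.\<close>

lemma Theta_half_int_real:
  assumes "2 *\<^sub>R a = real_vec m"
  shows "Im (Theta a x) = 0"
proof -
  have eq: "real_vec (- n - m) + a = - (real_vec n + a)" for n
    using real_vec_add[of "- n - m" m] assms
    by (simp add: real_vec_minus algebra_simps scaleR_2 flip: assms)
  have Qm: "Q (- v) = Q v" for v
    using matrix_vector_mult_scaleR[of T "-1" v] by (simp add: Q_def)
  have "bij_betw (\<lambda>n. - n - m) (UNIV :: (int^'n) set) UNIV"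
    by (rule bij_betwI[of _ _ _ "\<lambda>n. - n - m"]) auto
  from infsum_reindex_bij_betw[OF this, of "\<lambda>n. complex_of_real (exp (- pi * Q (real_vec n + a))) * cis (2 * pi * ((real_vec n + a) \<bullet> x))"]
  have "Theta a x = (\<Sum>\<^sub>\<infinity>n\<in>UNIV. cnj (complex_of_real (exp (- pi * Q (real_vec n + a))) * cis (2 * pi * ((real_vec n + a) \<bullet> x))))"
    unfolding Theta_def eq Qm
    by (simp only: inner_minus_left complex_cnj_mult complex_cnj_complex_of_real cis_cnj mult_minus_right)
  also have "\<dots> = cnj (Theta a x)" unfolding Theta_def by (rule infsum_cnj)
  finally show ?thesis by (metis Im_complex_of_real Reals_cnj_iff complex_is_Real_iff)
qed

text \<open>The coordinate \<open>k\<close> of every \<open>real_vec n + a\<close> is half an odd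
  integer, so each phase turns by an odd multiple of \<pi>.\<close>

lemma Theta_add_axis:
  assumes "2 *\<^sub>R a = real_vec m" and "odd (m $ k)"
  shows "Theta a (x + axis k 1) = - Theta a x"
proof -
  have "cis (2 * pi * ((real_vec n + a) \<bullet> (x + axis k 1))) = - cis (2 * pi * ((real_vec n + a) \<bullet> x))" for n
  proof -
    have "2 * a $ k = real_of_int (m $ k)"
      using arg_cong[OF assms(1), of "\<lambda>v. v $ k"] by (simp add: real_vec_def)
    moreover obtain j where "m $ k = 2 * j + 1" using assms(2) by (rule oddE)
    ultimately have "2 * pi * ((real_vec n + a) \<bullet> (x + axis k 1))
      = 2 * pi * ((real_vec n + a) \<bullet> x) + pi + 2 * pi * real_of_int (n $ k + j)"
      by (simp add: inner_add_right inner_axis real_vec_def algebra_simps)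
    then show ?thesis
      by (simp only: cis_mult[symmetric] cis_pi cis_multiple_2pi Ints_of_int) simp
  qed
  then show ?thesis unfolding Theta_def by (simp add: infsum_uminus)
qed

lemma Theta_continuous: "continuous_on UNIV (\<lambda>t. Theta a (t *\<^sub>R u))"
proof (intro continuous_at_imp_continuous_on ballI)
  fix t :: real
  show "isCont (\<lambda>t. Theta a (t *\<^sub>R u)) t"
    unfolding isCont_def Theta_def
  proof (rule tendsto_infsum_dominated)
    show "(\<lambda>n::int^'n. exp (- pi * Q (real_vec n + a))) summable_on UNIV" by (rule summable_gaussian)
  qed (auto simp: norm_mult intro!: tendsto_eq_intros)
qed

lemma Theta_half_int_zero:
  assumes "2 *\<^sub>R a = real_vec m" and "odd (m $ k)"
  obtains x where "Theta a x = 0"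
proof -
  define g where "g t = Re (Theta a (t *\<^sub>R axis k 1))" for t
  have cont: "continuous_on {0..1} g"
    unfolding g_def by (intro continuous_intros continuous_on_subset[OF Theta_continuous]) auto
  have g1: "g 1 = - g 0" using Theta_add_axis[OF assms, of 0] by (simp add: g_def)
  have "\<exists>t. 0 \<le> t \<and> t \<le> 1 \<and> g t = 0"
  proof (cases "g 0 \<le> 0")
    case True
    then show ?thesis using IVT'[of g 0 0 1] cont g1 by auto
  next
    case False
    then show ?thesis using IVT2'[of g 1 0 0] cont g1 by auto
  qed
  then obtain t where "g t = 0" by blast
  then have "Theta a (t *\<^sub>R axis k 1) = 0"
    using Theta_half_int_real[OF assms(1)] by (simp add: complex_eq_iff g_def)
  then show thesis by (rule that)
qed

text \<open>The upper characteristic, all ones, adds 1/2 to each coordinate of \<open>h\<close>,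
  while the lower one merely translates the real argument; the exponential prefactors have no
  zeros.\<close>

lemma theta_char_eq_0_iff:
  fixes x :: "real^'n" and h :: "real^'n" and c :: "'n characteristic"
  assumes c: "fst c = (\<chi> j. 1)"
  shows "theta_char c (cvec_of_real x + Tc *v cvec_of_real h) Tc = 0
    \<longleftrightarrow> Theta (h + (\<chi> j. 1/2)) (x + (1/2) *\<^sub>R real_vec (snd c)) = 0"
proof -
  have a: "(1/2) *s cvec_of_int (fst c) = cvec_of_real (\<chi> j. 1/2)"
    by (simp add: c cvec_of_int_def cvec_of_real_def vec_eq_iff)
  have b: "(1/2) *s cvec_of_int (snd c) = cvec_of_real ((1/2) *\<^sub>R real_vec (snd c))"
    by (simp add: cvec_of_int_def cvec_of_real_def real_vec_def vec_eq_iff)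
  have add: "cvec_of_real (u + v) = cvec_of_real u + cvec_of_real v" for u v :: "real^'n"
    by (simp add: cvec_of_real_def vec_eq_iff)
  have arg: "cvec_of_real x + Tc *v cvec_of_real h + cvec_of_real ((1/2) *\<^sub>R real_vec (snd c)) + Tc *v cvec_of_real (\<chi> j. 1/2)
     = cvec_of_real (x + (1/2) *\<^sub>R real_vec (snd c)) + Tc *v cvec_of_real (h + (\<chi> j. 1/2))"
    by (simp only: add matrix_vector_right_distrib) (simp add: algebra_simps)
  show ?thesis
    unfolding theta_char_def Let_def a b arg theta_eq_Theta by simp
qed

end

subsection \<open>Holomorphic functions on the upper half-plane with integrable boundary values\<close>

text \<open>
  The exceptional set \<open>E\<close> stands for the branch points. The majorant \<open>D\<close> does not depend on the
  height, so that horizontal integrals can be moved both to the boundary and up to infinity.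
\<close>

locale majorant =
  fixes E :: "real set" and D :: "real \<Rightarrow> real"
  assumes finite_E: "finite E"
    and D_nonneg: "\<And>x. 0 \<le> D x"
    and D_integrable: "integrable lborel D"
    and D_top: "(D \<longlongrightarrow> 0) at_top"
    and D_bot: "(D \<longlongrightarrow> 0) at_bot"

definition half_plane_fun :: "real set \<Rightarrow> (real \<Rightarrow> real) \<Rightarrow> (complex \<Rightarrow> complex) \<Rightarrow> bool" where
  "half_plane_fun E D f \<longleftrightarrow>
     f holomorphic_on {z. Im z > 0} \<and>
     (\<forall>x t. x \<notin> E \<longrightarrow> 0 \<le> t \<longrightarrow> norm (f (Complex x t)) \<le> D x) \<and>
     (\<forall>x. x \<notin> E \<longrightarrow> ((\<lambda>t. f (Complex x t)) \<longlongrightarrow> f (Complex x 0)) (at_right 0)) \<and>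
     (\<forall>x. x \<notin> E \<longrightarrow> ((\<lambda>t. f (Complex x t)) \<longlongrightarrow> 0) at_top)"

definition line_primitive :: "(complex \<Rightarrow> complex) \<Rightarrow> real \<Rightarrow> real \<Rightarrow> complex" where
  "line_primitive f t x = (LINT u:{..x}|lborel. f (Complex u t))"

lemma continuous_on_Complex [continuous_intros]:
  assumes "continuous_on S f" "continuous_on S g"
  shows "continuous_on S (\<lambda>x. Complex (f x) (g x))"
  using assms unfolding Complex_eq by (intro continuous_intros)

lemma tendsto_at_right_0_sequence:
  fixes g :: "real \<Rightarrow> 'a::topological_space"
  assumes "(g \<longlongrightarrow> l) (at_right 0)"
  shows "(\<lambda>n. g (1 / real (Suc n))) \<longlonglongrightarrow> l"
proof (rule filterlim_compose[OF assms])
  have "(\<lambda>n. 1 / real (Suc n)) \<longlonglongrightarrow> 0" by (rule LIMSEQ_Suc[OF lim_1_over_n])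
  then show "filterlim (\<lambda>n. 1 / real (Suc n)) (at_right 0) sequentially"
    by (simp add: filterlim_at del: of_nat_Suc)
qed

lemma convex_upper_half_plane: "convex {z. Im z > 0}"
  using convex_halfspace_Im_gt[of 0] by simp

lemma open_upper_half_plane: "open {z. Im z > 0}"
  using open_halfspace_Im_gt[of 0] by simp

context majorant
begin

lemma null_E: "AE x in lborel. x \<notin> E"
  using finite_imp_null_set_lborel[OF finite_E] by (rule AE_not_in)

abbreviation hp :: "(complex \<Rightarrow> complex) \<Rightarrow> bool" where "hp \<equiv> half_plane_fun E D"

lemma hpD:
  assumes "hp f"
  shows "f holomorphic_on {z. Im z > 0}"
    and "x \<notin> E \<Longrightarrow> 0 \<le> t \<Longrightarrow> norm (f (Complex x t)) \<le> D x"
    and "x \<notin> E \<Longrightarrow> ((\<lambda>t. f (Complex x t)) \<longlongrightarrow> f (Complex x 0)) (at_right 0)"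
    and "x \<notin> E \<Longrightarrow> ((\<lambda>t. f (Complex x t)) \<longlongrightarrow> 0) at_top"
  using assms unfolding half_plane_fun_def by blast+

lemma hp_continuous:
  assumes "hp f" shows "continuous_on {z. Im z > 0} f"
  using hpD(1)[OF assms] by (rule holomorphic_on_imp_continuous_on)

lemma hp_line_continuous:
  assumes "hp f" "t > 0" shows "continuous_on S (\<lambda>x. f (Complex x t))"
  by (rule continuous_on_compose2[OF hp_continuous[OF assms(1)]])
     (use assms(2) in \<open>auto intro!: continuous_intros\<close>)

text \<open>At height 0 there is no continuity to appeal to. Off \<open>E\<close> the function is a
  limit of its continuous restrictions to the heights \<open>1 / Suc n\<close>, and on
  \<open>E\<close> it is corrected by finitely many point masses of indicators.\<close>

lemma hp_line_measurable:
  assumes f: "hp f" and t: "t \<ge> 0"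
  shows "(\<lambda>x. f (Complex x t)) \<in> borel_measurable lborel"
proof (cases "t = 0")
  case False
  then show ?thesis
    using borel_measurable_continuous_onI[OF hp_line_continuous[OF f, of t UNIV]] t by simp
next
  case True
  have m: "(\<lambda>x. indicator (- E) x *\<^sub>R f (Complex x 0)) \<in> borel_measurable lborel"
  proof (rule borel_measurable_LIMSEQ_metric)
    have E: "- E \<in> sets lborel" using finite_imp_closed[OF finite_E] by auto
    show "(\<lambda>x. indicator (- E) x *\<^sub>R f (Complex x (1 / real (Suc n)))) \<in> borel_measurable lborel" for n
      using borel_measurable_continuous_onI[OF hp_line_continuous[OF f, of "1 / real (Suc n)" UNIV]] E
      by (intro borel_measurable_scaleR) auto
    fix x :: real
    show "(\<lambda>n. indicator (- E) x *\<^sub>R f (Complex x (1 / real (Suc n)))) \<longlonglongrightarrow> indicator (- E) x *\<^sub>R f (Complex x 0)"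
    proof (cases "x \<in> E")
      case False
      then show ?thesis using tendsto_at_right_0_sequence[OF hpD(3)[OF f False]] by simp
    qed simp
  qed
  have "f (Complex x 0) = indicator (- E) x *\<^sub>R f (Complex x 0)
      + (\<Sum>a\<in>E. indicator {a} x *\<^sub>R f (Complex a 0))" for x
  proof -
    have "(\<Sum>a\<in>E. indicator {a} x *\<^sub>R f (Complex a 0)) = (\<Sum>a\<in>E. if x = a then f (Complex x 0) else 0)"
      by (intro sum.cong) (auto simp: indicator_def)
    then show ?thesis using finite_E by (simp add: indicator_def)
  qed
  then have "(\<lambda>x. f (Complex x 0)) = (\<lambda>x. indicator (- E) x *\<^sub>R f (Complex x 0)
      + (\<Sum>a\<in>E. indicator {a} x *\<^sub>R f (Complex a 0)))" by blast
  moreover have "(\<lambda>x. indicator (- E) x *\<^sub>R f (Complex x 0)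
      + (\<Sum>a\<in>E. indicator {a} x *\<^sub>R f (Complex a 0))) \<in> borel_measurable lborel"
    by (intro m borel_measurable_add borel_measurable_sum borel_measurable_scaleR) auto
  ultimately show ?thesis using True by simp
qed

lemma hp_line_integrable:
  assumes f: "hp f" and t: "t \<ge> 0"
  shows "integrable lborel (\<lambda>x. f (Complex x t))"
  using null_E hpD(2)[OF f _ t] D_nonneg
  by (intro Bochner_Integration.integrable_bound[OF D_integrable hp_line_measurable[OF f t]]) auto

lemma hp_dominated:
  fixes F :: "real \<Rightarrow> real \<Rightarrow> complex"
  assumes "\<And>t. F t \<in> borel_measurable lborel" "g \<in> borel_measurable lborel"
    and "\<And>x. x \<notin> E \<Longrightarrow> ((\<lambda>t. F t x) \<longlongrightarrow> g x) at_top"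
    and "\<And>t x. x \<notin> E \<Longrightarrow> norm (F t x) \<le> K * D x"
  shows "((\<lambda>t. integral\<^sup>L lborel (F t)) \<longlongrightarrow> integral\<^sup>L lborel g) at_top"
proof (rule integral_dominated_convergence_at_top[where w = "\<lambda>x. K * D x"])
  show "integrable lborel (\<lambda>x. K * D x)" by (intro integrable_mult_right D_integrable)
  show "AE x in lborel. ((\<lambda>t. F t x) \<longlongrightarrow> g x) at_top"
    using null_E by eventually_elim (rule assms(3))
  show "\<forall>\<^sub>F t in at_top. AE x in lborel. norm (F t x) \<le> K * D x"
  proof (rule always_eventually, rule allI)
    show "AE x in lborel. norm (F t x) \<le> K * D x" for t
      using null_E by eventually_elim (rule assms(4))
  qed
qed (use assms(1,2) in auto)

definition K :: real where "K = integral\<^sup>L lborel D"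

lemma K_nonneg: "0 \<le> K" unfolding K_def by (intro integral_nonneg_AE) (simp add: D_nonneg)

lemma line_set_integrable:
  assumes "hp f" "t \<ge> 0" "A \<in> sets lborel"
  shows "set_integrable lborel A (\<lambda>x. f (Complex x t))"
  unfolding set_integrable_def by (rule integrable_mult_indicator[OF assms(3) hp_line_integrable[OF assms(1,2)]])

lemma line_primitive_bound:
  assumes f: "hp f" and t: "t \<ge> 0"
  shows "norm (line_primitive f t x) \<le> K"
  unfolding line_primitive_def set_lebesgue_integral_def K_def
proof (rule order_trans[OF integral_norm_bound], rule integral_mono_AE)
  show "integrable lborel (\<lambda>u. norm (indicator {..x} u *\<^sub>R f (Complex u t)))"
    using line_set_integrable[OF f t, of "{..x}"] unfolding set_integrable_def by (intro integrable_norm) auto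
  show "AE u in lborel. norm (indicator {..x} u *\<^sub>R f (Complex u t)) \<le> D u"
    using null_E hpD(2)[OF f _ t] D_nonneg by (auto split: split_indicator)
qed (rule D_integrable)

lemma line_primitive_diff:
  assumes f: "hp f" and t: "t \<ge> 0" and "x \<le> y"
  shows "line_primitive f t y - line_primitive f t x = integral {x..y} (\<lambda>u. f (Complex u t))"
proof -
  have i: "((\<lambda>u. f (Complex u t)) has_integral (LINT u:A|lborel. f (Complex u t))) A" if "A \<in> sets lborel" for A
    using set_borel_integral_eq_integral[OF line_set_integrable[OF f t that]] by (simp add: has_integral_integral)
  have n: "negligible ({..x} \<inter> {x..y})" using assms(3) by (intro negligible_subset[OF negligible_sing[of x]]) auto
  have "((\<lambda>u. f (Complex u t)) has_integral (line_primitive f t x + (LINT u:{x..y}|lborel. f (Complex u t)))) ({..x} \<union> {x..y})"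
    unfolding line_primitive_def using i n by (intro has_integral_Un) auto
  moreover have "{..x} \<union> {x..y} = {..y}" using assms(3) by auto
  ultimately have "line_primitive f t y = line_primitive f t x + (LINT u:{x..y}|lborel. f (Complex u t))"
    using i[of "{..y}"] has_integral_unique by (auto simp: line_primitive_def)
  then show ?thesis
    using i[of "{x..y}"] by (auto dest: integral_unique)
qed

lemma line_primitive_tendsto_bot:
  assumes f: "hp f" and t: "t \<ge> 0"
  shows "((line_primitive f t) \<longlongrightarrow> 0) at_bot"
proof -
  have "((\<lambda>x. LINT u|lborel. indicator {..-x} u *\<^sub>R f (Complex u t)) \<longlongrightarrow> (LINT u::real|lborel. 0)) at_top"
  proof (rule hp_dominated[where K = 1])
    show "(\<lambda>u. indicator {..-x} u *\<^sub>R f (Complex u t)) \<in> borel_measurable lborel" for x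
      using hp_line_measurable[OF f t] by (intro borel_measurable_scaleR) auto
    show "((\<lambda>x. indicator {..-x} u *\<^sub>R f (Complex u t)) \<longlongrightarrow> 0) at_top" for u
      by (rule tendsto_eventually) (use eventually_gt_at_top[of "-u"] in eventually_elim, auto)
    show "norm (indicator {..-x} u *\<^sub>R f (Complex u t)) \<le> 1 * D u" if "u \<notin> E" for u x
      using hpD(2)[OF f that t] D_nonneg[of u] by (auto split: split_indicator)
  qed simp
  then show ?thesis
    by (simp add: filterlim_at_bot_mirror line_primitive_def set_lebesgue_integral_def)
qed

definition line_integral :: "(complex \<Rightarrow> complex) \<Rightarrow> real \<Rightarrow> complex" where
  "line_integral f t = (LINT u|lborel. f (Complex u t))"

lemma line_primitive_tendsto_top:
  assumes f: "hp f" and t: "t \<ge> 0"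
  shows "((line_primitive f t) \<longlongrightarrow> line_integral f t) at_top"
  unfolding line_integral_def line_primitive_def set_lebesgue_integral_def
proof (rule hp_dominated[where K = 1])
  show "(\<lambda>u. indicator {..x} u *\<^sub>R f (Complex u t)) \<in> borel_measurable lborel" for x
    using hp_line_measurable[OF f t] by (intro borel_measurable_scaleR) auto
  show "((\<lambda>x. indicator {..x} u *\<^sub>R f (Complex u t)) \<longlongrightarrow> f (Complex u t)) at_top" for u
    by (rule tendsto_eventually) (use eventually_ge_at_top[of u] in eventually_elim, auto)
  show "norm (indicator {..x} u *\<^sub>R f (Complex u t)) \<le> 1 * D u" if "u \<notin> E" for u x
    using hpD(2)[OF f that t] D_nonneg[of u] by (auto split: split_indicator)
qed (rule hp_line_measurable[OF f t])

text \<open>The substitution \<open>t = inverse s\<close> reduces the limit at 0 to one at infinity;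
  \<open>max s 1\<close> keeps the height positive for every \<open>s\<close>, since measurability
  and the bound are given for positive heights only.\<close>

lemma hp_boundary_dominated:
  fixes F :: "real \<Rightarrow> real \<Rightarrow> complex"
  assumes "\<And>t. t > 0 \<Longrightarrow> F t \<in> borel_measurable lborel" "F 0 \<in> borel_measurable lborel"
    and "\<And>x. x \<notin> E \<Longrightarrow> ((\<lambda>t. F t x) \<longlongrightarrow> F 0 x) (at_right 0)"
    and "\<And>t x. t > 0 \<Longrightarrow> x \<notin> E \<Longrightarrow> norm (F t x) \<le> C * D x"
  shows "((\<lambda>t. integral\<^sup>L lborel (F t)) \<longlongrightarrow> integral\<^sup>L lborel (F 0)) (at_right 0)"
proof -
  have "((\<lambda>s. integral\<^sup>L lborel (F (inverse (max s 1)))) \<longlongrightarrow> integral\<^sup>L lborel (F 0)) at_top"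
  proof (rule hp_dominated[where K = C])
    fix x assume x: "x \<notin> E"
    have "((\<lambda>s. F (inverse s) x) \<longlongrightarrow> F 0 x) at_top"
      using assms(3)[OF x] by (simp add: filterlim_at_right_to_top)
    then show "((\<lambda>s. F (inverse (max s 1)) x) \<longlongrightarrow> F 0 x) at_top"
      by (rule Lim_transform_eventually) (use eventually_ge_at_top[of 1] in eventually_elim, simp add: max_def)
  qed (use assms in auto)
  then have "((\<lambda>s. integral\<^sup>L lborel (F (inverse s))) \<longlongrightarrow> integral\<^sup>L lborel (F 0)) at_top"
    by (rule Lim_transform_eventually) (use eventually_ge_at_top[of 1] in eventually_elim, simp add: max_def)
  then show ?thesis by (simp add: filterlim_at_right_to_top)
qed

lemma line_primitive_tendsto_0:
  assumes f: "hp f"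
  shows "((\<lambda>t. line_primitive f t x) \<longlongrightarrow> line_primitive f 0 x) (at_right 0)"
  unfolding line_primitive_def set_lebesgue_integral_def
proof (rule hp_boundary_dominated[where C = 1 and F = "\<lambda>t u. indicator {..x} u *\<^sub>R f (Complex u t)"])
  show "((\<lambda>t. indicator {..x} u *\<^sub>R f (Complex u t)) \<longlongrightarrow> indicator {..x} u *\<^sub>R f (Complex u 0)) (at_right 0)"
    if "u \<notin> E" for u
    by (intro tendsto_intros hpD(3)[OF f that])
  show "norm (indicator {..x} u *\<^sub>R f (Complex u t)) \<le> 1 * D u" if "t > 0" "u \<notin> E" for u t
    using hpD(2)[OF f that(2), of t] that D_nonneg[of u] by (auto split: split_indicator)
qed (use hp_line_measurable[OF f] in \<open>auto intro!: borel_measurable_scaleR\<close>)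

lemma line_primitive_tendsto_top_height:
  assumes f: "hp f"
  shows "((\<lambda>t. line_primitive f t x) \<longlongrightarrow> 0) at_top"
proof -
  have "((\<lambda>t. LINT u|lborel. indicator {..x} u *\<^sub>R f (Complex u (max t 1))) \<longlongrightarrow> (LINT u::real|lborel. 0)) at_top"
  proof (rule hp_dominated[where K = 1])
    show "(\<lambda>u. indicator {..x} u *\<^sub>R f (Complex u (max t 1))) \<in> borel_measurable lborel" for t
      using hp_line_measurable[OF f, of "max t 1"] by (intro borel_measurable_scaleR) auto
    fix u assume u: "u \<notin> E"
    have "((\<lambda>t. f (Complex u (max t 1))) \<longlongrightarrow> 0) at_top"
      by (rule Lim_transform_eventually[OF hpD(4)[OF f u]])
         (use eventually_ge_at_top[of 1] in eventually_elim, simp add: max_def)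
    then show "((\<lambda>t. indicator {..x} u *\<^sub>R f (Complex u (max t 1))) \<longlongrightarrow> 0) at_top"
      by (auto intro!: tendsto_eq_intros)
    show "norm (indicator {..x} u *\<^sub>R f (Complex u (max t 1))) \<le> 1 * D u" for t
      using hpD(2)[OF f u, of "max t 1"] D_nonneg[of u] by (auto split: split_indicator)
  qed simp
  then have "((\<lambda>t. line_primitive f (max t 1) x) \<longlongrightarrow> 0) at_top"
    by (simp add: line_primitive_def set_lebesgue_integral_def)
  then show ?thesis
    by (rule Lim_transform_eventually) (use eventually_ge_at_top[of 1] in eventually_elim, simp add: max_def)
qed

lemma line_integral_tendsto_top_height:
  assumes f: "hp f"
  shows "((\<lambda>t. line_integral f t) \<longlongrightarrow> 0) at_top"
proof -
  have "((\<lambda>t. LINT u|lborel. f (Complex u (max t 1))) \<longlongrightarrow> (LINT u::real|lborel. 0)) at_top"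
  proof (rule hp_dominated[where K = 1])
    show "(\<lambda>u. f (Complex u (max t 1))) \<in> borel_measurable lborel" for t
      using hp_line_measurable[OF f, of "max t 1"] by auto
    fix u assume u: "u \<notin> E"
    show "((\<lambda>t. f (Complex u (max t 1))) \<longlongrightarrow> 0) at_top"
      by (rule Lim_transform_eventually[OF hpD(4)[OF f u]])
         (use eventually_ge_at_top[of 1] in eventually_elim, simp add: max_def)
    show "norm (f (Complex u (max t 1))) \<le> 1 * D u" for t
      using hpD(2)[OF f u, of "max t 1"] by auto
  qed simp
  then have "((\<lambda>t. line_integral f (max t 1)) \<longlongrightarrow> 0) at_top"
    by (simp add: line_integral_def)
  then show ?thesis
    by (rule Lim_transform_eventually) (use eventually_ge_at_top[of 1] in eventually_elim, simp add: max_def)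
qed

lemma line_integral_tendsto_0:
  assumes f: "hp f"
  shows "((\<lambda>t. line_integral f t) \<longlongrightarrow> line_integral f 0) (at_right 0)"
  unfolding line_integral_def
  by (rule hp_boundary_dominated[where C = 1 and F = "\<lambda>t u. f (Complex u t)"])
     (use hpD(2,3)[OF f] hp_line_measurable[OF f] in auto)

end

section \<open>Primitives, Cauchy's theorem on horizontal lines, and the area form\<close>

lemma has_vector_derivative_horizontal:
  assumes "(F has_field_derivative F') (at (Complex x t))"
  shows "((\<lambda>x. F (Complex x t)) has_vector_derivative F') (at x within S)"
proof -
  have "((\<lambda>x. complex_of_real x + \<i> * complex_of_real t) has_vector_derivative 1 + 0) (at x)"
    by (intro has_vector_derivative_add has_vector_derivative_of_real has_vector_derivative_const has_vector_derivative_id)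
       (simp add: has_vector_derivative_of_real[OF DERIV_ident, simplified])
  then have "((\<lambda>x. Complex x t) has_vector_derivative 1) (at x)" by (simp add: Complex_eq)
  from field_vector_diff_chain_at[OF this assms]
  have "((\<lambda>x. F (Complex x t)) has_vector_derivative F') (at x)" by (simp add: o_def)
  then show ?thesis by (rule has_vector_derivative_at_within)
qed

lemma has_vector_derivative_vertical:
  assumes "(F has_field_derivative F') (at (Complex x t))"
  shows "((\<lambda>t. F (Complex x t)) has_vector_derivative \<i> * F') (at t within S)"
proof -
  have "((\<lambda>t. complex_of_real x + \<i> * complex_of_real t) has_vector_derivative 0 + \<i> * 1) (at t)"
    by (intro has_vector_derivative_add has_vector_derivative_const has_vector_derivative_mult_right)
       (use has_vector_derivative_of_real[OF DERIV_ident] in simp)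
  then have "((\<lambda>t. Complex x t) has_vector_derivative \<i>) (at t)" by (simp add: Complex_eq)
  from field_vector_diff_chain_at[OF this assms]
  have "((\<lambda>t. F (Complex x t)) has_vector_derivative \<i> * F') (at t)" by (simp add: o_def)
  then show ?thesis by (rule has_vector_derivative_at_within)
qed

lemma tendsto_symmetric_integral:
  fixes \<phi> :: "real \<Rightarrow> 'a::euclidean_space"
  assumes "integrable lborel \<phi>"
  shows "((\<lambda>R. integral {-R..R} \<phi>) \<longlongrightarrow> integral\<^sup>L lborel \<phi>) at_top"
proof -
  have "((\<lambda>R. LINT x|lborel. indicator {-R..R} x *\<^sub>R \<phi> x) \<longlongrightarrow> integral\<^sup>L lborel \<phi>) at_top"
  proof (rule integral_dominated_convergence_at_top[where w = "\<lambda>x. norm (\<phi> x)"])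
    show "AE x in lborel. ((\<lambda>R. indicator {-R..R} x *\<^sub>R \<phi> x) \<longlongrightarrow> \<phi> x) at_top"
    proof (rule AE_I2)
      fix x :: real
      show "((\<lambda>R. indicator {-R..R} x *\<^sub>R \<phi> x) \<longlongrightarrow> \<phi> x) at_top"
        by (rule tendsto_eventually) (use eventually_ge_at_top[of "\<bar>x\<bar>"] in eventually_elim, auto simp: indicator_def abs_le_iff)
    qed
    show "\<forall>\<^sub>F R in at_top. AE x in lborel. norm (indicator {-R..R} x *\<^sub>R \<phi> x) \<le> norm (\<phi> x)"
      by (rule always_eventually, rule allI, rule AE_I2) (simp split: split_indicator)
  qed (use assms borel_measurable_integrable[OF assms] in auto)
  moreover have "(LINT x|lborel. indicator {-R..R} x *\<^sub>R \<phi> x) = integral {-R..R} \<phi>" for R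
    using set_borel_integral_eq_integral(2)[of "{-R..R}" \<phi>] integrable_mult_indicator[OF _ assms, of "{-R..R}"]
    by (simp add: set_integrable_def set_lebesgue_integral_def)
  ultimately show ?thesis by simp
qed

context majorant
begin

lemma eventually_notin_E_top: "\<forall>\<^sub>F y in at_top. y \<notin> E \<and> - y \<notin> E"
proof -
  have "\<exists>b. \<forall>e\<in>E. \<bar>e\<bar> \<le> b"
    using finite_imp_bounded[OF finite_E] by (auto simp: bounded_iff)
  then obtain b where b: "\<And>e. e \<in> E \<Longrightarrow> \<bar>e\<bar> \<le> b" by blast
  show ?thesis
    using eventually_gt_at_top[of b] by eventually_elim (use b in force)
qed

lemma tendsto_D_symmetric: "((\<lambda>y. D y + D (- y)) \<longlongrightarrow> 0) at_top"
  using tendsto_add[OF D_top D_bot[unfolded filterlim_at_bot_mirror]] by simp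

text \<open>This is the estimate for the vertical sides of a rectangle: the bound vanishes as
  \<open>y\<close> goes to either infinity, because \<open>D\<close> does.\<close>

lemma primitive_vertical_bound:
  assumes f: "hp f" and F: "\<And>z. Im z > 0 \<Longrightarrow> (F has_field_derivative f z) (at z)"
    and y: "y \<notin> E" and "s > 0" "t > 0"
  shows "norm (F (Complex y t) - F (Complex y s)) \<le> D y * \<bar>t - s\<bar>"
proof -
  have "norm (F (Complex y t) - F (Complex y s)) \<le> D y * norm (Complex y t - Complex y s)"
  proof (rule field_differentiable_bound[where S = "{z. Re z = y} \<inter> {z. Im z > 0}"])
    show "convex ({z. Re z = y} \<inter> {z. Im z > 0})"
      using convex_hyperplane[of "1::complex" y] by (intro convex_Int convex_upper_half_plane) (simp add: inner_complex_def)
    show "(F has_field_derivative f z) (at z within {z. Re z = y} \<inter> {z. Im z > 0})"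
      if "z \<in> {z. Re z = y} \<inter> {z. Im z > 0}" for z
      using F that by (auto intro: has_field_derivative_at_within)
    show "norm (f z) \<le> D y" if "z \<in> {z. Re z = y} \<inter> {z. Im z > 0}" for z
      using that hpD(2)[OF f y, of "Im z"] by auto
  qed (use assms in auto)
  also have "Complex y t - Complex y s = \<i> * complex_of_real (t - s)" by (simp add: complex_eq_iff)
  also have "norm \<dots> = \<bar>t - s\<bar>" by (simp add: norm_mult del: of_real_diff)
  finally show ?thesis .
qed

text \<open>On each horizontal line an antiderivative differs from \<open>line_primitive\<close> by
  a constant \<open>c t\<close>. Comparing two heights far to the left, where the line primitives
  vanish, shows that the constant is the same for all heights.\<close>

lemma hp_primitive:
  assumes f: "hp f"
  obtains F where "\<And>z. Im z > 0 \<Longrightarrow> (F has_field_derivative f z) (at z)"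
    and "\<And>x t. t > 0 \<Longrightarrow> line_primitive f t x = F (Complex x t)"
proof -
  obtain F0 where F0: "\<And>z. z \<in> {z. Im z > 0} \<Longrightarrow> (F0 has_field_derivative f z) (at z within {z. Im z > 0})"
    using holomorphic_convex_primitive'[OF convex_upper_half_plane open_upper_half_plane hpD(1)[OF f]] by blast
  have F0': "(F0 has_field_derivative f z) (at z)" if "Im z > 0" for z
    using F0[of z] that by (simp add: at_within_open[OF _ open_upper_half_plane])
  define c where "c t = F0 (Complex 0 t) - line_primitive f t 0" for t
  have diff: "F0 (Complex y t) - F0 (Complex x t) = line_primitive f t y - line_primitive f t x"
    if "t > 0" "x \<le> y" for t x y
  proof -
    have "((\<lambda>u. f (Complex u t)) has_integral (F0 (Complex y t) - F0 (Complex x t))) {x..y}"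
      using that by (intro fundamental_theorem_of_calculus has_vector_derivative_horizontal F0') auto
    then show ?thesis using line_primitive_diff[OF f _ that(2), of t] that(1) by (simp add: integral_unique)
  qed
  have c: "F0 (Complex x t) = line_primitive f t x + c t" if "t > 0" for x t
    using diff[OF that, of 0 x] diff[OF that, of x 0] by (cases "0 \<le> x") (auto simp: c_def algebra_simps)
  have c_const: "c t = c s" if "t > 0" "s > 0" for s t
  proof -
    have lim: "((\<lambda>y. F0 (Complex (-y) t)) \<longlongrightarrow> c t) at_top" if "t > 0" for t
      using tendsto_add[OF line_primitive_tendsto_bot[OF f, of t] tendsto_const[of "c t"]] that
      by (simp add: c filterlim_at_bot_mirror)
    have "((\<lambda>y. norm (F0 (Complex (-y) t) - F0 (Complex (-y) s))) \<longlongrightarrow> norm (c t - c s)) at_top"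
      by (intro tendsto_intros lim that)
    moreover have "((\<lambda>y. D (- y) * \<bar>t - s\<bar>) \<longlongrightarrow> 0 * \<bar>t - s\<bar>) at_top"
      by (intro tendsto_intros D_bot[unfolded filterlim_at_bot_mirror])
    moreover have "\<forall>\<^sub>F y in at_top. norm (F0 (Complex (-y) t) - F0 (Complex (-y) s)) \<le> D (- y) * \<bar>t - s\<bar>"
      using eventually_notin_E_top by eventually_elim (use primitive_vertical_bound[OF f F0'] that in auto)
    ultimately have "norm (c t - c s) \<le> 0 * \<bar>t - s\<bar>"
      by (intro tendsto_le[of at_top "\<lambda>y. D (- y) * \<bar>t - s\<bar>" _ "\<lambda>y. norm (F0 (Complex (-y) t) - F0 (Complex (-y) s))"]) auto
    then show ?thesis by simp
  qed
  show thesis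
  proof (rule that)
    show "((\<lambda>z. F0 z - c 1) has_field_derivative f z) (at z)" if "Im z > 0" for z
      using DERIV_diff[OF F0'[OF that] DERIV_const[of "c 1"]] by simp
    show "line_primitive f t x = F0 (Complex x t) - c 1" if "t > 0" for x t
      using c[OF that] c_const[OF that, of 1] by simp
  qed
qed

text \<open>Cauchy's theorem on an infinite strip makes the integral independent of the height, and
  domination makes it tend to 0 as the height grows. Height 0 is reached by the limit from
  above.\<close>

lemma line_integral_eq_0:
  assumes f: "hp f" and t: "t \<ge> 0"
  shows "line_integral f t = 0"
proof -
  obtain F where F: "\<And>z. Im z > 0 \<Longrightarrow> (F has_field_derivative f z) (at z)"
    "\<And>x t. t > 0 \<Longrightarrow> line_primitive f t x = F (Complex x t)"
    using hp_primitive[OF f] by blast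
  have const: "line_integral f t = line_integral f s" if "t > 0" "s > 0" for s t
  proof -
    have lim: "((\<lambda>y. F (Complex y t)) \<longlongrightarrow> line_integral f t) at_top" if "t > 0" for t
    proof -
      have "line_primitive f t = (\<lambda>y. F (Complex y t))" using F(2)[OF that] by blast
      then show ?thesis using line_primitive_tendsto_top[OF f, of t] that by simp
    qed
    have "((\<lambda>y. norm (F (Complex y t) - F (Complex y s))) \<longlongrightarrow> norm (line_integral f t - line_integral f s)) at_top"
      by (intro tendsto_intros lim that)
    moreover have "((\<lambda>y. D y * \<bar>t - s\<bar>) \<longlongrightarrow> 0 * \<bar>t - s\<bar>) at_top"
      by (intro tendsto_intros D_top)
    moreover have "\<forall>\<^sub>F y in at_top. norm (F (Complex y t) - F (Complex y s)) \<le> D y * \<bar>t - s\<bar>"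
      using eventually_notin_E_top by eventually_elim (use primitive_vertical_bound[OF f F(1)] that in auto)
    ultimately have "norm (line_integral f t - line_integral f s) \<le> 0 * \<bar>t - s\<bar>"
      by (intro tendsto_le[of at_top "\<lambda>y. D y * \<bar>t - s\<bar>" _ "\<lambda>y. norm (F (Complex y t) - F (Complex y s))"]) auto
    then show ?thesis by simp
  qed
  have pos: "line_integral f t = 0" if "t > 0" for t
  proof -
    have "((\<lambda>s. line_integral f s) \<longlongrightarrow> line_integral f t) at_top"
      by (rule tendsto_eventually) (use eventually_gt_at_top[of 0] in eventually_elim, rule const[OF _ that])
    with line_integral_tendsto_top_height[OF f] show ?thesis
      using tendsto_unique trivial_limit_at_top_linorder by blast
  qed
  show ?thesis
  proof (cases "t = 0")
    case True
    have "((\<lambda>t. line_integral f t) \<longlongrightarrow> 0) (at_right 0)"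
      by (rule tendsto_eventually) (auto simp: eventually_at_right_field pos intro: exI[of _ 1])
    with line_integral_tendsto_0[OF f] True show ?thesis
      using tendsto_unique trivial_limit_at_right_real by blast
  qed (use pos t in auto)
qed

lemma line_primitive_measurable:
  assumes f: "hp f" and t: "t \<ge> 0"
  shows "line_primitive f t \<in> borel_measurable lborel"
proof -
  have pos: "line_primitive f t \<in> borel_measurable lborel" if "t > 0" for t
  proof -
    obtain F where F: "\<And>z. Im z > 0 \<Longrightarrow> (F has_field_derivative f z) (at z)"
      "\<And>x t. t > 0 \<Longrightarrow> line_primitive f t x = F (Complex x t)"
      using hp_primitive[OF f] by blast
    have "continuous_on UNIV (\<lambda>x. F (Complex x t))"
      using has_vector_derivative_continuous[OF has_vector_derivative_horizontal[OF F(1)]] that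
      by (intro continuous_at_imp_continuous_on) auto
    moreover have "line_primitive f t = (\<lambda>y. F (Complex y t))" using F(2)[OF that] by blast
    ultimately show ?thesis by (simp add: borel_measurable_continuous_onI)
  qed
  show ?thesis
  proof (cases "t = 0")
    case True
    have "line_primitive f 0 \<in> borel_measurable lborel"
    proof (rule borel_measurable_LIMSEQ_metric)
      show "line_primitive f (1 / real (Suc n)) \<in> borel_measurable lborel" for n by (rule pos) simp
      show "(\<lambda>n. line_primitive f (1 / real (Suc n)) x) \<longlonglongrightarrow> line_primitive f 0 x" for x
        by (rule tendsto_at_right_0_sequence[OF line_primitive_tendsto_0[OF f]])
    qed
    then show ?thesis using True by simp
  qed (use pos t in auto)
qed

text \<open>A primitive is bounded by the total mass \<open>K\<close> of the majorant, so the
  product stays in the same class for the majorant \<open>K * D\<close>, and Cauchy's theorem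
  applies to it as well.\<close>

lemma hp_times_primitive:
  assumes f: "hp f" and g: "hp g"
  shows "half_plane_fun E (\<lambda>x. K * D x) (\<lambda>z. line_primitive f (Im z) (Re z) * g z)"
  unfolding half_plane_fun_def
proof (intro conjI allI impI)
  obtain F where F: "\<And>z. Im z > 0 \<Longrightarrow> (F has_field_derivative f z) (at z)"
    "\<And>x t. t > 0 \<Longrightarrow> line_primitive f t x = F (Complex x t)"
    using hp_primitive[OF f] by blast
  have "(\<lambda>z. F z * g z) holomorphic_on {z. Im z > 0}"
    using F(1) open_upper_half_plane
    by (intro holomorphic_intros hpD(1)[OF g]) (auto simp: holomorphic_on_open)
  then show "(\<lambda>z. line_primitive f (Im z) (Re z) * g z) holomorphic_on {z. Im z > 0}"
    by (rule holomorphic_transform) (simp add: F(2))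
  fix x assume x: "x \<notin> E"
  have bound: "norm (line_primitive f t x) \<le> K" if "0 \<le> t" for t
    by (rule line_primitive_bound[OF f that])
  show "norm (line_primitive f (Im (Complex x t)) (Re (Complex x t)) * g (Complex x t)) \<le> K * D x" if "0 \<le> t" for t
    using mult_mono[OF bound[OF that] hpD(2)[OF g x that] K_nonneg] by (simp add: norm_mult)
  show "((\<lambda>t. line_primitive f (Im (Complex x t)) (Re (Complex x t)) * g (Complex x t)) \<longlongrightarrow>
       line_primitive f (Im (Complex x 0)) (Re (Complex x 0)) * g (Complex x 0)) (at_right 0)"
    using tendsto_mult[OF line_primitive_tendsto_0[OF f] hpD(3)[OF g x]] by simp
  show "((\<lambda>t. line_primitive f (Im (Complex x t)) (Re (Complex x t)) * g (Complex x t)) \<longlongrightarrow> 0) at_top"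
    using tendsto_mult[OF line_primitive_tendsto_top_height[OF f] hpD(4)[OF g x]] by simp
qed

lemma majorant_cmult:
  assumes "0 \<le> c"
  shows "majorant E (\<lambda>x. c * D x)"
proof
  show "((\<lambda>x. c * D x) \<longlongrightarrow> 0) at_top" using tendsto_mult_right_zero[OF D_top, of c] by simp
  show "((\<lambda>x. c * D x) \<longlongrightarrow> 0) at_bot" using tendsto_mult_right_zero[OF D_bot, of c] by simp
qed (use assms finite_E D_nonneg D_integrable in auto)

lemma integral_primitive_times_eq_0:
  assumes "hp f" and "hp g"
  shows "(LINT x|lborel. line_primitive f 0 x * g (Complex x 0)) = 0"
proof -
  interpret KD: majorant E "\<lambda>x. K * D x" by (rule majorant_cmult[OF K_nonneg])
  show ?thesis
    using KD.line_integral_eq_0[OF hp_times_primitive[OF assms], of 0]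
    by (simp add: KD.line_integral_def)
qed

text \<open>For \<open>f = g\<close>, twice the area covered by a primitive of \<open>f\<close> above height \<open>t\<close> is the imaginary part.\<close>

definition H :: "real \<Rightarrow> (complex \<Rightarrow> complex) \<Rightarrow> (complex \<Rightarrow> complex) \<Rightarrow> complex" where
  "H t f g = (LINT x|lborel. cnj (line_primitive f t x) * g (Complex x t))"

lemma H_integrable:
  assumes f: "hp f" and g: "hp g" and t: "t \<ge> 0"
  shows "integrable lborel (\<lambda>x. cnj (line_primitive f t x) * g (Complex x t))"
proof (rule Bochner_Integration.integrable_bound[where f = "\<lambda>x. K * norm (g (Complex x t))"])
  show "integrable lborel (\<lambda>x. K * norm (g (Complex x t)))"
    by (intro integrable_mult_right integrable_norm hp_line_integrable g t)
  have "(\<lambda>x. cnj (line_primitive f t x)) \<in> borel_measurable lborel"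
    using measurable_compose[OF line_primitive_measurable[OF f t], of cnj borel] by (simp add: borel_measurable_continuous_onI continuous_on_cnj)
  then show "(\<lambda>x. cnj (line_primitive f t x) * g (Complex x t)) \<in> borel_measurable lborel"
    using hp_line_measurable[OF g t] by (intro borel_measurable_times)
  show "AE x in lborel. norm (cnj (line_primitive f t x) * g (Complex x t)) \<le> norm (K * norm (g (Complex x t)))"
    using line_primitive_bound[OF f t] K_nonneg by (intro AE_I2) (simp add: norm_mult mult_right_mono)
qed

lemma H_tendsto_0:
  assumes f: "hp f" and g: "hp g"
  shows "((\<lambda>t. H t f g) \<longlongrightarrow> H 0 f g) (at_right 0)"
  unfolding H_def
proof (rule hp_boundary_dominated[where C = K and F = "\<lambda>t x. cnj (line_primitive f t x) * g (Complex x t)"])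
  show "(\<lambda>x. cnj (line_primitive f t x) * g (Complex x t)) \<in> borel_measurable lborel" if "t > 0" for t
    using borel_measurable_integrable[OF H_integrable[OF f g, of t]] that by simp
  show "(\<lambda>x. cnj (line_primitive f 0 x) * g (Complex x 0)) \<in> borel_measurable lborel"
    using borel_measurable_integrable[OF H_integrable[OF f g, of 0]] by simp
  show "((\<lambda>t. cnj (line_primitive f t x) * g (Complex x t)) \<longlongrightarrow> cnj (line_primitive f 0 x) * g (Complex x 0)) (at_right 0)"
    if "x \<notin> E" for x
    by (intro tendsto_intros line_primitive_tendsto_0[OF f] hpD(3)[OF g that])
  show "norm (cnj (line_primitive f t x) * g (Complex x t)) \<le> K * D x" if "t > 0" "x \<notin> E" for x t
    using mult_mono[OF line_primitive_bound[OF f, of t x] hpD(2)[OF g that(2), of t] K_nonneg] that by (simp add: norm_mult)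
qed

lemma H_tendsto_top:
  assumes f: "hp f" and g: "hp g"
  shows "((\<lambda>t. H t f g) \<longlongrightarrow> 0) at_top"
proof -
  have "((\<lambda>t. LINT x|lborel. cnj (line_primitive f (max t 1) x) * g (Complex x (max t 1))) \<longlongrightarrow> (LINT x::real|lborel. 0)) at_top"
  proof (rule hp_dominated[where K = K])
    show "(\<lambda>x. cnj (line_primitive f (max t 1) x) * g (Complex x (max t 1))) \<in> borel_measurable lborel" for t
      using borel_measurable_integrable[OF H_integrable[OF f g, of "max t 1"]] by simp
    fix x assume x: "x \<notin> E"
    have "((\<lambda>t. cnj (line_primitive f t x) * g (Complex x t)) \<longlongrightarrow> cnj 0 * 0) at_top"
      by (intro tendsto_intros line_primitive_tendsto_top_height[OF f] hpD(4)[OF g x])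
    then have "((\<lambda>t. cnj (line_primitive f t x) * g (Complex x t)) \<longlongrightarrow> 0) at_top" by simp
    then show "((\<lambda>t. cnj (line_primitive f (max t 1) x) * g (Complex x (max t 1))) \<longlongrightarrow> 0) at_top"
      by (rule Lim_transform_eventually) (use eventually_ge_at_top[of 1] in eventually_elim, simp add: max_def)
    show "norm (cnj (line_primitive f (max t 1) x) * g (Complex x (max t 1))) \<le> K * D x" for t
      using mult_mono[OF line_primitive_bound[OF f, of "max t 1" x] hpD(2)[OF g x, of "max t 1"] K_nonneg] by (simp add: norm_mult)
  qed simp
  then have "((\<lambda>t. H (max t 1) f g) \<longlongrightarrow> 0) at_top"
    by (simp add: H_def)
  then show ?thesis
    by (rule Lim_transform_eventually) (use eventually_ge_at_top[of 1] in eventually_elim, simp add: max_def)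
qed

text \<open>Above the real line the combined integrand is the derivative of
  \<open>cnj F * G\<close>. This product vanishes at both ends, on the left by the normalisation of
  \<open>line_primitive\<close> and on the right by \<open>line_integral_eq_0\<close>.\<close>

lemma H_antihermitian:
  assumes f: "hp f" and g: "hp g"
  shows "H 0 f g + cnj (H 0 g f) = 0"
proof -
  have pos: "H t f g + cnj (H t g f) = 0" if t: "t > 0" for t
  proof -
    obtain F where F: "\<And>z. Im z > 0 \<Longrightarrow> (F has_field_derivative f z) (at z)"
      "\<And>x t. t > 0 \<Longrightarrow> line_primitive f t x = F (Complex x t)"
      using hp_primitive[OF f] by blast
    obtain G where G: "\<And>z. Im z > 0 \<Longrightarrow> (G has_field_derivative g z) (at z)"
      "\<And>x t. t > 0 \<Longrightarrow> line_primitive g t x = G (Complex x t)"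
      using hp_primitive[OF g] by blast
    define \<phi> where "\<phi> x = cnj (line_primitive f t x) * g (Complex x t) + cnj (cnj (line_primitive g t x) * f (Complex x t))" for x
    have int: "integrable lborel \<phi>"
      unfolding \<phi>_def using H_integrable[OF f g, of t] H_integrable[OF g f, of t] t
      by (intro Bochner_Integration.integrable_add integrable_cnj) auto
    have "integral\<^sup>L lborel \<phi> = H t f g + cnj (H t g f)"
      unfolding \<phi>_def H_def using H_integrable[OF f g, of t] H_integrable[OF g f, of t] t
      by (subst Bochner_Integration.integral_add) (auto intro: integrable_cnj simp del: complex_cnj_mult)
    moreover have "integral\<^sup>L lborel \<phi> = 0"
    proof -
      define B where "B x = cnj (line_primitive f t x) * line_primitive g t x" for x
      have "(\<phi> has_integral (B R - B (- R))) {-R..R}" if "R > 0" for R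
      proof (rule fundamental_theorem_of_calculus)
        fix x
        have "((\<lambda>x. cnj (F (Complex x t)) * G (Complex x t)) has_vector_derivative
            (cnj (F (Complex x t)) * g (Complex x t) + cnj (f (Complex x t)) * G (Complex x t))) (at x within {-R..R})"
          by (intro has_vector_derivative_mult has_vector_derivative_cnj has_vector_derivative_horizontal F(1) G(1)) (use t in simp_all)
        then show "(B has_vector_derivative \<phi> x) (at x within {-R..R})"
          using t by (simp add: B_def[abs_def] \<phi>_def F(2) G(2) mult.commute)
      qed (use that in simp)
      then have "B R - B (- R) = integral {-R..R} \<phi>" if "0 < R" for R
        using that integral_unique by metis
      then have ev: "\<forall>\<^sub>F R in at_top. B R - B (- R) = integral {-R..R} \<phi>"
        by (rule eventually_mono[OF eventually_gt_at_top[of 0]])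
      have "((\<lambda>R. B R - B (- R)) \<longlongrightarrow> cnj 0 * 0 - cnj 0 * 0) at_top"
        unfolding B_def
        using line_primitive_tendsto_top[OF f, of t] line_primitive_tendsto_top[OF g, of t]
          line_primitive_tendsto_bot[OF f, of t] line_primitive_tendsto_bot[OF g, of t] t
        by (intro tendsto_intros) (simp_all add: line_integral_eq_0 f g filterlim_at_bot_mirror)
      then have "((\<lambda>R. integral {-R..R} \<phi>) \<longlongrightarrow> 0) at_top"
        using Lim_transform_eventually[OF _ ev] by simp
      with tendsto_symmetric_integral[OF int] show ?thesis
        using tendsto_unique trivial_limit_at_top_linorder by blast
    qed
    ultimately show ?thesis by simp
  qed
  have "((\<lambda>t. H t f g + cnj (H t g f)) \<longlongrightarrow> H 0 f g + cnj (H 0 g f)) (at_right 0)"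
    by (intro tendsto_intros H_tendsto_0 f g)
  moreover have "((\<lambda>t. H t f g + cnj (H t g f)) \<longlongrightarrow> 0) (at_right 0)"
    by (rule tendsto_eventually) (auto simp: eventually_at_right_field pos intro: exI[of _ 1])
  ultimately show ?thesis using tendsto_unique trivial_limit_at_right_real by blast
qed

text \<open>A form of Green's theorem. Differentiating the integrand in the height gives
  \<open>\<psi>\<close>, that is \<open>- |f|^2 + Re (cnj F * f')\<close>, and the second term is
  the horizontal derivative of \<open>Re (cnj F * f)\<close> minus another \<open>|f|^2\<close>.
  Integration leaves two end terms and twice the energy.\<close>

lemma area_derivative:
  assumes F: "\<And>z. Im z > 0 \<Longrightarrow> (F has_field_derivative f z) (at z)"
    and f: "\<And>z. Im z > 0 \<Longrightarrow> (f has_field_derivative f' z) (at z)"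
    and f': "continuous_on {z. Im z > 0} f'"
    and t: "t > 0" and R: "R > 0"
  shows "((\<lambda>t. integral {-R..R} (\<lambda>x. Im (cnj (F (Complex x t)) * f (Complex x t)))) has_field_derivative
      (Re (cnj (F (Complex R t)) * f (Complex R t)) - Re (cnj (F (Complex (-R) t)) * f (Complex (-R) t))
        - 2 * integral {-R..R} (\<lambda>x. (norm (f (Complex x t)))\<^sup>2))) (at t)"
proof -
  define \<psi> where "\<psi> t x = - (norm (f (Complex x t)))\<^sup>2 + Re (cnj (F (Complex x t)) * f' (Complex x t))" for t x
  have contF: "continuous_on {z. Im z > 0} F" and contf: "continuous_on {z. Im z > 0} f"
    using F f by (auto intro!: continuous_at_imp_continuous_on DERIV_isCont)
  have norm2: "complex_of_real ((norm z)\<^sup>2) = cnj z * z" for z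
    by (metis complex_norm_square mult.commute)
  have Re_norm: "Re (cnj z * z) = (norm z)\<^sup>2" for z
    by (metis norm2 Re_complex_of_real)
  have "((\<lambda>t. integral (cbox (-R) R) (\<lambda>x. Im (cnj (F (Complex x t)) * f (Complex x t)))) has_field_derivative
      integral (cbox (-R) R) (\<psi> t)) (at t within {0<..})"
  proof (rule leibniz_rule_field_derivative[where U = "{0<..}"])
    fix s x :: real assume s: "s \<in> {0<..}"
    have "((\<lambda>t. cnj (F (Complex x t)) * f (Complex x t)) has_vector_derivative
      (cnj (F (Complex x s)) * (\<i> * f' (Complex x s)) + cnj (\<i> * f (Complex x s)) * f (Complex x s))) (at s within {0<..})"
      by (intro has_vector_derivative_mult has_vector_derivative_cnj has_vector_derivative_vertical F f) (use s in auto)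
    moreover have "Im (cnj (F (Complex x s)) * (\<i> * f' (Complex x s)) + cnj (\<i> * f (Complex x s)) * f (Complex x s)) = \<psi> s x"
      unfolding \<psi>_def cmod_power2 by (simp add: power2_eq_square)
    ultimately have "((\<lambda>t. Im (cnj (F (Complex x t)) * f (Complex x t))) has_vector_derivative \<psi> s x) (at s within {0<..})"
      using bounded_linear.has_vector_derivative[OF bounded_linear_Im] by fastforce
    then show "((\<lambda>t. Im (cnj (F (Complex x t)) * f (Complex x t))) has_field_derivative \<psi> s x) (at s within {0<..})"
      by (simp add: has_real_derivative_iff_has_vector_derivative)
  next
    fix s :: real assume s: "s \<in> {0<..}"
    show "(\<lambda>x. Im (cnj (F (Complex x s)) * f (Complex x s))) integrable_on cbox (-R) R"
      by (rule integrable_continuous)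
         (use s in \<open>auto intro!: continuous_intros continuous_on_compose2[OF contF] continuous_on_compose2[OF contf]\<close>)
  next
    show "continuous_on ({0<..} \<times> cbox (-R) R) (\<lambda>(t, x). \<psi> t x)"
      unfolding \<psi>_def split_def
      by (auto intro!: continuous_intros continuous_on_compose2[OF contF] continuous_on_compose2[OF contf]
          continuous_on_compose2[OF f'])
  qed (use t in auto)
  then have 1: "((\<lambda>t. integral {-R..R} (\<lambda>x. Im (cnj (F (Complex x t)) * f (Complex x t)))) has_field_derivative
      integral {-R..R} (\<psi> t)) (at t)"
    using t by (simp add: at_within_open[of t "{0<..}"])
  have "((\<lambda>x. (norm (f (Complex x t)))\<^sup>2 + Re (cnj (F (Complex x t)) * f' (Complex x t))) has_integral
     (Re (cnj (F (Complex R t)) * f (Complex R t)) - Re (cnj (F (Complex (-R) t)) * f (Complex (-R) t)))) {-R..R}"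
  proof (rule fundamental_theorem_of_calculus)
    fix x
    have v: "((\<lambda>x. cnj (F (Complex x t)) * f (Complex x t)) has_vector_derivative
      (cnj (F (Complex x t)) * f' (Complex x t) + cnj (f (Complex x t)) * f (Complex x t))) (at x within {-R..R})"
      by (intro has_vector_derivative_mult has_vector_derivative_cnj has_vector_derivative_horizontal F f) (use t in auto)
    have eq: "Re (cnj (F (Complex x t)) * f' (Complex x t) + cnj (f (Complex x t)) * f (Complex x t))
       = (norm (f (Complex x t)))\<^sup>2 + Re (cnj (F (Complex x t)) * f' (Complex x t))"
      unfolding cmod_power2 by (simp add: power2_eq_square)
    show "((\<lambda>x. Re (cnj (F (Complex x t)) * f (Complex x t))) has_vector_derivative
       ((norm (f (Complex x t)))\<^sup>2 + Re (cnj (F (Complex x t)) * f' (Complex x t)))) (at x within {-R..R})"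
      using bounded_linear.has_vector_derivative[OF bounded_linear_Re v] by (simp only: eq)
  qed (use R in simp)
  moreover have n: "((\<lambda>x. (norm (f (Complex x t)))\<^sup>2) has_integral integral {-R..R} (\<lambda>x. (norm (f (Complex x t)))\<^sup>2)) {-R..R}"
    by (intro integrable_integral integrable_continuous_real)
       (use t in \<open>auto intro!: continuous_intros continuous_on_compose2[OF contf]\<close>)
  ultimately have "(\<psi> t has_integral
      (Re (cnj (F (Complex R t)) * f (Complex R t)) - Re (cnj (F (Complex (-R) t)) * f (Complex (-R) t))
        - 2 * integral {-R..R} (\<lambda>x. (norm (f (Complex x t)))\<^sup>2))) {-R..R}"
    using has_integral_diff[OF _ has_integral_mult_right[OF n, of 2]] by (fastforce simp: \<psi>_def[abs_def] algebra_simps)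
  with 1 show ?thesis by (simp add: integral_unique)
qed

text \<open>The mean value theorem in the height is applied on \<open>{-R..R}\<close>, where the end
  terms are at most \<open>K * (D R + D (- R))\<close> and disappear as \<open>R\<close> grows. To
  survive this limit, \<open>\<delta>\<close> has to be the same for all large \<open>R\<close> and
  all heights in between.\<close>

lemma area_decreasing:
  assumes f: "hp f" and st: "0 < s" "s < t"
    and \<delta>: "\<And>\<xi> R. s \<le> \<xi> \<Longrightarrow> \<xi> \<le> t \<Longrightarrow> R \<ge> R0 \<Longrightarrow> \<delta> \<le> integral {-R..R} (\<lambda>x. (norm (f (Complex x \<xi>)))\<^sup>2)"
  shows "2 * \<delta> * (t - s) \<le> Im (H s f f) - Im (H t f f)"
proof -
  obtain F where F: "\<And>z. Im z > 0 \<Longrightarrow> (F has_field_derivative f z) (at z)"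
    "\<And>x t. t > 0 \<Longrightarrow> line_primitive f t x = F (Complex x t)"
    using hp_primitive[OF f] by blast
  have f': "(f has_field_derivative deriv f z) (at z)" if "Im z > 0" for z
    using holomorphic_derivI[OF hpD(1)[OF f] open_upper_half_plane, of z] that by simp
  have cf': "continuous_on {z. Im z > 0} (deriv f)"
    by (intro holomorphic_on_imp_continuous_on holomorphic_deriv hpD(1)[OF f] open_upper_half_plane)
  define A where "A R t = integral {-R..R} (\<lambda>x. Im (cnj (F (Complex x t)) * f (Complex x t)))" for R t
  have bound: "norm (cnj (F (Complex x \<xi>)) * f (Complex x \<xi>)) \<le> K * D x" if "\<xi> > 0" "x \<notin> E" for x \<xi>
    using mult_mono[OF line_primitive_bound[OF f, of \<xi> x] hpD(2)[OF f that(2), of \<xi>] K_nonneg] that F(2)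
    by (simp add: norm_mult)
  have step: "A R t - A R s \<le> (t - s) * (K * (D R + D (- R)) - 2 * \<delta>)"
    if R: "R > 0" "R \<ge> R0" "R \<notin> E" "- R \<notin> E" for R
  proof -
    define A' where "A' \<xi> = Re (cnj (F (Complex R \<xi>)) * f (Complex R \<xi>)) - Re (cnj (F (Complex (-R) \<xi>)) * f (Complex (-R) \<xi>))
        - 2 * integral {-R..R} (\<lambda>x. (norm (f (Complex x \<xi>)))\<^sup>2)" for \<xi>
    have "DERIV (A R) \<xi> :> A' \<xi>" if "s \<le> \<xi>" "\<xi> \<le> t" for \<xi>
      using area_derivative[OF F(1) f' cf', of \<xi> R] that st R by (simp add: A_def[abs_def] A'_def)
    then obtain \<xi> where \<xi>: "s < \<xi>" "\<xi> < t" "A R t - A R s = (t - s) * A' \<xi>"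
      using MVT2[OF st(2), of "A R" A'] by blast
    have "\<bar>Re (cnj (F (Complex R \<xi>)) * f (Complex R \<xi>))\<bar> \<le> K * D R"
      using bound[of \<xi> R] abs_Re_le_cmod order_trans \<xi> st R by (metis less_trans)
    moreover have "\<bar>Re (cnj (F (Complex (-R) \<xi>)) * f (Complex (-R) \<xi>))\<bar> \<le> K * D (-R)"
      using bound[of \<xi> "-R"] abs_Re_le_cmod order_trans \<xi> st R by (metis less_trans)
    moreover have "\<delta> \<le> integral {-R..R} (\<lambda>x. (norm (f (Complex x \<xi>)))\<^sup>2)" using \<delta>[of \<xi> R] \<xi> R by simp
    ultimately have "A' \<xi> \<le> K * (D R + D (- R)) - 2 * \<delta>"
      unfolding A'_def by (simp add: distrib_left abs_le_iff)
    then show ?thesis using \<xi>(3) st by simp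
  qed
  have lim: "((\<lambda>R. A R \<xi>) \<longlongrightarrow> Im (H \<xi> f f)) at_top" if "\<xi> > 0" for \<xi>
  proof -
    have int: "integrable lborel (\<lambda>x. cnj (F (Complex x \<xi>)) * f (Complex x \<xi>))"
      using H_integrable[OF f f, of \<xi>] that by (simp add: F(2))
    have "Im (H \<xi> f f) = (LINT x|lborel. Im (cnj (F (Complex x \<xi>)) * f (Complex x \<xi>)))"
      unfolding H_def using that by (simp only: F(2) integral_Im[OF int])
    then show ?thesis
      using tendsto_symmetric_integral[OF integrable_Im[OF int]] by (simp add: A_def)
  qed
  have "((\<lambda>R. (t - s) * (K * (D R + D (- R)) - 2 * \<delta>)) \<longlongrightarrow> (t - s) * (K * 0 - 2 * \<delta>)) at_top"
    by (intro tendsto_intros tendsto_D_symmetric)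
  moreover have "((\<lambda>R. A R t - A R s) \<longlongrightarrow> Im (H t f f) - Im (H s f f)) at_top"
    using st by (intro tendsto_intros lim) auto
  moreover have "\<forall>\<^sub>F R in at_top. A R t - A R s \<le> (t - s) * (K * (D R + D (- R)) - 2 * \<delta>)"
    using eventually_notin_E_top eventually_gt_at_top[of 0] eventually_ge_at_top[of R0]
    by eventually_elim (use step in auto)
  ultimately have "Im (H t f f) - Im (H s f f) \<le> (t - s) * (K * 0 - 2 * \<delta>)"
    using tendsto_le[OF trivial_limit_at_top_linorder] by blast
  then show ?thesis by (simp add: algebra_simps)
qed

text \<open>\<open>Im (H t f f)\<close> does not increase with \<open>t\<close> and tends to 0, so
  it is nonnegative; across a square around \<open>z0\<close> on which \<open>f\<close> is bounded
  away from 0 it drops by a definite amount.\<close>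

lemma H_positive:
  assumes f: "hp f" and z0: "Im z0 > 0" "f z0 \<noteq> 0"
  shows "Im (H 0 f f) > 0"
proof -
  have nn: "0 \<le> integral {-R..R} (\<lambda>x. (norm (f (Complex x \<xi>)))\<^sup>2)" if "\<xi> > 0" for R \<xi>
    by (intro integral_nonneg integrable_continuous_real)
       (use that in \<open>auto intro!: continuous_intros hp_line_continuous[OF f]\<close>)
  have mono: "Im (H t f f) \<le> Im (H s f f)" if "0 < s" "s < t" for s t
    using area_decreasing[OF f that, of 0 0] nn that by force
  have nonneg: "0 \<le> Im (H s f f)" if "s > 0" for s
  proof (rule tendsto_upperbound[OF tendsto_Im[OF H_tendsto_top[OF f f]], of "Im (H s f f)", simplified])
    show "\<forall>\<^sub>F t in at_top. Im (H t f f) \<le> Im (H s f f)"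
      using eventually_gt_at_top[of s] by eventually_elim (rule mono[OF that])
  qed
  obtain c r where c: "c > 0" and r: "r > 0" "2 * r < Im z0"
    and cr: "\<And>z. \<bar>Re z - Re z0\<bar> \<le> r \<Longrightarrow> \<bar>Im z - Im z0\<bar> \<le> r \<Longrightarrow> c \<le> norm (f z)"
  proof -
    have "isCont f z0"
      using hp_continuous[OF f] z0(1) open_upper_half_plane by (simp add: continuous_on_eq_continuous_at)
    then have "((\<lambda>z. norm (f z)) \<longlongrightarrow> norm (f z0)) (at z0)"
      unfolding isCont_def by (rule tendsto_norm)
    then have "\<forall>\<^sub>F z in at z0. norm (f z0) / 2 < norm (f z)"
      by (rule order_tendstoD) (use z0 in simp)
    then obtain d where d: "d > 0" "\<And>z. z \<noteq> z0 \<Longrightarrow> dist z z0 < d \<Longrightarrow> norm (f z0) / 2 < norm (f z)"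
      unfolding eventually_at by blast
    \<comment> \<open>A third of \<open>d\<close> keeps the square inside the disc, as two
      coordinate differences of size \<open>r\<close> add up to less than \<open>d\<close>; a third
      of \<open>Im z0\<close> keeps it above the real line.\<close>
    define r where "r = min (d / 3) (Im z0 / 3)"
    show thesis
    proof (rule that[of "norm (f z0) / 2" r])
      show "norm (f z0) / 2 > 0" using z0 by simp
      show "r > 0" "2 * r < Im z0" using d z0 by (auto simp: r_def min_def)
      fix z assume z: "\<bar>Re z - Re z0\<bar> \<le> r" "\<bar>Im z - Im z0\<bar> \<le> r"
      have "dist z z0 \<le> \<bar>Re (z - z0)\<bar> + \<bar>Im (z - z0)\<bar>" unfolding dist_norm by (rule cmod_le)
      also have "\<dots> < d" using z d by (simp add: r_def)
      finally show "norm (f z0) / 2 \<le> norm (f z)" using d(2)[of z] by (cases "z = z0") auto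
    qed
  qed
  define s where "s = Im z0 - r"
  define t where "t = Im z0 + r"
  have st: "0 < s" "s < t" using r by (auto simp: s_def t_def)
  \<comment> \<open>Each horizontal section of the square has length \<open>2 * r\<close> and
    carries at least \<open>c\<^sup>2\<close> of energy per unit length.\<close>
  have "2 * (2 * r * c\<^sup>2) * (t - s) \<le> Im (H s f f) - Im (H t f f)"
  proof (rule area_decreasing[OF f st])
    fix \<xi> R assume \<xi>: "s \<le> \<xi>" "\<xi> \<le> t" and R: "R \<ge> \<bar>Re z0\<bar> + r"
    define g where "g x = (norm (f (Complex x \<xi>)))\<^sup>2" for x
    have g: "g integrable_on {a..b}" for a b
      unfolding g_def by (intro integrable_continuous_real)
        (use \<xi> st in \<open>auto intro!: continuous_intros hp_line_continuous[OF f]\<close>)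
    have "2 * r * c\<^sup>2 = integral {Re z0 - r..Re z0 + r} (\<lambda>x. c\<^sup>2)" using r by simp
    also have "\<dots> \<le> integral {Re z0 - r..Re z0 + r} g"
      by (rule integral_le[OF _ g]) (use cr c \<xi> in \<open>auto simp: g_def s_def t_def abs_le_iff intro!: power_mono\<close>)
    also have "\<dots> \<le> integral {-R..R} g"
      by (rule integral_subset_le[OF _ g g]) (use R in \<open>auto simp: g_def\<close>)
    finally show "2 * r * c\<^sup>2 \<le> integral {-R..R} (\<lambda>x. (norm (f (Complex x \<xi>)))\<^sup>2)" by (simp add: g_def[abs_def])
  qed
  moreover have "0 < 2 * (2 * r * c\<^sup>2) * (t - s)" using r c st by simp
  ultimately have pos: "Im (H s f f) > 0" using nonneg[of t] st by linarith
  have "Im (H s f f) \<le> Im (H 0 f f)"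
  proof (rule tendsto_lowerbound[OF tendsto_Im[OF H_tendsto_0[OF f f]]])
    show "\<forall>\<^sub>F t in at_right 0. Im (H s f f) \<le> Im (H t f f)"
      unfolding eventually_at_right_field using mono[of _ s] st by (intro exI[of _ s]) auto
  qed simp
  with pos show ?thesis by linarith
qed

text \<open>Half of \<open>Im (H 0 g f)\<close>, rewritten so that it can be evaluated interval by
  interval on the boundary.\<close>

definition period_form :: "(complex \<Rightarrow> complex) \<Rightarrow> (complex \<Rightarrow> complex) \<Rightarrow> real" where
  "period_form f g = - (LINT x|lborel. Re (f (Complex x 0)) * Im (line_primitive g 0 x))"

text \<open>Pointwise \<open>Im (cnj P * q) - Im (P * q) = - 2 * Re q * Im P\<close>, and the
  integral of \<open>P * q\<close> is zero by Cauchy's theorem.\<close>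

lemma period_form_eq:
  assumes f: "hp f" and g: "hp g"
  shows "2 * period_form f g = Im (H 0 g f)"
proof -
  define P where "P = line_primitive g 0"
  define q where "q x = f (Complex x 0)" for x
  have i1: "integrable lborel (\<lambda>x. cnj (P x) * q x)"
    using H_integrable[OF g f, of 0] by (simp add: P_def q_def)
  interpret KD: majorant E "\<lambda>x. K * D x" by (rule majorant_cmult[OF K_nonneg])
  have i2: "integrable lborel (\<lambda>x. P x * q x)"
    using KD.hp_line_integrable[OF hp_times_primitive[OF g f], of 0] by (simp add: P_def q_def)
  have "Im (H 0 g f) - Im (LINT x|lborel. P x * q x)
      = (LINT x|lborel. Im (cnj (P x) * q x)) - (LINT x|lborel. Im (P x * q x))"
    unfolding integral_Im[OF i1] integral_Im[OF i2] by (simp add: H_def P_def q_def)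
  also have "\<dots> = (LINT x|lborel. Im (cnj (P x) * q x) - Im (P x * q x))"
    by (rule Bochner_Integration.integral_diff[symmetric]; rule integrable_Im) (rule i1 i2)+
  also have "(\<lambda>x. Im (cnj (P x) * q x) - Im (P x * q x)) = (\<lambda>x. (-2) * (Re (q x) * Im (P x)))"
    by (auto simp: fun_eq_iff)
  also have "(LINT x|lborel. (-2) * (Re (q x) * Im (P x))) = 2 * period_form f g"
    by (simp add: period_form_def P_def q_def)
  finally show ?thesis using integral_primitive_times_eq_0[OF g f] by (simp add: P_def q_def)
qed

theorem period_form_commute:
  assumes "hp f" and "hp g"
  shows "period_form f g = period_form g f"
  using arg_cong[OF H_antihermitian[OF assms], of Im] period_form_eq[OF assms] period_form_eq[OF assms(2,1)]
  by simp

theorem period_form_positive: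
  assumes "hp f" and "Im z > 0" "f z \<noteq> 0"
  shows "period_form f f > 0"
  using H_positive[OF assms] period_form_eq[OF assms(1,1)] by simp

end

subsection \<open>The square root of the curve polynomial\<close>

text \<open>
  The square root whose cut is the negative imaginary axis: it is continuous up to the real line
  from above, away from the origin.
\<close>

definition up_sqrt :: "complex \<Rightarrow> complex" where
  "up_sqrt z = cis (pi / 4) * csqrt (- (\<i> * z))"

lemma cis_pi_4_square: "cis (pi / 4) ^ 2 = \<i>"
  by (simp add: power2_eq_square cis_mult)

lemma up_sqrt_square: "up_sqrt z ^ 2 = z"
  by (simp add: up_sqrt_def power_mult_distrib cis_pi_4_square)

lemma up_sqrt_eq_0_iff [simp]: "up_sqrt z = 0 \<longleftrightarrow> z = 0"
  by (simp add: up_sqrt_def)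

lemma up_sqrt_real_pos:
  assumes "x > 0" shows "up_sqrt (complex_of_real x) = complex_of_real (sqrt x)"
proof -
  have "csqrt (- (\<i> * complex_of_real x)) = complex_of_real (sqrt x) * cis (- (pi / 4))"
  proof (rule csqrt_unique)
    have "cis (- (pi / 4)) ^ 2 = - \<i>"
      using arg_cong[OF cis_pi_4_square, of cnj] by (simp add: cis_cnj)
    then show "(complex_of_real (sqrt x) * cis (- (pi / 4)))\<^sup>2 = - (\<i> * complex_of_real x)"
      using assms by (simp add: power_mult_distrib flip: of_real_power)
    show "0 < Re (complex_of_real (sqrt x) * cis (- (pi / 4))) \<or>
       Re (complex_of_real (sqrt x) * cis (- (pi / 4))) = 0 \<and> 0 \<le> Im (complex_of_real (sqrt x) * cis (- (pi / 4)))"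
      using assms by (simp add: cos_45)
  qed
  then show ?thesis by (simp add: up_sqrt_def mult.left_commute cis_mult)
qed

lemma up_sqrt_real_neg:
  assumes "x < 0" shows "up_sqrt (complex_of_real x) = \<i> * complex_of_real (sqrt (- x))"
proof -
  have "csqrt (- (\<i> * complex_of_real x)) = complex_of_real (sqrt (- x)) * cis (pi / 4)"
  proof (rule csqrt_unique)
    have "(complex_of_real (sqrt (- x)))\<^sup>2 = - complex_of_real x"
      using assms by (simp flip: of_real_power)
    then show "(complex_of_real (sqrt (- x)) * cis (pi / 4))\<^sup>2 = - (\<i> * complex_of_real x)"
      by (simp add: power_mult_distrib cis_pi_4_square)
    show "0 < Re (complex_of_real (sqrt (- x)) * cis (pi / 4)) \<or>
       Re (complex_of_real (sqrt (- x)) * cis (pi / 4)) = 0 \<and> 0 \<le> Im (complex_of_real (sqrt (- x)) * cis (pi / 4))"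
      using assms by (simp add: cos_45)
  qed
  then show ?thesis
    by (simp add: up_sqrt_def) (metis cis_pi_4_square mult.commute mult.assoc power2_eq_square)
qed

lemma up_sqrt_slit:
  assumes "Im z \<ge> 0" "z \<noteq> 0" shows "- (\<i> * z) \<notin> \<real>\<^sub>\<le>\<^sub>0"
  using assms by (auto simp: complex_nonpos_Reals_iff complex_eq_iff)

lemma isCont_up_sqrt:
  assumes "Im z \<ge> 0" "z \<noteq> 0" shows "isCont up_sqrt z"
proof -
  have "isCont (\<lambda>z. csqrt (- (\<i> * z))) z"
    by (rule isCont_o2[where f = "\<lambda>z. - (\<i> * z)" and g = csqrt])
       (auto intro!: continuous_intros continuous_at_csqrt up_sqrt_slit[OF assms])
  then show ?thesis unfolding up_sqrt_def[abs_def] by (intro continuous_intros)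
qed

lemma up_sqrt_holomorphic: "(\<lambda>z. up_sqrt (z - complex_of_real a)) holomorphic_on {z. Im z > 0}"
  unfolding up_sqrt_def
proof (intro holomorphic_intros)
  show "- (\<i> * (z - complex_of_real a)) \<notin> \<real>\<^sub>\<le>\<^sub>0" if "z \<in> {z. 0 < Im z}" for z
    using up_sqrt_slit[of "z - complex_of_real a"] that by (auto simp: complex_eq_iff)
qed

subsection \<open>An integrable majorant\<close>

lemma integrable_inverse_sqrt_decay: 
  "integrable lborel (\<lambda>u::real. if 0 < u \<and> u \<le> 1 then u powr (-1/2) else if 1 < u then u powr (-3/2) else 0)"
  (is "integrable lborel ?k")
proof -
  have 1: "((\<lambda>u::real. u powr (-1/2)) has_integral 2) {0..1}"
    using has_integral_powr_from_0[of "-1/2" 1] by simp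
  have 2: "((\<lambda>u::real. u powr (-3/2)) has_integral 2) {1..}"
    using has_integral_powr_to_inf[of "-3/2" 1] by simp
  have a: "(?k has_integral 2) {0..1}"
    by (rule has_integral_spike[OF negligible_sing[of 0] _ 1]) auto
  have b: "(?k has_integral 2) {1..}"
    by (rule has_integral_spike[OF negligible_sing[of 1] _ 2]) auto
  have "(?k has_integral 4) ({0..1} \<union> {1..})"
    using has_integral_Un[OF a b] negligible_subset[OF negligible_sing[of "1::real"], of "{0..1} \<inter> {1..}"] by fastforce
  then have "(?k has_integral 4) UNIV"
    by (rule has_integral_on_superset) auto
  then have "?k absolutely_integrable_on UNIV"
    by (intro nonnegative_absolutely_integrable_1) (auto simp: integrable_on_def)
  then have "integrable lebesgue ?k" by (simp add: set_integrable_def)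
  then show ?thesis by (subst (asm) integrable_completion) auto
qed

text \<open>With \<open>u = \<bar>x - a\<bar>\<close> the integrand is at most
  \<open>u powr (-1/2)\<close> near \<open>a\<close>. Far away
  \<open>u \<le> (1 + \<bar>a\<bar>) * sqrt (1 + x^2)\<close> gives the decay
  \<open>u powr (-3/2)\<close> and explains the constant.\<close>

lemma integrable_inverse_sqrt_times_decay:
  "integrable lborel (\<lambda>x. 1 / (sqrt \<bar>x - a\<bar> * sqrt (1 + x\<^sup>2)))"
proof -
  define k :: "real \<Rightarrow> real" where
    "k u = (if 0 < u \<and> u \<le> 1 then u powr (-1/2) else if 1 < u then u powr (-3/2) else 0)" for u
  have k: "integrable lborel k"
    using integrable_inverse_sqrt_decay by (simp add: k_def[abs_def])
  have "integrable lborel (\<lambda>x. k (- a + 1 * x))" "integrable lborel (\<lambda>x. k (a + (- 1) * x))"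
    by (rule lborel_integrable_real_affine[OF k]; simp)+
  then have i: "integrable lborel (\<lambda>x. (1 + \<bar>a\<bar>) * (k (x - a) + k (a - x)))"
    by (intro integrable_mult_right Bochner_Integration.integrable_add) simp_all
  have bound: "1 / (sqrt \<bar>x - a\<bar> * sqrt (1 + x\<^sup>2)) \<le> (1 + \<bar>a\<bar>) * (k (x - a) + k (a - x))" for x
  proof -
    define u where "u = \<bar>x - a\<bar>"
    \<comment> \<open>\<open>k\<close> vanishes off the positive numbers, so at most one of the two
      reflected terms is nonzero.\<close>
    have ku: "k (x - a) + k (a - x) = k u" by (auto simp: k_def u_def)
    have s1: "1 \<le> sqrt (1 + x\<^sup>2)" by simp
    then have s0: "0 < sqrt (1 + x\<^sup>2)" by linarith
    consider "u = 0" | "0 < u" "u \<le> 1" | "1 < u" using abs_ge_zero[of "x - a"] unfolding u_def by linarith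
    then have "1 / (sqrt u * sqrt (1 + x\<^sup>2)) \<le> (1 + \<bar>a\<bar>) * k u"
    proof cases
      case 2
      have "1 / (sqrt u * sqrt (1 + x\<^sup>2)) \<le> 1 / (sqrt u * 1)"
        using 2 s1 s0 by (intro divide_left_mono mult_left_mono mult_pos_pos) auto
      also have "1 / (sqrt u * 1) = k u"
      proof -
        have "u powr (-1/2) = inverse (u powr (1/2))" using powr_minus[of u "1/2"] by simp
        then have "k u = inverse (sqrt u)" using 2 by (simp only: k_def if_True simp_thms powr_half_sqrt less_imp_le)
        then show ?thesis by (simp add: divide_inverse)
      qed
      also have "k u \<le> (1 + \<bar>a\<bar>) * k u"
      proof -
        have "0 \<le> k u" by (simp add: k_def)
        then show ?thesis using mult_right_mono[of 1 "1 + \<bar>a\<bar>" "k u"] by simp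
      qed
      finally show ?thesis .
    next
      case 3
      have "\<bar>x\<bar> \<le> sqrt (1 + x\<^sup>2)" by (rule real_le_rsqrt) simp
      then have "u \<le> sqrt (1 + x\<^sup>2) + \<bar>a\<bar> * 1" unfolding u_def by linarith
      also have "\<dots> \<le> sqrt (1 + x\<^sup>2) + \<bar>a\<bar> * sqrt (1 + x\<^sup>2)"
        by (intro add_left_mono mult_left_mono s1) simp
      finally have u: "u / (1 + \<bar>a\<bar>) \<le> sqrt (1 + x\<^sup>2)" by (simp add: field_simps)
      have "1 / (sqrt u * sqrt (1 + x\<^sup>2)) \<le> 1 / (sqrt u * (u / (1 + \<bar>a\<bar>)))"
        using 3 u s0 by (intro divide_left_mono mult_left_mono mult_pos_pos) auto
      also have "\<dots> = (1 + \<bar>a\<bar>) * (1 / (sqrt u * u))" by simp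
      also have "sqrt u * u = u powr (3/2)"
        using 3 powr_add[of u "1/2" 1] by (simp add: powr_half_sqrt)
      also have "1 / u powr (3/2) = k u"
      proof -
        have "u powr (-3/2) = inverse (u powr (3/2))" using powr_minus[of u "3/2"] by simp
        moreover have "k u = u powr (-3/2)" using 3 by (simp add: k_def)
        ultimately show ?thesis by (simp add: inverse_eq_divide)
      qed
      finally show ?thesis .
    qed (simp add: k_def)
    then show ?thesis by (simp add: ku u_def)
  qed
  show ?thesis
  proof (rule Bochner_Integration.integrable_bound[OF i])
    show "AE x in lborel. norm (1 / (sqrt \<bar>x - a\<bar> * sqrt (1 + x\<^sup>2))) \<le> norm ((1 + \<bar>a\<bar>) * (k (x - a) + k (a - x)))"
    proof (rule AE_I2)
      fix x
      have "0 \<le> 1 / (sqrt \<bar>x - a\<bar> * sqrt (1 + x\<^sup>2))" by simp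
      with bound[of x] show "norm (1 / (sqrt \<bar>x - a\<bar> * sqrt (1 + x\<^sup>2))) \<le> norm ((1 + \<bar>a\<bar>) * (k (x - a) + k (a - x)))"
        unfolding real_norm_def by linarith
    qed
  qed measurable
qed

text \<open>\<open>P\<close> is \<open>q\<close> minus its Lagrange interpolant at the nodes
  \<open>A\<close>; it has degree below \<open>card A\<close> and vanishes on
  \<open>A\<close>.\<close>

lemma lagrange_partial_fractions:
  fixes q :: "complex poly"
  assumes "finite A" and "degree q < card A" and "z \<notin> A"
  shows "poly q z / (\<Prod>a\<in>A. z - a) = (\<Sum>a\<in>A. poly q a / (\<Prod>b\<in>A - {a}. a - b) / (z - a))"
proof -
  define c where "c a = poly q a / (\<Prod>b\<in>A - {a}. a - b)" for a
  define P where "P = q - (\<Sum>a\<in>A. smult (c a) (\<Prod>b\<in>A - {a}. [:- b, 1:]))"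
  have poly_P: "poly P w = poly q w - (\<Sum>a\<in>A. c a * (\<Prod>b\<in>A - {a}. w - b))" for w
    by (simp add: P_def poly_sum poly_prod)
  have zero: "poly P w = 0" if "w \<in> A" for w
  proof -
    have "(\<Sum>a\<in>A. c a * (\<Prod>b\<in>A - {a}. w - b)) = (\<Sum>a\<in>A. if a = w then c w * (\<Prod>b\<in>A - {w}. w - b) else 0)"
      using assms(1) that by (intro sum.cong) (auto intro!: prod_zero)
    also have "\<dots> = poly q w" using assms(1) that by (auto simp: c_def)
    finally show ?thesis by (simp add: poly_P)
  qed
  have "P = 0"
  proof (rule ccontr)
    assume "P \<noteq> 0"
    have "degree (\<Prod>b\<in>A - {a}. [:- b, 1:]) \<le> card A - 1" if "a \<in> A" for a
      using degree_prod_sum_le[of "A - {a}" "\<lambda>b. [:- b, 1:]"] assms(1) that by simp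
    then have "degree (\<Sum>a\<in>A. smult (c a) (\<Prod>b\<in>A - {a}. [:- b, 1:])) \<le> card A - 1"
      using assms(1) by (intro degree_sum_le) (auto intro: order_trans[OF degree_smult_le])
    then have "degree P \<le> card A - 1"
      unfolding P_def using assms(2) by (intro degree_diff_le) auto
    then have "degree P < card A" using assms(2) by linarith
    moreover have "card A \<le> card {w. poly P w = 0}"
      using zero \<open>P \<noteq> 0\<close> by (intro card_mono poly_roots_finite) auto
    ultimately show False using card_poly_roots_bound[OF \<open>P \<noteq> 0\<close>] by simp
  qed
  then have "poly q z = (\<Sum>a\<in>A. c a * (\<Prod>b\<in>A - {a}. z - b))" using poly_P[of z] by simp
  then have "poly q z / (\<Prod>a\<in>A. z - a) = (\<Sum>a\<in>A. c a * (\<Prod>b\<in>A - {a}. z - b) / (\<Prod>a\<in>A. z - a))"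
    by (simp add: sum_divide_distrib)
  also have "\<dots> = (\<Sum>a\<in>A. c a / (z - a))"
  proof (intro sum.cong refl)
    fix a assume a: "a \<in> A"
    have "(\<Prod>a\<in>A. z - a) = (z - a) * (\<Prod>b\<in>A - {a}. z - b)" using assms(1) a by (rule prod.remove)
    moreover have "(\<Prod>b\<in>A - {a}. z - b) \<noteq> 0" using assms(1,3) by auto
    ultimately show "c a * (\<Prod>b\<in>A - {a}. z - b) / (\<Prod>a\<in>A. z - a) = c a / (z - a)" by simp
  qed
  finally show ?thesis by (simp add: c_def)
qed

subsection \<open>Differentials on the boundary of the upper half-plane\<close>

text \<open>The l2 norm is at most the l1 norm. This splits the square root of a partial fraction
  bound into one term per branch point.\<close>

lemma sum_power2_le_power2_sum:
  fixes f :: "'a \<Rightarrow> real"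
  assumes "\<And>a. a \<in> A \<Longrightarrow> 0 \<le> f a"
  shows "(\<Sum>a\<in>A. (f a)\<^sup>2) \<le> (\<Sum>a\<in>A. f a)\<^sup>2"
proof -
  have "(\<Sum>a\<in>A. (f a)\<^sup>2) = (L2_set f A)\<^sup>2" by (simp add: L2_set_def sum_nonneg)
  also have "\<dots> \<le> (\<Sum>a\<in>A. f a)\<^sup>2" by (intro power_mono L2_set_le_sum L2_set_nonneg assms)
  finally show ?thesis .
qed

locale real_branch_points =
  fixes g :: nat and e :: "nat \<Rightarrow> real"
  assumes genus_pos: "0 < g" and e_mono: "strict_mono_on {1..2 * g + 1} e"
begin

definition N :: nat where "N = 2 * g + 1"

definition E :: "real set" where "E = e ` {1..N}"

definition sqrt_curve :: "complex \<Rightarrow> complex" where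
  "sqrt_curve z = (\<Prod>j\<in>{1..N}. up_sqrt (z - complex_of_real (e j)))"

definition form :: "complex poly \<Rightarrow> complex \<Rightarrow> complex" where
  "form p z = poly p z / sqrt_curve z"

text \<open>The inverse square roots are integrable at the branch points but decay too slowly; the
  extra factor \<open>1 / sqrt (1 + x^2)\<close> makes up for it and stems from the weight
  \<open>z + \<i>\<close> in \<open>form_bound\<close>.\<close>

definition D :: "real \<Rightarrow> real \<Rightarrow> real" where
  "D C x = C * (\<Sum>j\<in>{1..N}. 1 / (sqrt \<bar>x - e j\<bar> * sqrt (1 + x\<^sup>2)))"

lemma finite_E: "finite E" unfolding E_def by simp

lemma e_less: "i \<in> {1..N} \<Longrightarrow> j \<in> {1..N} \<Longrightarrow> i < j \<Longrightarrow> e i < e j"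
  using e_mono by (simp add: strict_mono_on_def N_def)

lemma e_le: "i \<in> {1..N} \<Longrightarrow> j \<in> {1..N} \<Longrightarrow> i \<le> j \<Longrightarrow> e i \<le> e j"
  using e_less[of i j] by (cases "i = j") auto

lemma e_inj: "inj_on e {1..N}"
  using e_mono unfolding N_def by (rule strict_mono_on_imp_inj_on)

lemma majorant_D:
  assumes "C \<ge> 0" shows "majorant E (D C)"
proof
  show "finite E" by (rule finite_E)
  show "0 \<le> D C x" for x using assms unfolding D_def by (intro mult_nonneg_nonneg sum_nonneg) auto
  show "integrable lborel (D C)"
    unfolding D_def[abs_def]
    by (intro integrable_mult_right Bochner_Integration.integrable_sum integrable_inverse_sqrt_times_decay)
  have top: "((\<lambda>x::real. 1 / (sqrt \<bar>x - a\<bar> * sqrt (1 + x\<^sup>2))) \<longlongrightarrow> 0) at_top" for a :: real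
    by real_asymp
  have bot: "((\<lambda>x::real. 1 / (sqrt \<bar>x - a\<bar> * sqrt (1 + x\<^sup>2))) \<longlongrightarrow> 0) at_bot" for a :: real
    by real_asymp
  have "((\<lambda>x. D C x) \<longlongrightarrow> C * (\<Sum>j\<in>{1..N}. 0)) at_top"
    unfolding D_def by (intro tendsto_intros top)
  then show "(D C \<longlongrightarrow> 0) at_top" by simp
  have "((\<lambda>x. D C x) \<longlongrightarrow> C * (\<Sum>j\<in>{1..N}. 0)) at_bot"
    unfolding D_def by (intro tendsto_intros bot)
  then show "(D C \<longlongrightarrow> 0) at_bot" by simp
qed

lemma notin_E: "x \<notin> E \<Longrightarrow> j \<in> {1..N} \<Longrightarrow> x \<noteq> e j"
  unfolding E_def by auto

lemma sqrt_curve_square: "sqrt_curve z ^ 2 = (\<Prod>j\<in>{1..N}. z - complex_of_real (e j))"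
  unfolding sqrt_curve_def by (simp only: prod_power_distrib up_sqrt_square)

lemma sqrt_curve_nonzero:
  assumes "Im z > 0 \<or> Re z \<notin> E" shows "sqrt_curve z \<noteq> 0"
proof -
  have "z \<noteq> complex_of_real (e j)" if "j \<in> {1..N}" for j
    using assms that by (auto simp: E_def)
  then show ?thesis unfolding sqrt_curve_def by simp
qed

lemma sqrt_curve_holomorphic: "sqrt_curve holomorphic_on {z. Im z > 0}"
  unfolding sqrt_curve_def[abs_def] by (intro holomorphic_on_prod up_sqrt_holomorphic)

lemma isCont_sqrt_curve:
  assumes "Im z \<ge> 0" "Re z \<notin> E" shows "isCont sqrt_curve z"
  unfolding sqrt_curve_def[abs_def]
proof (intro continuous_intros)
  fix j assume "j \<in> {1..N}"
  then have "z - complex_of_real (e j) \<noteq> 0" using notin_E[OF assms(2)] by (auto simp: complex_eq_iff)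
  then show "isCont (\<lambda>z. up_sqrt (z - complex_of_real (e j))) z"
    by (intro isCont_o2[where f = "\<lambda>z. z - complex_of_real (e j)" and g = up_sqrt] isCont_up_sqrt)
       (use assms in \<open>auto intro!: continuous_intros\<close>)
qed

text \<open>
  By partial fractions, \<open>(form p z * (z + \<i>))\<^sup>2\<close> is \<open>\<Sum>j. r\<^sub>j / (z - e\<^sub>j)\<close>, and \<open>\<bar>z - e\<^sub>j\<bar> \<ge> \<bar>Re z - e\<^sub>j\<bar>\<close>.
\<close>

lemma form_bound:
  assumes "degree p < g"
  obtains C where "C \<ge> 0"
    "\<And>x t. x \<notin> E \<Longrightarrow> 0 \<le> t \<Longrightarrow> norm (form p (Complex x t)) * norm (Complex x t + \<i>) \<le> C * (\<Sum>j\<in>{1..N}. 1 / sqrt \<bar>x - e j\<bar>)"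
proof -
  define A where "A = (\<lambda>j. complex_of_real (e j)) ` {1..N}"
  have inj: "inj_on (\<lambda>j. complex_of_real (e j)) {1..N}"
    using e_inj unfolding inj_on_def of_real_eq_iff .
  have cA: "card A = N" unfolding A_def by (simp only: card_image[OF inj]) simp
  \<comment> \<open>The degree is at most \<open>2 * (g - 1) + 2 = 2 * g\<close>, just below the
    number of branch points, so one factor \<open>z + \<i>\<close> is all that partial fractions
    leave room for.\<close>
  define q where "q = p ^ 2 * [:\<i>, 1:] ^ 2"
  have "degree q \<le> 2 * degree p + 2"
  proof -
    have "degree q \<le> degree (p ^ 2) + degree ([:\<i>, 1:] ^ 2)" unfolding q_def by (rule degree_mult_le)
    moreover have "degree (p ^ 2) \<le> degree p * 2" by (rule degree_power_le)
    moreover have "degree ([:\<i>, 1:] ^ 2) \<le> degree [:\<i>, 1:] * 2" by (rule degree_power_le)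
    moreover have "degree [:\<i>, 1:] = 1" by simp
    ultimately show ?thesis by linarith
  qed
  then have dq: "degree q < card A" using assms unfolding cA N_def by linarith
  define r where "r a = norm (poly q a / (\<Prod>b\<in>A - {a}. a - b))" for a
  define C where "C = (\<Sum>a\<in>A. sqrt (r a))"
  have r0: "r a \<ge> 0" for a by (simp add: r_def)
  have C: "sqrt (r a) \<le> C" if "a \<in> A" for a
    unfolding C_def using that r0 by (intro member_le_sum) (auto simp: A_def)
  show thesis
  proof (rule that[of C])
    show "C \<ge> 0" unfolding C_def using r0 by (intro sum_nonneg) simp
    fix x t :: real assume x: "x \<notin> E" and t: "0 \<le> t"
    define z where "z = Complex x t"
    have zA: "z \<notin> A" using x by (auto simp: A_def z_def complex_eq_iff E_def)
    have "(form p z * (z + \<i>)) ^ 2 = poly q z / sqrt_curve z ^ 2"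
      by (simp add: form_def q_def power_mult_distrib power_divide add.commute)
    also have "sqrt_curve z ^ 2 = (\<Prod>a\<in>A. z - a)"
      unfolding sqrt_curve_square A_def prod.reindex[OF inj] by (simp only: o_def)
    also have "poly q z / (\<Prod>a\<in>A. z - a) = (\<Sum>a\<in>A. poly q a / (\<Prod>b\<in>A - {a}. a - b) / (z - a))"
      by (rule lagrange_partial_fractions[OF _ dq zA]) (simp add: A_def)
    finally have eq: "(form p z * (z + \<i>)) ^ 2 = (\<Sum>a\<in>A. poly q a / (\<Prod>b\<in>A - {a}. a - b) / (z - a))" .
    have "(norm (form p z) * norm (z + \<i>)) ^ 2 = norm ((form p z * (z + \<i>)) ^ 2)"
      by (simp add: norm_mult norm_power)
    also have "\<dots> \<le> (\<Sum>a\<in>A. r a / norm (z - a))"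
      unfolding eq by (rule order_trans[OF norm_sum]) (simp add: r_def norm_divide norm_mult)
    also have "\<dots> = (\<Sum>a\<in>A. (sqrt (r a) / sqrt (norm (z - a))) ^ 2)"
      using r0 by (simp add: power_divide)
    also have "\<dots> \<le> (\<Sum>a\<in>A. sqrt (r a) / sqrt (norm (z - a))) ^ 2"
      by (rule sum_power2_le_power2_sum) (use r0 in simp)
    finally have "norm (form p z) * norm (z + \<i>) \<le> (\<Sum>a\<in>A. sqrt (r a) / sqrt (norm (z - a)))"
      by (rule power2_le_imp_le) (use r0 in \<open>auto intro!: sum_nonneg\<close>)
    also have "\<dots> = (\<Sum>j\<in>{1..N}. sqrt (r (complex_of_real (e j))) / sqrt (norm (z - complex_of_real (e j))))"
      unfolding A_def sum.reindex[OF inj] by (simp only: o_def)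
    also have "\<dots> \<le> (\<Sum>j\<in>{1..N}. C * (1 / sqrt \<bar>x - e j\<bar>))"
    proof (rule sum_mono)
      fix j assume j: "j \<in> {1..N}"
      have "sqrt (r (complex_of_real (e j))) \<le> C" unfolding A_def using j by (intro C[unfolded A_def] imageI)
      moreover have "\<bar>x - e j\<bar> \<le> norm (z - complex_of_real (e j))"
        using abs_Re_le_cmod[of "z - complex_of_real (e j)"] by (simp add: z_def)
      then have "1 / sqrt (norm (z - complex_of_real (e j))) \<le> 1 / sqrt \<bar>x - e j\<bar>"
        using notin_E[OF x j] by (intro divide_left_mono mult_pos_pos) auto
      ultimately have "sqrt (r (complex_of_real (e j))) * (1 / sqrt (norm (z - complex_of_real (e j)))) \<le> C * (1 / sqrt \<bar>x - e j\<bar>)"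
        using r0 by (intro mult_mono) (auto intro: order_trans[OF real_sqrt_ge_zero])
      then show "sqrt (r (complex_of_real (e j))) / sqrt (norm (z - complex_of_real (e j))) \<le> C * (1 / sqrt \<bar>x - e j\<bar>)"
        by simp
    qed
    also have "\<dots> = C * (\<Sum>j\<in>{1..N}. 1 / sqrt \<bar>x - e j\<bar>)" by (simp add: sum_distrib_left)
    finally show "norm (form p (Complex x t)) * norm (Complex x t + \<i>) \<le> C * (\<Sum>j\<in>{1..N}. 1 / sqrt \<bar>x - e j\<bar>)"
      by (simp add: z_def)
  qed
qed

lemma D_mono: "C \<le> C' \<Longrightarrow> D C x \<le> D C' x"
  unfolding D_def by (intro mult_right_mono sum_nonneg) auto

text \<open>All larger constants are allowed as well, so that two differentials can be placed under
  one common majorant.\<close>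

lemma form_half_plane_fun:
  assumes "degree p < g"
  obtains C where "C \<ge> 0" "\<And>C'. C \<le> C' \<Longrightarrow> half_plane_fun E (D C') (form p)"
proof -
  obtain C where C: "C \<ge> 0" and bound:
    "\<And>x t. x \<notin> E \<Longrightarrow> 0 \<le> t \<Longrightarrow> norm (form p (Complex x t)) * norm (Complex x t + \<i>) \<le> C * (\<Sum>j\<in>{1..N}. 1 / sqrt \<bar>x - e j\<bar>)"
    using form_bound[OF assms] by blast
  show thesis
  proof (rule that[OF C])
    fix C' assume C': "C \<le> C'"
    show "half_plane_fun E (D C') (form p)"
      unfolding half_plane_fun_def
    proof (intro conjI allI impI)
      show "form p holomorphic_on {z. 0 < Im z}"
        unfolding form_def[abs_def] by (intro holomorphic_intros sqrt_curve_holomorphic) (auto simp: sqrt_curve_nonzero)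
      fix x assume x: "x \<notin> E"
      define S where "S = C * (\<Sum>j\<in>{1..N}. 1 / sqrt \<bar>x - e j\<bar>)"
      show "norm (form p (Complex x t)) \<le> D C' x" if t: "0 \<le> t" for t
      proof -
        have pos: "0 < sqrt (1 + x\<^sup>2)" by (simp add: add_pos_nonneg)
        \<comment> \<open>In the closed half-plane the distance to \<open>- \<i>\<close> is at least
          \<open>sqrt (1 + x\<^sup>2)\<close>, uniformly in the height.\<close>
        have "1 \<le> (t + 1)\<^sup>2" using power_mono[of 1 "t + 1" 2] t by simp
        then have "sqrt (1 + x\<^sup>2) \<le> norm (Complex x t + \<i>)"
          by (simp add: cmod_def add.commute)
        then have "norm (form p (Complex x t)) * sqrt (1 + x\<^sup>2) \<le> S"
          using bound[OF x t] mult_left_mono[of "sqrt (1 + x\<^sup>2)" "norm (Complex x t + \<i>)" "norm (form p (Complex x t))"]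
          unfolding S_def by simp
        then have "norm (form p (Complex x t)) \<le> S / sqrt (1 + x\<^sup>2)"
          using pos by (simp add: pos_le_divide_eq)
        also have "\<dots> = D C x"
          by (simp add: S_def D_def sum_divide_distrib sum_distrib_left)
        also have "\<dots> \<le> D C' x" by (rule D_mono[OF C'])
        finally show ?thesis .
      qed
      have "isCont (form p) (Complex x 0)"
        unfolding form_def[abs_def] using x sqrt_curve_nonzero[of "Complex x 0"]
        by (intro continuous_intros isCont_sqrt_curve) auto
      moreover have "((\<lambda>t. Complex x t) \<longlongrightarrow> Complex x 0) (at_right 0)"
        unfolding Complex_eq by (auto intro!: tendsto_eq_intros)
      ultimately show "((\<lambda>t. form p (Complex x t)) \<longlongrightarrow> form p (Complex x 0)) (at_right 0)"
        by (rule isCont_tendsto_compose)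
      show "((\<lambda>t. form p (Complex x t)) \<longlongrightarrow> 0) at_top"
      proof (rule Lim_null_comparison)
        show "((\<lambda>t. S / t) \<longlongrightarrow> 0) at_top"
          by (intro tendsto_divide_0[OF tendsto_const] filterlim_at_top_imp_at_infinity filterlim_ident)
        show "\<forall>\<^sub>F t in at_top. norm (form p (Complex x t)) \<le> S / t"
          using eventually_gt_at_top[of 0]
        proof eventually_elim
          case (elim t)
          have "t \<le> norm (Complex x t + \<i>)" using abs_Im_le_cmod[of "Complex x t + \<i>"] elim by simp
          then have "norm (form p (Complex x t)) * t \<le> S"
            using bound[OF x, of t] mult_left_mono[of t "norm (Complex x t + \<i>)" "norm (form p (Complex x t))"] elim
            unfolding S_def by simp
          then show ?case using elim by (simp add: pos_le_divide_eq)
        qed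
      qed
    qed
  qed
qed

end

section \<open>Boundary values of the differentials and their periods over cuts and gaps\<close>

lemma Re_integral_eq_0:
  fixes f :: "real \<Rightarrow> complex"
  assumes "f integrable_on {a..b}" and "\<And>x. a < x \<Longrightarrow> x < b \<Longrightarrow> Re (f x) = 0"
  shows "Re (integral {a..b} f) = 0"
proof -
  have "Re (integral {a..b} f) = integral {a..b} (\<lambda>x. Re (f x))"
    using integral_linear[OF assms(1) bounded_linear_Re] by (simp add: o_def)
  also have "\<dots> = integral {a..b} (\<lambda>x. 0)"
    by (rule integral_spike[of "{a, b}"]) (use assms(2) in force)+
  finally show ?thesis by simp
qed

lemma Im_integral_eq_0:
  fixes f :: "real \<Rightarrow> complex"
  assumes "f integrable_on {a..b}" and "\<And>x. a < x \<Longrightarrow> x < b \<Longrightarrow> Im (f x) = 0"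
  shows "Im (integral {a..b} f) = 0"
  using Re_integral_eq_0[of "\<lambda>x. \<i> * f x" a b] assms by (simp add: integrable_on_mult_right)

context real_branch_points
begin

text \<open>Seen from the upper half-plane, a branch point to the right of \<open>x\<close>
  contributes a factor \<open>\<i>\<close> and one to the left a positive factor, so only the parity
  of the number on the right decides between real and imaginary.\<close>

lemma sqrt_curve_real:
  assumes x: "x \<notin> E"
  shows "sqrt_curve (Complex x 0) = \<i> ^ card {j \<in> {1..N}. x < e j} * complex_of_real (\<Prod>j\<in>{1..N}. sqrt \<bar>x - e j\<bar>)"
proof -
  have "sqrt_curve (Complex x 0) = (\<Prod>j\<in>{1..N}. (if x < e j then \<i> else 1) * complex_of_real (sqrt \<bar>x - e j\<bar>))"
    unfolding sqrt_curve_def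
  proof (rule prod.cong[OF refl])
    fix j assume j: "j \<in> {1..N}"
    have eq: "Complex x 0 - complex_of_real (e j) = complex_of_real (x - e j)" by (simp add: complex_eq_iff)
    show "up_sqrt (Complex x 0 - complex_of_real (e j)) = (if x < e j then \<i> else 1) * complex_of_real (sqrt \<bar>x - e j\<bar>)"
    proof (cases "x < e j")
      case True
      then show ?thesis unfolding eq by (subst up_sqrt_real_neg) auto
    next
      case False
      then have "0 < x - e j" using notin_E[OF x j] by simp
      then show ?thesis unfolding eq using False by (subst up_sqrt_real_pos) auto
    qed
  qed
  also have "\<dots> = (\<Prod>j\<in>{1..N}. if x < e j then \<i> else 1) * complex_of_real (\<Prod>j\<in>{1..N}. sqrt \<bar>x - e j\<bar>)"
    by (simp add: prod.distrib)
  also have "(\<Prod>j\<in>{1..N}. if x < e j then \<i> else 1) = \<i> ^ card {j \<in> {1..N}. x < e j}"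
    by (subst prod.inter_filter[symmetric]) simp_all
  finally show ?thesis .
qed

definition real_on_line :: "complex poly \<Rightarrow> bool" where
  "real_on_line p \<longleftrightarrow> (\<forall>x. Im (poly p (complex_of_real x)) = 0)"

lemma form_real:
  assumes p: "real_on_line p" and x: "x \<notin> E"
  shows "even (card {j \<in> {1..N}. x < e j}) \<Longrightarrow> Im (form p (Complex x 0)) = 0"
    and "odd (card {j \<in> {1..N}. x < e j}) \<Longrightarrow> Re (form p (Complex x 0)) = 0"
proof -
  define m where "m = card {j \<in> {1..N}. x < e j}"
  define s where "s = Re (poly p (complex_of_real x)) / (\<Prod>j\<in>{1..N}. sqrt \<bar>x - e j\<bar>)"
  have "poly p (Complex x 0) = complex_of_real (Re (poly p (complex_of_real x)))"
    using p by (simp add: real_on_line_def complex_eq_iff complex_of_real_def)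
  then have f: "form p (Complex x 0) = complex_of_real s / \<i> ^ m"
    by (simp add: form_def sqrt_curve_real[OF x] s_def m_def)
  show "Im (form p (Complex x 0)) = 0" if "even (card {j \<in> {1..N}. x < e j})"
  proof -
    obtain k where "m = 2 * k" using \<open>even (card _)\<close> unfolding m_def[symmetric] by (rule evenE)
    then have "\<i> ^ m = complex_of_real ((-1) ^ k)" by (simp add: power_mult)
    then show ?thesis unfolding f by (simp flip: of_real_divide del: of_real_power)
  qed
  show "Re (form p (Complex x 0)) = 0" if "odd (card {j \<in> {1..N}. x < e j})"
  proof -
    obtain k where "m = 2 * k + 1" using \<open>odd (card _)\<close> unfolding m_def[symmetric] by (rule oddE)
    then have "\<i> ^ m = \<i> * complex_of_real ((-1) ^ k)" by (simp add: power_mult)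
    moreover have "form p (Complex x 0) * \<i> ^ m = complex_of_real s" unfolding f by simp
    ultimately have "Im (form p (Complex x 0) * (\<i> * complex_of_real ((-1) ^ k))) = 0"
      by (metis Im_complex_of_real)
    then show ?thesis by (simp del: of_real_power)
  qed
qed

lemma card_branch_points_above:
  assumes "m \<in> {1..<N}" "e m < x" "x < e (m + 1)"
  shows "card {j \<in> {1..N}. x < e j} = N - m"
proof -
  have "x < e j \<longleftrightarrow> m < j" if "j \<in> {1..N}" for j
  proof
    assume "m < j"
    then have "e (m + 1) \<le> e j" using assms(1) that by (intro e_le) auto
    then show "x < e j" using assms by linarith
  next
    assume "x < e j"
    then have "\<not> e j \<le> e m" using assms by linarith
    then show "m < j" using e_le[of j m] assms(1) that by force
  qed
  then have "{j \<in> {1..N}. x < e j} = {m<..N}" by auto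
  then show ?thesis by simp
qed

lemma gap_notin_E:
  assumes "m \<in> {1..<N}" "e m < x" "x < e (m + 1)"
  shows "x \<notin> E"
proof
  assume "x \<in> E"
  then obtain j where j: "j \<in> {1..N}" "x = e j" by (auto simp: E_def)
  then show False using e_le[of j m] e_le[of "m + 1" j] assms by (cases "j \<le> m") auto
qed

lemma branch_points_interval:
  assumes "x \<notin> E"
  obtains "x < e 1" | "e N < x" | m where "m \<in> {1..<N}" "e m < x" "x < e (m + 1)"
proof (cases "x < e 1 \<or> e N < x")
  case False
  define M where "M = {j \<in> {1..N}. e j \<le> x}"
  define m where "m = Max M"
  have N: "1 \<le> N" by (simp add: N_def)
  have M: "finite M" "1 \<in> M" using False N by (auto simp: M_def)
  then have "m \<in> M" unfolding m_def by (intro Max_in) auto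
  then have m: "m \<in> {1..N}" "e m \<le> x" by (auto simp: M_def)
  have max: "j \<le> m" if "j \<in> {1..N}" "e j \<le> x" for j
    unfolding m_def using that by (intro Max_ge M) (simp add: M_def)
  have "e N \<noteq> x" using notin_E[OF assms, of N] N by auto
  then have "m \<noteq> N" using m False by auto
  then have mN: "m \<in> {1..<N}" using m by auto
  moreover have "e m < x" using m notin_E[OF assms, of m] by force
  moreover have "x < e (m + 1)" using max[of "m + 1"] mN by force
  ultimately show thesis by (rule that(3))
qed (use that in blast)

lemma form_real_on_cut:
  assumes "real_on_line p" "k \<in> {1..g}" "e (2 * k - 1) < x" "x < e (2 * k)"
  shows "Im (form p (Complex x 0)) = 0"
proof -
  have k: "2 * k - 1 \<in> {1..<N}" "2 * k - 1 + 1 = 2 * k" using assms(2) by (auto simp: N_def)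
  have "N - (2 * k - 1) = 2 * (g + 1 - k)" using assms(2) by (simp add: N_def)
  then show ?thesis
    using form_real(1)[OF assms(1) gap_notin_E, of "2 * k - 1" x] card_branch_points_above[of "2 * k - 1" x] assms k by simp
qed

lemma form_imaginary_on_gap:
  assumes "real_on_line p" "k \<in> {1..g}" "e (2 * k) < x" "x < e (2 * k + 1)"
  shows "Re (form p (Complex x 0)) = 0"
proof -
  have k: "2 * k \<in> {1..<N}" using assms(2) by (auto simp: N_def)
  have "N - 2 * k = 2 * (g - k) + 1" using assms(2) unfolding N_def atLeastAtMost_iff by arith
  then show ?thesis
    using form_real(2)[OF assms(1) gap_notin_E, of "2 * k" x] card_branch_points_above[of "2 * k" x] assms k by simp
qed

lemma form_imaginary_left:
  assumes "real_on_line p" "x < e 1"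
  shows "Re (form p (Complex x 0)) = 0"
proof -
  have "x < e j" if "j \<in> {1..N}" for j using e_le[of 1 j] assms(2) that by force
  then have all: "{j \<in> {1..N}. x < e j} = {1..N}" and nE: "x \<notin> E"
    by (blast, metis E_def imageE less_irrefl)
  show ?thesis using form_real(2)[OF assms(1) nE] unfolding all by (simp add: N_def)
qed

lemma form_real_right:
  assumes "real_on_line p" "e N < x"
  shows "Im (form p (Complex x 0)) = 0"
proof -
  have "e j < x" if "j \<in> {1..N}" for j using e_le[of j N] assms(2) that by force
  then have none: "{j \<in> {1..N}. x < e j} = {}" and nE: "x \<notin> E"
    by (force, metis E_def imageE less_irrefl)
  show ?thesis using form_real(1)[OF assms(1) nE] unfolding none by simp
qed

text \<open>Carries neither the 2 of the contour integrals nor the \<open>- 2\<close> of the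
  differentials, as these cancel up to sign.\<close>

definition interval_period :: "complex poly \<Rightarrow> nat \<Rightarrow> complex" where
  "interval_period p m = integral {e m..e (m + 1)} (\<lambda>x. form p (Complex x 0))"

definition a_period :: "complex poly \<Rightarrow> nat \<Rightarrow> real" where
  "a_period p k = Re (interval_period p (2 * k - 1))"

definition b_period :: "complex poly \<Rightarrow> nat \<Rightarrow> real" where
  "b_period p k = (\<Sum>i=k..g. Im (interval_period p (2 * i)))"

lemma form_integrable_on:
  assumes "degree p < g"
  shows "(\<lambda>x. form p (Complex x 0)) integrable_on {a..b}"
proof -
  obtain C where C: "C \<ge> 0" "half_plane_fun E (D C) (form p)"
    using form_half_plane_fun[OF assms] by (metis order_refl)
  interpret majorant E "D C" by (rule majorant_D[OF C(1)])
  show ?thesis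
    using set_borel_integral_eq_integral(1)[OF line_set_integrable[OF C(2)], of 0 "{a..b}"] by simp
qed

lemma interval_period_cut:
  assumes "degree p < g" "real_on_line p" "k \<in> {1..g}"
  shows "interval_period p (2 * k - 1) = complex_of_real (a_period p k)"
proof -
  have k: "2 * k - 1 + 1 = 2 * k" using assms(3) by auto
  have "Im (interval_period p (2 * k - 1)) = 0"
    unfolding interval_period_def k
    by (rule Im_integral_eq_0[OF form_integrable_on[OF assms(1)] form_real_on_cut[OF assms(2,3)]])
  then show ?thesis by (simp add: complex_eq_iff a_period_def)
qed

lemma interval_period_gap:
  assumes "degree p < g" "real_on_line p" "k \<in> {1..g}"
  shows "interval_period p (2 * k) = \<i> * complex_of_real (Im (interval_period p (2 * k)))"
proof -
  have "Re (interval_period p (2 * k)) = 0"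
    unfolding interval_period_def
    by (rule Re_integral_eq_0[OF form_integrable_on[OF assms(1)] form_imaginary_on_gap[OF assms(2,3)]])
  then show ?thesis by (simp add: complex_eq_iff)
qed

text \<open>\<open>Re (form p)\<close> vanishes on the gaps and left of \<open>e 1\<close>, whereas
  \<open>V\<close> is constant on each cut and zero right of \<open>e N\<close>. Each cut therefore
  contributes its a-period times the constant value of \<open>V\<close> there.\<close>

lemma period_form_eval:
  assumes p: "degree p < g" "real_on_line p" and q: "degree q < g" "real_on_line q"
    and C: "C \<ge> 0" and hp: "half_plane_fun E (D C) (form p)" "half_plane_fun E (D C) (form q)"
  shows "- (LINT x|lborel. Re (form p (Complex x 0)) * Im (line_primitive (form q) 0 x))
    = (\<Sum>k=1..g. a_period p k * b_period q k)"
proof -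
  interpret majorant E "D C" by (rule majorant_D[OF C])
  define V where "V x = Im (line_primitive (form q) 0 x)" for x
  have V_diff: "V b - V a = Im (integral {a..b} (\<lambda>x. form q (Complex x 0)))" if "a \<le> b" for a b
    using arg_cong[OF line_primitive_diff[OF hp(2) _ that, of 0], of Im] by (simp add: V_def)
  have V_cut: "V x = V (e (2 * k - 1))" if "k \<in> {1..g}" "e (2 * k - 1) \<le> x" "x \<le> e (2 * k)" for k x
  proof -
    have "Im (integral {e (2 * k - 1)..x} (\<lambda>x. form q (Complex x 0))) = 0"
      by (rule Im_integral_eq_0[OF form_integrable_on[OF q(1)]])
         (use that in \<open>auto intro!: form_real_on_cut[OF q(2) that(1)]\<close>)
    then show ?thesis using V_diff[OF that(2)] by simp
  qed
  \<comment> \<open>\<open>V\<close> is normalised at minus infinity; the vanishing total integral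
    makes it zero at plus infinity too, which is why the b-periods collect the gaps to the right of
    a cut.\<close>
  have V_right: "V x = 0" if x: "e N \<le> x" for x
  proof -
    have c: "V y = V (e N)" if "e N \<le> y" for y
    proof -
      have "Im (integral {e N..y} (\<lambda>x. form q (Complex x 0))) = 0"
        by (rule Im_integral_eq_0[OF form_integrable_on[OF q(1)]])
           (use that in \<open>auto intro!: form_real_right[OF q(2)]\<close>)
      then show ?thesis using V_diff[OF that] by simp
    qed
    have "(V \<longlongrightarrow> Im (line_integral (form q) 0)) at_top"
      unfolding V_def by (intro tendsto_Im line_primitive_tendsto_top[OF hp(2)]) simp
    then have "(V \<longlongrightarrow> 0) at_top" by (simp add: line_integral_eq_0[OF hp(2)])
    moreover have "(V \<longlongrightarrow> V (e N)) at_top"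
      by (rule tendsto_eventually) (use eventually_ge_at_top[of "e N"] in eventually_elim, rule c)
    ultimately have "V (e N) = 0" using tendsto_unique trivial_limit_at_top_linorder by blast
    then show ?thesis using c[OF x] by simp
  qed
  \<comment> \<open>Between the left ends of neighbouring cuts \<open>V\<close> changes only over
    the gap, so the sum defining \<open>b_period\<close> telescopes; for \<open>i = g\<close> the
    right end is \<open>e N\<close>.\<close>
  have gap: "Im (interval_period q (2 * i)) = V (e (2 * Suc i - 1)) - V (e (2 * i - 1))" if i: "i \<in> {1..g}" for i
  proof -
    have "e (2 * i) \<le> e (2 * i + 1)" using i by (intro e_le) (auto simp: N_def)
    moreover have "V (e (2 * i)) = V (e (2 * i - 1))"
      using i by (intro V_cut e_le) (auto simp: N_def)
    ultimately show ?thesis using V_diff[of "e (2 * i)" "e (2 * i + 1)"] by (simp add: interval_period_def)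
  qed
  have V_b: "V (e (2 * k - 1)) = - b_period q k" if k: "k \<in> {1..g}" for k
  proof -
    have "b_period q k = (\<Sum>i=k..g. V (e (2 * Suc i - 1)) - V (e (2 * i - 1)))"
      unfolding b_period_def using k by (intro sum.cong refl gap) auto
    also have "\<dots> = V (e (2 * Suc g - 1)) - V (e (2 * k - 1))"
      using k by (intro sum_Suc_diff[of k g "\<lambda>i. V (e (2 * i - 1))"]) auto
    also have "V (e (2 * Suc g - 1)) = 0" using V_right[of "e N"] by (simp add: N_def)
    finally show ?thesis by simp
  qed
  define h where "h k x = indicator {e (2 * k - 1)..e (2 * k)} x * (Re (form p (Complex x 0)) * V (e (2 * k - 1)))" for k x
  have split: "Re (form p (Complex x 0)) * V x = (\<Sum>k=1..g. h k x)" if x: "x \<notin> E" for x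
  proof (cases "Re (form p (Complex x 0)) = 0")
    case True
    then show ?thesis by (simp add: h_def)
  next
    case False
    show ?thesis
    proof (rule branch_points_interval[OF x])
      assume "x < e 1"
      then show ?thesis using form_imaginary_left[OF p(2)] False by blast
    next
      assume r: "e N < x"
      have "h k x = 0" if "k \<in> {1..g}" for k
      proof -
        have "e (2 * k) \<le> e N" using that by (intro e_le) (auto simp: N_def)
        then show ?thesis using r by (simp add: h_def)
      qed
      then show ?thesis using V_right[of x] r by simp
    next
      fix m assume m: "m \<in> {1..<N}" "e m < x" "x < e (m + 1)"
      \<comment> \<open>Intervals with even number are gaps, where the real part would be
        zero.\<close>
      have "odd m"
      proof
        assume "even m"
        then obtain k where k: "m = 2 * k" by (rule evenE)
        then have "k \<in> {1..g}" using m(1) by (auto simp: N_def)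
        then show False using form_imaginary_on_gap[OF p(2), of k x] m k False by simp
      qed
      then obtain k' where k': "m = 2 * k' + 1" by (rule oddE)
      define k where "k = k' + 1"
      have k: "k \<in> {1..g}" "m = 2 * k - 1" "m + 1 = 2 * k" using m(1) k' by (auto simp: k_def N_def)
      have "(\<Sum>j=1..g. h j x) = (\<Sum>j=1..g. if j = k then h k x else 0)"
      proof (rule sum.cong[OF refl])
        fix j assume j: "j \<in> {1..g}"
        have "h j x = 0" if "j \<noteq> k"
        proof -
          have "x \<notin> {e (2 * j - 1)..e (2 * j)}"
          proof (cases "j < k")
            case True
            then have "e (2 * j) \<le> e m" using j k by (intro e_le) (auto simp: N_def)
            then show ?thesis using m by simp
          next
            case False
            then have "e (m + 1) \<le> e (2 * j - 1)" using j k that by (intro e_le) (auto simp: N_def)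
            then show ?thesis using m by simp
          qed
          then show ?thesis by (simp add: h_def)
        qed
        then show "h j x = (if j = k then h k x else 0)" by simp
      qed
      also have "\<dots> = h k x" using k by simp
      also have "\<dots> = Re (form p (Complex x 0)) * V x"
        using V_cut[OF k(1), of x] m k by (simp add: h_def)
      finally show ?thesis by simp
    qed
  qed
  have int: "integrable lborel (\<lambda>x. Re (form p (Complex x 0)))"
    using hp_line_integrable[OF hp(1), of 0] by (intro integrable_Re) simp
  have h_eq: "h k = (\<lambda>x. (indicator {e (2 * k - 1)..e (2 * k)} x *\<^sub>R Re (form p (Complex x 0))) * V (e (2 * k - 1)))" for k
    by (auto simp: h_def fun_eq_iff)
  have inth: "integrable lborel (h k)" for k
    unfolding h_eq by (intro integrable_mult_left integrable_mult_indicator int) auto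
  have Ih: "integral\<^sup>L lborel (h k) = - (a_period p k * b_period q k)" if k: "k \<in> {1..g}" for k
  proof -
    have s: "set_integrable lborel {e (2 * k - 1)..e (2 * k)} (\<lambda>x. Re (form p (Complex x 0)))"
      unfolding set_integrable_def by (intro integrable_mult_indicator int) auto
    have kk: "2 * k - 1 + 1 = 2 * k" using k by auto
    have "integral\<^sup>L lborel (h k) = integral {e (2 * k - 1)..e (2 * k)} (\<lambda>x. Re (form p (Complex x 0))) * V (e (2 * k - 1))"
      unfolding h_eq using set_borel_integral_eq_integral(2)[OF s] by (simp add: set_lebesgue_integral_def)
    also have "integral {e (2 * k - 1)..e (2 * k)} (\<lambda>x. Re (form p (Complex x 0))) = a_period p k"
      using integral_linear[OF form_integrable_on[OF p(1)] bounded_linear_Re, of "e (2 * k - 1)" "e (2 * k)"]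
      unfolding a_period_def interval_period_def kk by (simp add: o_def)
    finally show ?thesis using V_b[OF k] by simp
  qed
  have "(LINT x|lborel. Re (form p (Complex x 0)) * V x) = (LINT x|lborel. (\<Sum>k=1..g. h k x))"
  proof (rule integral_cong_AE)
    show "(\<lambda>x. Re (form p (Complex x 0)) * V x) \<in> borel_measurable lborel"
      unfolding V_def using borel_measurable_integrable[OF int] line_primitive_measurable[OF hp(2), of 0]
      by (intro borel_measurable_times borel_measurable_Im) auto
    show "(\<lambda>x. \<Sum>k=1..g. h k x) \<in> borel_measurable lborel"
      by (intro borel_measurable_sum borel_measurable_integrable inth)
    show "AE x in lborel. Re (form p (Complex x 0)) * V x = (\<Sum>k=1..g. h k x)"
      using null_E by eventually_elim (rule split)
  qed
  also have "\<dots> = (\<Sum>k=1..g. integral\<^sup>L lborel (h k))" by (rule Bochner_Integration.integral_sum) (rule inth)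
  also have "\<dots> = (\<Sum>k=1..g. - (a_period p k * b_period q k))" by (intro sum.cong refl Ih)
  finally show ?thesis by (simp add: sum_negf V_def)
qed

theorem period_form_symmetric:
  assumes "degree p < g" "real_on_line p" "degree q < g" "real_on_line q"
  shows "(\<Sum>k=1..g. a_period p k * b_period q k) = (\<Sum>k=1..g. a_period q k * b_period p k)"
proof -
  obtain C1 where C1: "C1 \<ge> 0" "\<And>C'. C1 \<le> C' \<Longrightarrow> half_plane_fun E (D C') (form p)"
    using form_half_plane_fun[OF assms(1)] by blast
  obtain C2 where C2: "C2 \<ge> 0" "\<And>C'. C2 \<le> C' \<Longrightarrow> half_plane_fun E (D C') (form q)"
    using form_half_plane_fun[OF assms(3)] by blast
  define C where "C = max C1 C2"
  have C: "C \<ge> 0" "half_plane_fun E (D C) (form p)" "half_plane_fun E (D C) (form q)"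
    using C1 C2 by (auto simp: C_def)
  interpret majorant E "D C" by (rule majorant_D[OF C(1)])
  show ?thesis
    using period_form_commute[OF C(2,3)] period_form_eval[OF assms C(1) C(2,3)]
      period_form_eval[OF assms(3,4,1,2) C(1) C(3,2)] by (simp add: period_form_def)
qed

theorem period_form_pos:
  assumes "degree p < g" "real_on_line p" "p \<noteq> 0"
  shows "0 < (\<Sum>k=1..g. a_period p k * b_period p k)"
proof -
  obtain C where C: "C \<ge> 0" "half_plane_fun E (D C) (form p)"
    using form_half_plane_fun[OF assms(1)] by (metis order_refl)
  interpret majorant E "D C" by (rule majorant_D[OF C(1)])
  \<comment> \<open>A nonzero polynomial has only finitely many roots, so some point of the
    half-plane is not among them.\<close>
  have "infinite {z. Im z > 0}"
  proof -
    have "\<i> \<in> {z. Im z > 0}" by simp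
    then show ?thesis using open_upper_half_plane finite_imp_not_open by blast
  qed
  then obtain z where z: "Im z > 0" "poly p z \<noteq> 0"
    using poly_roots_finite[OF assms(3)] finite_subset[of "{z. Im z > 0}" "{z. poly p z = 0}"] by blast
  then have "form p z \<noteq> 0" by (simp add: form_def sqrt_curve_nonzero)
  then show ?thesis
    using period_form_positive[OF C(2) z(1)] period_form_eval[OF assms(1,2,1,2) C(1) C(2,2)] by (simp add: period_form_def)
qed

end

subsection \<open>The period matrices\<close>

definition cmat :: "real^'n^'m \<Rightarrow> complex^'n^'m" where
  "cmat M = (\<chi> i j. complex_of_real (M $ i $ j))"

lemma cmat_mult: "cmat (M ** L) = cmat M ** cmat L"
  by (simp add: cmat_def matrix_matrix_mult_def vec_eq_iff)

lemma cmat_mat_1: "cmat (mat 1) = mat 1"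
  by (simp add: cmat_def mat_def vec_eq_iff)

lemma cmat_mult_cvec_of_real: "cmat M *v cvec_of_real x = cvec_of_real (M *v x)"
  by (simp add: cmat_def cvec_of_real_def matrix_vector_mult_def vec_eq_iff)

lemma matrix_inv_eq:
  fixes A B :: "'a::{field}^'n^'n"
  assumes "A ** B = mat 1" "B ** A = mat 1"
  shows "matrix_inv A = B"
proof -
  have "A ** matrix_inv A = mat 1 \<and> matrix_inv A ** A = mat 1"
    unfolding matrix_inv_def by (rule someI[of _ B]) (use assms in simp)
  then show ?thesis by (metis assms(2) matrix_mul_assoc matrix_mul_lid matrix_mul_rid)
qed

lemma matrix_inv_inverse:
  fixes A :: "real^'n^'n"
  assumes "invertible A"
  shows "A ** matrix_inv A = mat 1" "matrix_inv A ** A = mat 1"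
  using assms unfolding invertible_def matrix_inv_def by (metis (mono_tags, lifting) someI_ex)+

lemma posdef_imp_invertible:
  fixes M :: "real^'n^'n"
  assumes "\<And>v. v \<noteq> 0 \<Longrightarrow> 0 < v \<bullet> (M *v v)"
  shows "invertible M"
proof -
  have "inj ((*v) M)"
  proof (rule injI)
    fix v w assume "M *v v = M *v w"
    then have "(v - w) \<bullet> (M *v (v - w)) = 0" by (simp add: matrix_vector_mult_diff_distrib)
    then show "v = w" using assms[of "v - w"] by force
  qed
  then show ?thesis using matrix_left_invertible_injective[of M] invertible_left_inverse[of M] by blast
qed

text \<open>With \<open>M = A ** transpose B\<close> symmetric, \<open>matrix_inv A ** B\<close> is
  the congruence transform of \<open>M\<close> by \<open>matrix_inv A\<close>. Invertibility of both
  factors follows from that of \<open>M\<close>.\<close>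

lemma bilinear_relations_matrix:
  fixes A B :: "real^'n^'n"
  assumes sym: "transpose (A ** transpose B) = A ** transpose B"
    and pos: "\<And>v. v \<noteq> 0 \<Longrightarrow> 0 < v \<bullet> ((A ** transpose B) *v v)"
  shows "invertible A" "invertible B"
    and "transpose (matrix_inv A ** B) = matrix_inv A ** B"
    and "v \<noteq> 0 \<Longrightarrow> 0 < v \<bullet> ((matrix_inv A ** B) *v v)"
proof -
  define M where "M = A ** transpose B"
  have M': "M = B ** transpose A" using sym by (simp add: M_def matrix_transpose_mul)
  have "invertible M" unfolding M_def by (rule posdef_imp_invertible[OF pos])
  then obtain L where L: "M ** L = mat 1" unfolding invertible_def by blast
  have "A ** (transpose B ** L) = mat 1" using L by (simp add: M_def matrix_mul_assoc)
  then show A: "invertible A" using invertible_right_inverse by blast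
  have "B ** (transpose A ** L) = mat 1" using L by (simp add: M' matrix_mul_assoc)
  then show "invertible B" using invertible_right_inverse by blast
  define I where "I = matrix_inv A"
  have I: "A ** I = mat 1" "I ** A = mat 1" unfolding I_def by (rule matrix_inv_inverse[OF A])+
  have tI: "transpose A ** transpose I = mat 1" using I(2) by (metis matrix_transpose_mul transpose_mat)
  have "M ** transpose I = B ** (transpose A ** transpose I)" by (simp add: M' matrix_mul_assoc)
  then have T: "I ** B = I ** M ** transpose I" using tI by (simp add: matrix_mul_assoc[symmetric])
  have "transpose (I ** B) = I ** B"
    unfolding T using sym by (simp add: matrix_transpose_mul matrix_mul_assoc M_def[symmetric])
  then show "transpose (matrix_inv A ** B) = matrix_inv A ** B" by (simp add: I_def)
  assume v: "v \<noteq> 0"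
  have "transpose A *v (transpose I *v v) = v"
    by (simp only: matrix_vector_mul_assoc tI matrix_vector_mul_lid)
  then have "transpose I *v v \<noteq> 0" using v by (metis matrix_vector_mult_0_right)
  then have "0 < (transpose I *v v) \<bullet> (M *v (transpose I *v v))" unfolding M_def by (rule pos)
  also have "\<dots> = v \<bullet> ((I ** B) *v v)"
    unfolding T by (simp add: matrix_vector_mul_assoc[symmetric] dot_lmul_matrix[symmetric])
  finally show "0 < v \<bullet> ((matrix_inv A ** B) *v v)" by (simp add: I_def)
qed

text \<open>The numerator \<open>x ^ (g - n)\<close> of the holomorphic differential with index
  \<open>n = ix n\<close>, at the row position it has in \<open>omega\<close>.\<close>

definition basis_poly :: "'g::{finite,linorder} \<Rightarrow> complex poly" where
  "basis_poly n = monom 1 (CARD('g) - ix n)"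

definition real_poly :: "(real, 'g::{finite,linorder}) vec \<Rightarrow> complex poly" where
  "real_poly v = (\<Sum>n\<in>UNIV. smult (complex_of_real (v $ n)) (basis_poly n))"

lemma ix_bounds: "ix (n::'g::{finite,linorder}) \<in> {1..CARD('g)}"
  using bij_betw_ix[where 'g = 'g] by (auto simp: bij_betw_def)

lemma ix_eq_iff: "ix (m::'g::{finite,linorder}) = ix n \<longleftrightarrow> m = n"
  using bij_betw_ix[where 'g = 'g] by (auto simp: bij_betw_def inj_on_def)

lemma degree_basis_poly: "degree (basis_poly (n::'g::{finite,linorder})) < CARD('g)"
  using ix_bounds[of n] by (auto simp: basis_poly_def degree_monom_eq)

lemma degree_real_poly: "degree (real_poly (v::(real, 'g::{finite,linorder}) vec)) < CARD('g)"
proof -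
  have "degree (real_poly v) \<le> CARD('g) - 1"
    unfolding real_poly_def
  proof (intro degree_sum_le)
    show "degree (smult (complex_of_real (v $ n)) (basis_poly n)) \<le> CARD('g) - 1" for n
      using order_trans[OF degree_smult_le, of "basis_poly n"] degree_basis_poly[of n] by fastforce
  qed simp
  then show ?thesis using zero_less_card_finite[where 'a = 'g] by linarith
qed

lemma real_poly_nonzero:
  fixes v :: "(real, 'g::{finite,linorder}) vec"
  assumes "v \<noteq> 0" shows "real_poly v \<noteq> 0"
proof
  assume z: "real_poly v = 0"
  obtain k where k: "v $ k \<noteq> 0" using assms by (auto simp: vec_eq_iff)
  have "coeff (real_poly v) (CARD('g) - ix k) = (\<Sum>n\<in>UNIV. if n = k then complex_of_real (v $ k) else 0)"
    unfolding real_poly_def coeff_sum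
  proof (intro sum.cong refl)
    fix n :: 'g
    have "CARD('g) - ix n = CARD('g) - ix k \<longleftrightarrow> n = k"
      using ix_bounds[of n] ix_bounds[of k] ix_eq_iff[of n k] by auto
    then show "coeff (smult (complex_of_real (v $ n)) (basis_poly n)) (CARD('g) - ix k) = (if n = k then complex_of_real (v $ k) else 0)"
      by (auto simp: basis_poly_def)
  qed
  then show False using z k by simp
qed

definition a_matrix :: "(nat \<Rightarrow> real) \<Rightarrow> ((real, 'g::{finite,linorder}) vec, 'g) vec" where
  "a_matrix e = (\<chi> n k. real_branch_points.a_period CARD('g) e (basis_poly n) (ix k))"

definition b_matrix :: "(nat \<Rightarrow> real) \<Rightarrow> ((real, 'g::{finite,linorder}) vec, 'g) vec" where
  "b_matrix e = (\<chi> n k. real_branch_points.b_period CARD('g) e (basis_poly n) (ix k))"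

text \<open>Periods are linear in the numerator, so the quadratic form at \<open>v\<close> is the
  sum of a-periods times b-periods of the single differential with numerator
  \<open>real_poly v\<close>.\<close>

lemma a_b_matrix_relations:
  fixes e :: "nat \<Rightarrow> real"
  assumes "real_branch_points CARD('g::{finite,linorder}) e"
  defines "A \<equiv> a_matrix e :: ((real, 'g) vec, 'g) vec" and "B \<equiv> b_matrix e :: ((real, 'g) vec, 'g) vec"
  shows "transpose (A ** transpose B) = A ** transpose B"
    and "v \<noteq> 0 \<Longrightarrow> 0 < v \<bullet> ((A ** transpose B) *v v)"
proof -
  interpret real_branch_points "CARD('g)" e by fact
  have real: "real_on_line (basis_poly n)" for n :: 'g
    by (simp add: real_on_line_def basis_poly_def poly_monom flip: of_real_power)
  have real': "real_on_line (real_poly v)" for v :: "(real, 'g) vec"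
    using real by (auto simp: real_on_line_def real_poly_def poly_sum)
  have reindex: "(\<Sum>k=1..CARD('g). f k) = (\<Sum>k\<in>(UNIV::'g set). f (ix k))" for f :: "nat \<Rightarrow> real"
    by (rule sum.reindex_bij_betw[OF bij_betw_ix, symmetric])
  have entry: "(A ** transpose B) $ m $ n = (\<Sum>k=1..CARD('g). a_period (basis_poly m) k * b_period (basis_poly n) k)" for m n
    by (simp only: reindex) (simp add: A_def B_def a_matrix_def b_matrix_def matrix_matrix_mult_def transpose_def)
  show "transpose (A ** transpose B) = A ** transpose B"
  proof -
    have "(A ** transpose B) $ n $ m = (A ** transpose B) $ m $ n" for m n
      unfolding entry by (rule period_form_symmetric[OF degree_basis_poly real degree_basis_poly real])
    then show ?thesis by (simp add: vec_eq_iff transpose_def)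
  qed
  have interval: "interval_period (real_poly v) m = (\<Sum>n\<in>UNIV. complex_of_real (v $ n) * interval_period (basis_poly n) m)"
    for v :: "(real, 'g) vec" and m
  proof -
    have "form (real_poly v) z = (\<Sum>n\<in>UNIV. complex_of_real (v $ n) * form (basis_poly n) z)" for z
      by (simp add: form_def real_poly_def poly_sum sum_divide_distrib)
    then show ?thesis
      unfolding interval_period_def
      by (simp add: integral_sum integrable_on_mult_right form_integrable_on[OF degree_basis_poly])
  qed
  have a: "a_period (real_poly v) (ix k) = (transpose A *v v) $ k" for v k
    by (simp add: a_period_def interval A_def a_matrix_def matrix_vector_mult_def transpose_def mult.commute)
  have b: "b_period (real_poly v) (ix k) = (transpose B *v v) $ k" for v k
  proof -
    have "b_period (real_poly v) (ix k) = (\<Sum>i=ix k..CARD('g). \<Sum>n\<in>UNIV. v $ n * Im (interval_period (basis_poly n) (2 * i)))"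
      by (simp add: b_period_def interval)
    also have "\<dots> = (\<Sum>n\<in>UNIV. \<Sum>i=ix k..CARD('g). v $ n * Im (interval_period (basis_poly n) (2 * i)))"
      by (rule sum.swap)
    also have "\<dots> = (transpose B *v v) $ k"
      by (simp add: B_def b_matrix_def b_period_def matrix_vector_mult_def transpose_def sum_distrib_left mult.commute)
    finally show ?thesis .
  qed
  assume v: "v \<noteq> 0"
  have "0 < (\<Sum>k=1..CARD('g). a_period (real_poly v) k * b_period (real_poly v) k)"
    by (rule period_form_pos[OF degree_real_poly real' real_poly_nonzero[OF v]])
  also have "\<dots> = (transpose A *v v) \<bullet> (transpose B *v v)"
    by (simp only: reindex a b inner_vec_def inner_real_def)
  also have "\<dots> = v \<bullet> (A *v (transpose B *v v))"
    by (simp add: dot_lmul_matrix[symmetric])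
  finally show "0 < v \<bullet> ((A ** transpose B) *v v)" by (simp only: matrix_vector_mul_assoc)
qed

section \<open>From the given branch of the root to the period matrices\<close>

text \<open>Both sides are monic of the same degree, so their difference has lower degree; it
  vanishes at as many distinct points as that degree would have to exceed, hence
  identically.\<close>

lemma Lambda_factorization:
  assumes "inj_on r {1..2 * g + 1}" and "{x. Lambda g lam x = 0} = r ` {1..2 * g + 1}"
  shows "Lambda g lam z = (\<Prod>j\<in>{1..2 * g + 1}. z - r j)"
proof -
  define N where "N = 2 * g + 1"
  define L where "L = monom 1 N + (\<Sum>i=0..2*g. monom (lam (2*i + 2)) (2*g - i))"
  define P where "P = (\<Prod>j\<in>{1..N}. [:- r j, 1:])"
  have L: "poly L x = Lambda g lam x" for x
    by (simp add: L_def Lambda_def N_def poly_monom poly_sum)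
  have P: "poly P x = (\<Prod>j\<in>{1..N}. x - r j)" for x by (simp add: P_def poly_prod)
  have dP: "degree P = N" unfolding P_def by (subst degree_prod_sum_eq) auto
  have lP: "coeff P N = 1"
    using lead_coeff_prod[of "\<lambda>j. [:- r j, 1:]" "{1..N}"] dP by (simp add: P_def)
  have lower: "degree (\<Sum>i=0..2*g. monom (lam (2*i + 2)) (2*g - i)) < N"
  proof -
    have "degree (\<Sum>i=0..2*g. monom (lam (2*i + 2)) (2*g - i)) \<le> 2 * g"
      by (intro degree_sum_le) (auto intro: order_trans[OF degree_monom_le])
    then show ?thesis by (simp add: N_def)
  qed
  then have lL: "coeff L N = 1" by (simp add: L_def coeff_eq_0)
  have "degree L \<le> N" unfolding L_def using lower by (intro degree_add_le degree_monom_le) auto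
  then have dR: "degree (L - P) \<le> N" using dP by (intro degree_diff_le) auto
  have "L - P = 0"
  proof (rule ccontr)
    assume nz: "L - P \<noteq> 0"
    have "coeff (L - P) N = 0" using lL lP by simp
    then have "degree (L - P) \<noteq> N" using nz leading_coeff_0_iff[of "L - P"] by metis
    with dR have d: "degree (L - P) < N" by simp
    have "poly (L - P) (r j) = 0" if "j \<in> {1..N}" for j
    proof -
      have "Lambda g lam (r j) = 0" using assms(2) that by (auto simp: N_def)
      moreover have "(\<Prod>i\<in>{1..N}. r j - r i) = 0" using that by (intro prod_zero) auto
      ultimately show ?thesis by (simp add: L P)
    qed
    then have "r ` {1..N} \<subseteq> {x. poly (L - P) x = 0}" by blast
    then have "card (r ` {1..N}) \<le> card {x. poly (L - P) x = 0}"
      by (intro card_mono poly_roots_finite nz)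
    then have "N \<le> degree (L - P)"
      using card_poly_roots_bound[OF nz] card_image[OF assms(1)] by (simp add: N_def)
    with d show False by simp
  qed
  then show ?thesis using L[of z] P[of z] by (simp add: N_def)
qed

text \<open>The quotient of two square roots is continuous with values in \<open>{1, -1}\<close> on
  the connected half-plane, so it is a constant sign.\<close>

lemma sqrt_branch_eq:
  assumes "real_branch_points g e" and Y: "sqrt_branch L Y"
    and L: "\<And>z. L z = (\<Prod>j\<in>{1..2 * g + 1}. z - complex_of_real (e j))"
  obtains s where "s = 1 \<or> s = -1"
    "\<And>x. x \<notin> real_branch_points.E g e \<Longrightarrow> boundary_value Y x = s * real_branch_points.sqrt_curve g e (Complex x 0)"
proof -
  interpret real_branch_points g e by fact
  define H where "H = {z. Im z > 0}"
  have H: "open H" "convex H" unfolding H_def by (rule open_upper_half_plane convex_upper_half_plane)+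
  have nz: "sqrt_curve z \<noteq> 0" if "z \<in> H" for z using that sqrt_curve_nonzero by (auto simp: H_def)
  have sq: "(Y z / sqrt_curve z) ^ 2 = 1" if "z \<in> H" for z
  proof -
    have "Y z ^ 2 = L z" using Y that by (simp add: sqrt_branch_def H_def)
    also have "\<dots> = sqrt_curve z ^ 2" by (simp only: L sqrt_curve_square N_def)
    finally show ?thesis using nz[OF that] by (simp add: power_divide)
  qed
  have pm: "Y z / sqrt_curve z = 1 \<or> Y z / sqrt_curve z = -1" if "z \<in> H" for z
    using sq[OF that] by (simp add: power2_eq_1_iff)
  have "continuous_on H (\<lambda>z. Y z / sqrt_curve z)"
    using Y nz sqrt_curve_holomorphic unfolding sqrt_branch_def H_def
    by (intro continuous_intros holomorphic_on_imp_continuous_on) auto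
  moreover have "finite ((\<lambda>z. Y z / sqrt_curve z) ` H)"
  proof (rule finite_subset)
    show "(\<lambda>z. Y z / sqrt_curve z) ` H \<subseteq> {1, -1}" using pm by blast
  qed simp
  ultimately have "(\<lambda>z. Y z / sqrt_curve z) constant_on H"
    by (intro continuous_finite_range_constant convex_connected H)
  then obtain s where s: "\<And>z. z \<in> H \<Longrightarrow> Y z / sqrt_curve z = s" unfolding constant_on_def by blast
  have "\<i> \<in> H" by (simp add: H_def)
  then have s1: "s = 1 \<or> s = -1" using pm s by metis
  have Ys: "Y z = s * sqrt_curve z" if "z \<in> H" for z using s[OF that] nz[OF that] by (simp add: field_simps)
  show thesis
  proof (rule that[OF s1])
    fix x assume x: "x \<notin> E"
    have "(sqrt_curve \<longlongrightarrow> sqrt_curve (Complex x 0)) (at (Complex x 0) within H)"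
      using isCont_sqrt_curve[of "Complex x 0"] x by (simp add: isCont_def tendsto_within_subset[of _ _ _ UNIV])
    then have "((\<lambda>z. s * sqrt_curve z) \<longlongrightarrow> s * sqrt_curve (Complex x 0)) (at (Complex x 0) within H)"
      by (intro tendsto_intros)
    moreover have "\<forall>\<^sub>F z in at (Complex x 0) within H. s * sqrt_curve z = Y z"
      unfolding eventually_at_filter by (rule always_eventually) (simp add: Ys)
    ultimately have "(Y \<longlongrightarrow> s * sqrt_curve (Complex x 0)) (at (Complex x 0) within H)"
      by (rule Lim_transform_eventually)
    \<comment> \<open>\<open>Lim\<close> returns the limit only if it is unique, so the real point
      must be a limit point of the half-plane.\<close>
    moreover have "at (Complex x 0) within H \<noteq> bot"
    proof -
      have "Complex x 0 islimpt H"
        unfolding islimpt_approachable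
      proof (intro allI impI)
        fix d :: real assume "d > 0"
        then have "Complex x (d/2) \<in> H" "Complex x (d/2) \<noteq> Complex x 0" "dist (Complex x (d/2)) (Complex x 0) < d"
          by (auto simp: H_def dist_norm cmod_def)
        then show "\<exists>x'\<in>H. x' \<noteq> Complex x 0 \<and> dist x' (Complex x 0) < d" by blast
      qed
      then show ?thesis by (simp add: trivial_limit_within)
    qed
    ultimately show "boundary_value Y x = s * sqrt_curve (Complex x 0)"
      unfolding boundary_value_def H_def complex_of_real_def by (intro tendsto_Lim)
  qed
qed

text \<open>The sign \<open>s\<close> moves from the denominator to the numerator because
  \<open>1 / s = s\<close>. The branch points form a negligible set, so the boundary values there do
  not matter.\<close>

lemma real_axis_integral_du:
  assumes "real_branch_points g e" and s: "s = 1 \<or> s = -1"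
    and Y: "\<And>x. x \<notin> real_branch_points.E g e \<Longrightarrow> boundary_value Y x = s * real_branch_points.sqrt_curve g e (Complex x 0)"
  shows "2 * real_axis_integral Y (du g n) (e m) (e (m + 1))
    = - s * real_branch_points.interval_period g e (monom 1 (g - n)) m"
proof -
  interpret real_branch_points g e by fact
  have "integral {e m..e (m + 1)} (\<lambda>x. du g n (complex_of_real x) (boundary_value Y x))
     = integral {e m..e (m + 1)} (\<lambda>x. (- s / 2) * form (monom 1 (g - n)) (Complex x 0))"
  proof (rule integral_spike[OF negligible_finite[OF finite_E]])
    fix x assume "x \<in> {e m..e (m + 1)} - E"
    then have x: "x \<notin> E" by simp
    show "(- s / 2) * form (monom 1 (g - n)) (Complex x 0) = du g n (complex_of_real x) (boundary_value Y x)"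
      using s by (auto simp: du_def Y[OF x] form_def poly_monom complex_of_real_def)
  qed
  then show ?thesis by (simp add: real_axis_integral_def interval_period_def)
qed

theorem omega_eq:
  fixes e :: "nat \<Rightarrow> real"
  assumes mono: "strict_mono_on {1..2 * CARD('g::{finite,linorder}) + 1} e"
    and roots: "{x. Lambda CARD('g) lam x = 0} = (\<lambda>i. complex_of_real (e i)) ` {1..2 * CARD('g) + 1}"
    and Y: "sqrt_branch (Lambda CARD('g) lam) Y"
  obtains A B :: "((real, 'g::{finite,linorder}) vec, 'g) vec" where "omega e Y = cmat A" "omega' e Y = (\<chi> i j. \<i> * complex_of_real (B $ i $ j))"
    "transpose (A ** transpose B) = A ** transpose B"
    "\<And>v. v \<noteq> 0 \<Longrightarrow> 0 < v \<bullet> ((A ** transpose B) *v v)"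
proof -
  have rbp: "real_branch_points CARD('g) e" by unfold_locales (use mono in auto)
  interpret real_branch_points "CARD('g)" e by fact
  have "inj_on (\<lambda>i. complex_of_real (e i)) {1..2 * CARD('g) + 1}"
    using strict_mono_on_imp_inj_on[OF mono] unfolding inj_on_def of_real_eq_iff .
  then have "Lambda CARD('g) lam z = (\<Prod>j\<in>{1..2 * CARD('g) + 1}. z - complex_of_real (e j))" for z
    by (rule Lambda_factorization) (rule roots)
  then obtain s where s: "s = 1 \<or> s = -1"
    and Ys: "\<And>x. x \<notin> E \<Longrightarrow> boundary_value Y x = s * sqrt_curve (Complex x 0)"
    using sqrt_branch_eq[OF rbp Y] by blast
  have "\<exists>\<sigma>::real. s = complex_of_real \<sigma> \<and> \<sigma> * \<sigma> = 1"
    using s by (elim disjE) (auto intro: exI[of _ 1] exI[of _ "-1"])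
  then obtain \<sigma> where \<sigma>: "s = complex_of_real \<sigma>" "\<sigma> * \<sigma> = 1" by blast
  have real: "real_on_line (basis_poly n)" for n :: 'g
    by (simp add: real_on_line_def basis_poly_def poly_monom flip: of_real_power)
  have int: "2 * real_axis_integral Y (du CARD('g) (ix n)) (e m) (e (m + 1)) = - s * interval_period (basis_poly n) m" for n :: 'g and m
    unfolding basis_poly_def by (rule real_axis_integral_du[OF rbp s Ys])
  define A where "A = (- \<sigma>) *\<^sub>R (a_matrix e :: ((real, 'g) vec, 'g) vec)"
  define B where "B = (- \<sigma>) *\<^sub>R (b_matrix e :: ((real, 'g) vec, 'g) vec)"
  have AB: "A ** transpose B = a_matrix e ** transpose (b_matrix e)"
  proof -
    \<comment> \<open>The unknown sign of the branch enters \<open>A\<close> and \<open>B\<close>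
      alike and disappears from their product.\<close>
    have c: "\<sigma> * x * (\<sigma> * y) = x * y" for x y :: real
      using \<sigma>(2) by (metis mult.assoc mult.left_commute mult_1)
    show ?thesis by (simp add: vec_eq_iff A_def B_def matrix_matrix_mult_def transpose_def c)
  qed
  show thesis
  proof (rule that)
    have "omega e Y $ n $ k = cmat A $ n $ k" for n k :: 'g
    proof -
      have k: "ix k \<in> {1..CARD('g)}" by (rule ix_bounds)
      then have "2 * ix k - 1 + 1 = 2 * ix k" by auto
      then have "omega e Y $ n $ k = - s * interval_period (basis_poly n) (2 * ix k - 1)"
        using int[of n "2 * ix k - 1"] by (simp add: omega_def)
      then have "omega e Y $ n $ k = - s * complex_of_real (a_period (basis_poly n) (ix k))"
        by (simp only: interval_period_cut[OF degree_basis_poly real k])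
      then show ?thesis by (simp add: cmat_def A_def a_matrix_def \<sigma>)
    qed
    then show "omega e Y = cmat A" by (simp add: vec_eq_iff)
    have "omega' e Y $ n $ k = \<i> * complex_of_real (B $ n $ k)" for n k :: 'g
    proof -
      have k: "ix k \<in> {1..CARD('g)}" by (rule ix_bounds)
      have "omega' e Y $ n $ k = (\<Sum>i=ix k..CARD('g). - s * interval_period (basis_poly n) (2 * i))"
        using int[of n] by (simp add: omega'_def sum_distrib_left)
      also have "\<dots> = (\<Sum>i=ix k..CARD('g). - s * (\<i> * complex_of_real (Im (interval_period (basis_poly n) (2 * i)))))"
      proof (intro sum.cong refl)
        fix i assume "i \<in> {ix k..CARD('g)}"
        then have "i \<in> {1..CARD('g)}" using k by auto
        from interval_period_gap[OF degree_basis_poly real this]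
        show "- s * interval_period (basis_poly n) (2 * i) = - s * (\<i> * complex_of_real (Im (interval_period (basis_poly n) (2 * i))))"
          by (rule arg_cong)
      qed
      also have "\<dots> = \<i> * complex_of_real (B $ n $ k)"
        by (simp add: B_def b_matrix_def b_period_def \<sigma> sum_distrib_left sum_negf mult.left_commute)
      finally show ?thesis .
    qed
    then show "omega' e Y = (\<chi> i j. \<i> * complex_of_real (B $ i $ j))" by (simp add: vec_eq_iff)
    show "transpose (A ** transpose B) = A ** transpose B"
      unfolding AB by (rule a_b_matrix_relations(1)[OF rbp])
    show "0 < v \<bullet> ((A ** transpose B) *v v)" if "v \<noteq> 0" for v
      unfolding AB by (rule a_b_matrix_relations(2)[OF rbp that])
  qed
qed

subsection \<open>Zeros of the sigma function on the real affine subspaces\<close>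

definition half_indicator :: "'n set \<Rightarrow> real^'n::finite" where
  "half_indicator I = (\<chi> j. if j \<in> I then 1/2 else 0)"

context posdef_form
begin

lemma Theta_full_nonzero: "Theta (half_indicator UNIV + (\<chi> j. 1/2)) x \<noteq> 0"
proof -
  have "(half_indicator UNIV :: real^'n) + (\<chi> j. 1/2) = 0 + real_vec (\<chi> j. (1::int))"
    by (simp add: half_indicator_def real_vec_def vec_eq_iff)
  then show ?thesis using Theta_0_nonzero by (simp only: Theta_add_int not_False_eq_True)
qed

lemma Theta_proper_zero:
  assumes "I \<noteq> UNIV"
  obtains x where "Theta (half_indicator I + (\<chi> j. 1/2)) x = 0"
proof -
  obtain k where k: "k \<notin> I" using assms by blast
  have "2 *\<^sub>R (half_indicator I + (\<chi> j. 1/2)) = real_vec (\<chi> j. if j \<in> I then 2 else 1)"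
    by (simp add: half_indicator_def real_vec_def vec_eq_iff)
  moreover have "odd ((\<chi> j. if j \<in> I then 2 else (1::int)) $ k)" using k by simp
  ultimately show thesis using Theta_half_int_zero that by blast
qed

end

theorem proposition2:
  fixes lam :: "nat \<Rightarrow> complex" and e :: "nat \<Rightarrow> real"
    and Y :: "complex \<Rightarrow> complex" and C :: complex
  assumes "lam 0 = 1"
    and "strict_mono_on {1..2 * CARD('g::{finite,linorder}) + 1} e"
    and "{x. Lambda CARD('g) lam x = 0} = (\<lambda>i. complex_of_real (e i)) ` {1..2 * CARD('g) + 1}"
    and "sqrt_branch (Lambda CARD('g) lam) Y"
    and "C \<noteq> 0"
  shows "card (range (U_Re e Y :: 'g set \<Rightarrow> 'g cvec set)) = 2 ^ CARD('g)
    \<and> (\<exists>!S. S \<in> range (U_Re e Y :: 'g set \<Rightarrow> 'g cvec set) \<and> (\<forall>u\<in>S. sigma_fun lam e Y C u \<noteq> 0))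
    \<and> (\<forall>u\<in>U_Re e Y (UNIV :: 'g set). sigma_fun lam e Y C u \<noteq> 0)
    \<and> Omega' e Y (UNIV :: 'g set) = (\<Sum>k\<in>UNIV. (1/2) *s column k (omega' e Y))
    \<and> U_Re e Y (UNIV :: 'g set) = {cvec_of_real s + Omega' e Y UNIV | s. True}"
proof -
  obtain A B :: "((real, 'g) vec, 'g) vec" where omega: "omega e Y = cmat A"
    and omega': "omega' e Y = (\<chi> i j. \<i> * complex_of_real (B $ i $ j))"
    and sym: "transpose (A ** transpose B) = A ** transpose B"
    and pos: "\<And>v. v \<noteq> 0 \<Longrightarrow> 0 < v \<bullet> ((A ** transpose B) *v v)"
    using omega_eq[OF assms(2-4)] by blast
  have A: "invertible A" and B: "invertible B"
    and T_sym: "transpose (matrix_inv A ** B) = matrix_inv A ** B"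
    by (rule bilinear_relations_matrix[OF sym], erule pos)+
  have T_pos: "0 < v \<bullet> ((matrix_inv A ** B) *v v)" if "v \<noteq> 0" for v
    by (rule bilinear_relations_matrix(4)[OF sym _ that]) (rule pos)
  define Ai where "Ai = matrix_inv A"
  have Ai: "A ** Ai = mat 1" "Ai ** A = mat 1" 
    unfolding Ai_def by (rule matrix_inv_inverse[OF A])+
  interpret posdef_form "Ai ** B"
    unfolding Ai_def by unfold_locales (rule T_sym, erule T_pos)
  have inv_omega: "matrix_inv (omega e Y) = (cmat Ai :: 'g cmat)"
    unfolding omega by (rule matrix_inv_eq) (simp_all only: cmat_mult[symmetric] Ai cmat_mat_1)
  have tau: "tau e Y = Tc"
    unfolding tau_def inv_omega omega' Tc_def
    by (simp add: cmat_def matrix_matrix_mult_def vec_eq_iff sum_distrib_left mult.left_commute)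
  \<comment> \<open>The shift is purely imaginary; after \<open>matrix_inv (omega e Y)\<close> it
    becomes \<open>Tc\<close> applied to \<open>half_indicator I\<close>, while real vectors stay
    real.\<close>
  have Om: "Omega' e Y I = \<i> *s cvec_of_real (B *v half_indicator I)" for I
  proof -
    have "Omega' e Y I $ n = (\<i> *s cvec_of_real (B *v half_indicator I)) $ n" for n
    proof -
      have "Omega' e Y I $ n = (\<Sum>k\<in>I. \<i> * complex_of_real (B $ n $ k * (1/2)))"
        by (simp add: Omega'_def omega' column_def mult.commute)
      also have "\<dots> = (\<Sum>k\<in>UNIV. \<i> * complex_of_real (B $ n $ k * half_indicator I $ k))"
        by (rule sum.mono_neutral_cong_left) (auto simp: half_indicator_def)
      also have "\<dots> = (\<i> *s cvec_of_real (B *v half_indicator I)) $ n"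
        by (simp add: cvec_of_real_def matrix_vector_mult_def sum_distrib_left)
      finally show ?thesis .
    qed
    then show ?thesis by (simp add: vec_eq_iff)
  qed
  \<comment> \<open>The lower characteristic of \<open>K_char\<close> acts as a fixed real
    translation, harmless because \<open>s\<close> runs through all real vectors.\<close>
  define b where "b = (1/2) *\<^sub>R real_vec (snd (K_char :: 'g characteristic))"
  have zero_iff: "sigma_fun lam e Y C (Omega' e Y I + cvec_of_real s) = 0
      \<longleftrightarrow> Theta (half_indicator I + (\<chi> j. 1/2)) (Ai *v s + b) = 0" for I s
  proof -
    have "cmat Ai *v (Omega' e Y I + cvec_of_real s) = cvec_of_real (Ai *v s) + Tc *v cvec_of_real (half_indicator I)"
      by (simp add: Om matrix_vector_right_distrib vector_scalar_commute cmat_mult_cvec_of_real Tc_cvec_of_real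
          matrix_vector_mul_assoc add.commute)
    moreover have "fst (K_char :: 'g characteristic) = (\<chi> j. 1)" by (simp add: K_char_eq)
    ultimately show ?thesis
      unfolding sigma_fun_def inv_omega tau b_def
      using theta_char_eq_0_iff assms(5) by simp
  qed
  have nonzero: "\<forall>u\<in>U_Re e Y (UNIV :: 'g set). sigma_fun lam e Y C u \<noteq> 0"
    using Theta_full_nonzero by (auto simp: U_Re_def zero_iff)
  have zero: "\<exists>u\<in>U_Re e Y I. sigma_fun lam e Y C u = 0" if I: "I \<noteq> UNIV" for I :: "'g set"
  proof -
    obtain x where x: "Theta (half_indicator I + (\<chi> j. 1/2)) x = 0" using Theta_proper_zero[OF I] by blast
    \<comment> \<open>The real period matrix is invertible, so every real argument of the theta
      series is attained on the subspace.\<close>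
    have "Ai *v (A *v (x - b)) + b = x" by (simp add: matrix_vector_mul_assoc Ai)
    then have "sigma_fun lam e Y C (Omega' e Y I + cvec_of_real (A *v (x - b))) = 0"
      using x by (simp only: zero_iff)
    then show ?thesis by (auto simp: U_Re_def)
  qed
  \<comment> \<open>Imaginary parts are constant on each subspace and equal
    \<open>B *v half_indicator I\<close>; invertibility of \<open>B\<close> recovers
    \<open>I\<close>, so the subsets give pairwise different subspaces.\<close>
  have "inj (U_Re e Y :: 'g set \<Rightarrow> 'g cvec set)"
  proof (rule injI)
    fix I J :: "'g set" assume eq: "U_Re e Y I = U_Re e Y J"
    have "Omega' e Y I + cvec_of_real 0 \<in> U_Re e Y I" by (simp add: U_Re_def)
    then obtain s where s: "Omega' e Y I + cvec_of_real 0 = Omega' e Y J + cvec_of_real s"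
      unfolding eq by (auto simp: U_Re_def)
    have "(B *v half_indicator I) $ n = (B *v half_indicator J) $ n" for n
      using arg_cong[OF s, of "\<lambda>v. Im (v $ n)"] by (simp add: Om cvec_of_real_def)
    then have "B *v half_indicator I = B *v half_indicator J" by (simp add: vec_eq_iff)
    then have "matrix_inv B *v (B *v half_indicator I) = matrix_inv B *v (B *v half_indicator J)"
      by (simp only:)
    then have h: "half_indicator I = half_indicator J"
      by (simp only: matrix_vector_mul_assoc matrix_inv_inverse(2)[OF B] matrix_vector_mul_lid)
    have "j \<in> I \<longleftrightarrow> j \<in> J" for j
      using arg_cong[OF h, of "\<lambda>v. v $ j"] by (auto simp: half_indicator_def split: if_splits)
    then show "I = J" by blast
  qed
  then have "card (range (U_Re e Y :: 'g set \<Rightarrow> 'g cvec set)) = card (Pow (UNIV :: 'g set))"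
    by (simp add: card_image)
  then have card: "card (range (U_Re e Y :: 'g set \<Rightarrow> 'g cvec set)) = 2 ^ CARD('g)"
    by (simp only: card_Pow finite)
  have unique: "\<exists>!S. S \<in> range (U_Re e Y :: 'g set \<Rightarrow> 'g cvec set) \<and> (\<forall>u\<in>S. sigma_fun lam e Y C u \<noteq> 0)"
  proof (rule ex1I[of _ "U_Re e Y UNIV"])
    fix S :: "'g cvec set"
    assume S: "S \<in> range (U_Re e Y) \<and> (\<forall>u\<in>S. sigma_fun lam e Y C u \<noteq> 0)"
    then obtain I where "S = U_Re e Y I" by blast
    then show "S = U_Re e Y UNIV" using S zero[of I] by (cases "I = UNIV") auto
  qed (use nonzero in simp)
  have "U_Re e Y (UNIV :: 'g set) = {cvec_of_real s + Omega' e Y UNIV | s. True}"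
    unfolding U_Re_def by (auto simp: add.commute)
  with card unique nonzero Omega'_def[of e Y UNIV] show ?thesis by (intro conjI)
qed

end
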